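(* Let $d \geq 2$ and $G = \mathrm{SO}(d,1)$. For a lattice $\Gamma<G$, let $f(\Gamma)$ denote the number of conjugacy classes (under conjugation in $\Gamma$) of maximal finite subgroups of $\Gamma$. Then there exists a sequence of lattices $\Gamma_n < G$ such that $\mathrm{vol}(G/\Gamma_n) \to \infty$ and $$\liminf_{n\to\infty} \frac{f(\Gamma_n)}{\mathrm{vol}(G/\Gamma_n)} > 0.$$
   Context: A Haar measure on $G$ is fixed, and $\mathrm{vol}(G/\Gamma)$ is the covolume of $\Gamma$ with respect to it. A maximal finite subgroup of $\Gamma$ is a finite subgroup not properly contained in any other finite subgroup of $\Gamma$. *)

theory Defs
  imports "HOL-Analysis.Analysis" "HOL-Algebra.Left_Coset" "HOL-Algebra.Group_Action"
begin

text \<open>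
  The coordinates of \<open>\<real>\<^bsup>d,1\<^esup>\<close> are indexed by the type \<open>'d option\<close>, where \<open>d = CARD('d)\<close>: the
  indices \<open>Some i\<close> are the \<open>d\<close> positive directions, \<open>None\<close> is the negative one.
\<close>

definition lorentz_form :: "real ^ ('d::finite option) ^ ('d option)" where
  "lorentz_form = (\<chi> i j. if i \<noteq> j then 0 else if i = None then - 1 else 1)"

definition SO_d_1 :: "(real ^ ('d::finite option) ^ ('d option)) monoid" where
  "SO_d_1 = \<lparr>carrier = {A. transpose A ** lorentz_form ** A = lorentz_form \<and> det A = 1},
             mult = (**), one = mat 1\<rparr>"

text \<open>
  Left Haar measures. No regularity condition is imposed: on a second countable locally compact
  group, every Borel measure that is finite on compact sets is regular.
\<close>

definition haar_measure :: "('a::topological_space) monoid \<Rightarrow> 'a measure \<Rightarrow> bool" where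
  "haar_measure G \<mu> \<longleftrightarrow>
     sets \<mu> = sets (restrict_space borel (carrier G)) \<and>
     (\<forall>g\<in>carrier G. \<forall>A\<in>sets \<mu>. emeasure \<mu> (g <#\<^bsub>G\<^esub> A) = emeasure \<mu> A) \<and>
     (\<forall>K. K \<subseteq> carrier G \<and> compact K \<longrightarrow> emeasure \<mu> K < \<infinity>) \<and>
     emeasure \<mu> (carrier G) \<noteq> 0"

text \<open>
  The covolume is the measure of a measurable set of representatives of \<open>G/\<Gamma>\<close>. If \<open>\<Gamma>\<close> is discrete
  in \<open>SO(d,1)\<close>, such sets exist, and their measures agree because \<open>SO(d,1)\<close> is unimodular.
\<close>

definition fundamental_domain ::
    "('a::topological_space) monoid \<Rightarrow> 'a measure \<Rightarrow> 'a set \<Rightarrow> 'a set \<Rightarrow> bool" where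
  "fundamental_domain G \<mu> \<Gamma> F \<longleftrightarrow> F \<in> sets \<mu> \<and> (\<forall>C\<in>lcosets\<^bsub>G\<^esub> \<Gamma>. \<exists>!x. x \<in> C \<inter> F)"

definition covolume ::
    "('a::topological_space) monoid \<Rightarrow> 'a measure \<Rightarrow> 'a set \<Rightarrow> ennreal" where
  "covolume G \<mu> \<Gamma> = (THE v. \<exists>F. fundamental_domain G \<mu> \<Gamma> F \<and> v = emeasure \<mu> F)"

definition lattice_in ::
    "('a::topological_space) monoid \<Rightarrow> 'a measure \<Rightarrow> 'a set \<Rightarrow> bool" where
  "lattice_in G \<mu> \<Gamma> \<longleftrightarrow> subgroup \<Gamma> G \<and> discrete \<Gamma> \<and> covolume G \<mu> \<Gamma> < \<infinity>"

definition maximal_finite_subgroups :: "('a, 'b) monoid_scheme \<Rightarrow> 'a set set" where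
  "maximal_finite_subgroups G =
     {H. subgroup H G \<and> finite H \<and> (\<forall>K. subgroup K G \<and> finite K \<and> H \<subseteq> K \<longrightarrow> K = H)}"

definition max_finite_classes :: "('a, 'b) monoid_scheme \<Rightarrow> 'a set set set" where
  "max_finite_classes G =
     orbits G (maximal_finite_subgroups G) (\<lambda>g H. g <#\<^bsub>G\<^esub> H #>\<^bsub>G\<^esub> inv\<^bsub>G\<^esub> g)"

text \<open>
  The counting measure is the cardinality with value \<open>\<infinity>\<close> on infinite sets, where \<^const>\<open>card\<close>
  would be \<open>0\<close>.
\<close>

definition num_max_finite_classes :: "('a, 'b) monoid_scheme \<Rightarrow> ennreal" where
  "num_max_finite_classes G = emeasure (count_space UNIV) (max_finite_classes G)"

lemma group_SO_d_1: "group (SO_d_1 :: (real ^ ('d::finite option) ^ ('d option)) monoid)"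
proof (rule groupI)
  let ?J = "lorentz_form :: real ^ ('d option) ^ ('d option)"
  fix x y z :: "real ^ ('d option) ^ ('d option)"
  show "\<one>\<^bsub>SO_d_1\<^esub> \<in> carrier (SO_d_1 :: (real ^ ('d option) ^ ('d option)) monoid)"
    by (simp add: SO_d_1_def)
  assume x: "x \<in> carrier SO_d_1"
  then have xJ: "transpose x ** ?J ** x = ?J" and dx: "det x = 1"
    by (auto simp: SO_d_1_def)
  show "\<one>\<^bsub>SO_d_1\<^esub> \<otimes>\<^bsub>SO_d_1\<^esub> x = x" by (simp add: SO_d_1_def)
  show "\<exists>y\<in>carrier SO_d_1. y \<otimes>\<^bsub>SO_d_1\<^esub> x = \<one>\<^bsub>SO_d_1\<^esub>"
  proof -
    obtain w where w: "w ** x = mat 1" "x ** w = mat 1"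
      using dx invertible_det_nz[of x] by (auto simp: invertible_def)
    have dw: "det w = 1"
      using arg_cong[OF w(1), of det] dx by (simp add: det_mul)
    have tw: "transpose w ** transpose x = mat 1"
      using w(2) by (metis matrix_transpose_mul transpose_mat)
    have "transpose w ** ?J ** w = transpose w ** (transpose x ** ?J ** x) ** w"
      by (simp add: xJ)
    also have "\<dots> = (transpose w ** transpose x) ** ?J ** (x ** w)"
      by (simp add: matrix_mul_assoc)
    finally have "transpose w ** ?J ** w = ?J" by (simp add: tw w)
    then have "w \<in> carrier SO_d_1" using dw by (simp add: SO_d_1_def)
    then show ?thesis using w by (auto simp: SO_d_1_def)
  qed
  assume y: "y \<in> carrier SO_d_1"
  then have yJ: "transpose y ** ?J ** y = ?J" and dy: "det y = 1"
    by (auto simp: SO_d_1_def)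
  have "transpose (x ** y) ** ?J ** (x ** y) = transpose y ** (transpose x ** ?J ** x) ** y"
    by (simp add: matrix_transpose_mul matrix_mul_assoc)
  then show "x \<otimes>\<^bsub>SO_d_1\<^esub> y \<in> carrier SO_d_1"
    using xJ yJ dx dy by (simp add: SO_d_1_def det_mul)
  show "x \<otimes>\<^bsub>SO_d_1\<^esub> y \<otimes>\<^bsub>SO_d_1\<^esub> z = x \<otimes>\<^bsub>SO_d_1\<^esub> (y \<otimes>\<^bsub>SO_d_1\<^esub> z)"
    by (simp add: SO_d_1_def matrix_mul_assoc)
qed

end

theory Submission
  imports Defs "HOL-Algebra.Multiplicative_Group"
begin

section \<open>Lattices in SO(d,1) with many classes of maximal finite subgroups\<close>

text \<open>
  Let \<open>\<Gamma>\<close> be the group of integral matrices in \<open>SO(d,1)\<close> that are congruent modulo three to the identity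
  or to the involution \<open>\<tau>\<close> negating two coordinates, one positive and one negative, according to whether
  they preserve or reverse time. Counting with sign the walls \<open>v\<close> (integral vectors of norm one congruent
  to the unit vector of the positive coordinate that \<open>\<tau>\<close> negates) that separate a base point from its image gives a homomorphism
  \<open>\<phi>\<close> from \<open>\<Gamma>\<close> to the integers. It is not zero: two walls have product one modulo nine, so there is no
  room for a wall crossed in the opposite direction between two walls of product \<open>55\<close>. The centralizer of
  \<open>\<tau>\<close> fixes the base point, because the form \<open>x\<^sup>2 - y\<^sup>2\<close> has finitely many integral isometries; hence \<open>\<phi>\<close>
  vanishes on it. As the congruence subgroup of level three is torsion-free, \<open>\<tau>\<close> and its conjugates
  generate maximal finite subgroups. In the preimage of \<open>n \<int>\<close> under \<open>\<phi>\<close>, whose covolume is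
  proportional to \<open>n\<close>, the conjugates of \<open>\<tau>\<close> by the first \<open>n\<close> powers of an element are pairwise not
  conjugate.

  That \<open>\<Gamma>\<close> has finite covolume is reduction theory. Integral lattices without short vectors form a
  compact set by Minkowski's theorem. A short primitive vector is null, and stretching its direction
  leads back to the compact set; this describes the rest of the group by finitely many cusps, whose
  measure is bounded by packing horospherical translates. Both the packing and the independence of the
  covolume from the fundamental domain use that Haar measure is unimodular.
\<close>

subsection \<open>The Lorentz form\<close>

text \<open>Level three does two jobs: it removes torsion, and it tells \<open>v\<close> from
  \<open>- v\<close>, so that a hyperplane carries at most one wall and crossings have a sign. The
  difficulty is to keep an involution that respects this sign and whose centralizer is invisible to
  \<open>phi\<close>. Elements act on hyperbolic space through \<open>act\<close>, with a sign that
  keeps the time direction; so \<open>tau\<close> fixes the base point and the normal vector of the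
  wall through it, and its fixed set is a geodesic crossing that wall. A translation along this
  geodesic could commute with \<open>tau\<close> and cross walls. It is excluded since the geodesic
  spans a plane with rational null lines, which integral isometries cannot stretch. The centralizer
  thus lies in the preimage of every subgroup of the integers, and the class of \<open>tau\<close>
  splits into as many classes as the index of this normal subgroup. As for 55: a wall with products
  at most -8 with two others lies between them only if their product is at least
  \<open>2 * 8\<^sup>2 - 1 = 127\<close>, by the doubling formula for the hyperbolic cosine.\<close>

type_synonym 'd lvec = "real ^ ('d option)"
type_synonym 'd lmat = "real ^ ('d option) ^ ('d option)"

abbreviation SO :: "('d::finite) lmat set" where "SO \<equiv> carrier SO_d_1"

definition lip :: "('d::finite) lvec \<Rightarrow> 'd lvec \<Rightarrow> real" where
  "lip x y = x \<bullet> (lorentz_form *v y)"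

lemma UNIV_option_sum: "(\<Sum>i\<in>UNIV. f i) = f None + (\<Sum>i\<in>UNIV. f (Some i))"
  for f :: "'d::finite option \<Rightarrow> 'b::comm_monoid_add"
  by (simp add: UNIV_option_conv sum.reindex)

lemma lorentz_form_mult_nth:
  "(lorentz_form *v y) $ i = (if i = None then - (y $ None) else y $ i)"
proof -
  have "(lorentz_form *v y) $ i = (\<Sum>j\<in>UNIV. if i = j then (if i = None then - 1 else 1) * y $ j else 0)"
    unfolding matrix_vector_mult_def lorentz_form_def vec_lambda_beta
    by (intro sum.cong) auto
  then show ?thesis by simp
qed

lemma lip_expand: "lip x y = (\<Sum>i\<in>UNIV. x $ Some i * y $ Some i) - x $ None * y $ None"
  by (simp add: lip_def inner_vec_def UNIV_option_sum lorentz_form_mult_nth)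

lemma lorentz_form_transpose: "transpose lorentz_form = lorentz_form"
  by (simp add: vec_eq_iff transpose_def lorentz_form_def)

lemma lorentz_form_square:
  "lorentz_form ** lorentz_form = (mat 1 :: ('d::finite) lmat)"
proof -
  have "lorentz_form *v (lorentz_form *v x) = x" for x :: "'d lvec"
    by (simp add: vec_eq_iff lorentz_form_mult_nth)
  then show ?thesis by (simp add: matrix_eq matrix_vector_mul_assoc[symmetric])
qed

lemma SO_carrier: "A \<in> SO \<longleftrightarrow> transpose A ** lorentz_form ** A = lorentz_form \<and> det A = 1"
  by (simp add: SO_d_1_def)

lemma lip_sym: "lip x y = lip y x" by (simp add: lip_expand mult.commute)
lemma lip_add: "lip (x + y) z = lip x z + lip y z" "lip z (x + y) = lip z x + lip z y"
  by (simp_all add: lip_expand sum.distrib algebra_simps)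
lemma lip_scale: "lip (c *\<^sub>R x) z = c * lip x z" "lip z (c *\<^sub>R x) = c * lip z x"
  by (simp_all add: lip_expand sum_distrib_left algebra_simps)
lemma lip_minus: "lip (- x) z = - lip x z" "lip z (- x) = - lip z x"
  by (simp_all add: lip_expand sum_negf)
lemma lip_diff: "lip (x - y) z = lip x z - lip y z" "lip z (x - y) = lip z x - lip z y"
  by (simp_all add: lip_expand sum_subtractf algebra_simps)
lemmas lip_simps = lip_add lip_scale lip_minus lip_diff

lemma lip_mult_matrix: "lip (A *v x) (A *v y) = x \<bullet> ((transpose A ** lorentz_form ** A) *v y)"
  unfolding lip_def matrix_vector_mul_assoc[symmetric]
  by (simp only: dot_lmul_matrix[symmetric] vector_transpose_matrix)

lemma isometry_iff: "transpose A ** lorentz_form ** A = lorentz_form \<longleftrightarrow>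
    (\<forall>x y. lip (A *v x) (A *v y) = lip x y)" (is "?l = ?r")
proof
  assume ?l then show ?r by (simp add: lip_mult_matrix) (simp add: lip_def)
next
  assume r: ?r
  have "x \<bullet> ((transpose A ** lorentz_form ** A) *v y) = x \<bullet> (lorentz_form *v y)" for x y
    using r unfolding lip_mult_matrix by (simp add: lip_def)
  then have "(transpose A ** lorentz_form ** A) *v y = lorentz_form *v y" for y
    by (metis vector_eq_ldot)
  then show ?l by (simp add: matrix_eq)
qed

lemma lip_SO: "A \<in> SO \<Longrightarrow> lip (A *v x) (A *v y) = lip x y"
  using isometry_iff SO_carrier by blast

lemma det_lorentz_form_nz: "det (lorentz_form :: ('d::finite) lmat) \<noteq> 0"
  using arg_cong[OF lorentz_form_square[where 'd='d], of det] by (auto simp: det_mul)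

lemma isometry_det:
  fixes A :: "('d::finite) lmat"
  assumes "\<And>x y. lip (A *v x) (A *v y) = lip x y" shows "det A * det A = 1"
proof -
  have "transpose A ** lorentz_form ** A = lorentz_form" using assms isometry_iff by blast
  from arg_cong[OF this, of det] show ?thesis using det_lorentz_form_nz[where 'd='d]
    by (simp add: det_mul) 
qed

text \<open>An isometry has determinant 1 or -1, so its square has determinant one. Eichler
  transformations and boosts have square roots of their own kind, which replaces a computation of
  their determinants.\<close>

lemma isometry_square_SO:
  assumes "\<And>x y. lip (A *v x) (A *v y) = lip x y" shows "A ** A \<in> SO"
  unfolding SO_carrier isometry_iff using assms isometry_det[OF assms]
  by (simp add: det_mul matrix_vector_mul_assoc[symmetric])

text \<open>The inverse of an isometry, written as a formula that makes sense for every matrix: it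
  is continuous on the whole matrix space and visibly preserves integrality.\<close>

definition lorentz_inv :: "('d::finite) lmat \<Rightarrow> 'd lmat"
  where "lorentz_inv A = lorentz_form ** transpose A ** lorentz_form"

lemma lorentz_inv_mult: "lorentz_inv (A ** B) = lorentz_inv B ** lorentz_inv A"
proof -
  have "lorentz_inv B ** lorentz_inv A = lorentz_form ** transpose B ** (lorentz_form ** lorentz_form) ** transpose A ** lorentz_form"
    by (simp only: lorentz_inv_def matrix_mul_assoc)
  then show ?thesis by (simp add: lorentz_form_square lorentz_inv_def matrix_transpose_mul matrix_mul_assoc)
qed

lemma lorentz_inv_involution: "lorentz_inv (lorentz_inv A) = A"
proof -
  have "lorentz_inv (lorentz_inv A) = (lorentz_form ** lorentz_form) ** A ** (lorentz_form ** lorentz_form)"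
    by (simp only: lorentz_inv_def matrix_mul_assoc matrix_transpose_mul lorentz_form_transpose transpose_transpose)
  then show ?thesis by (simp add: lorentz_form_square)
qed

lemma lorentz_inv_one: "lorentz_inv (mat 1) = mat 1"
  by (simp add: lorentz_inv_def lorentz_form_square)

lemma lorentz_inv_left: assumes "A \<in> SO" shows "lorentz_inv A ** A = mat 1"
proof -
  have "lorentz_inv A ** A = lorentz_form ** (transpose A ** lorentz_form ** A)"
    by (simp add: lorentz_inv_def matrix_mul_assoc)
  then show ?thesis using assms by (simp add: SO_carrier lorentz_form_square)
qed

lemma lorentz_inv_right: assumes "A \<in> SO" shows "A ** lorentz_inv A = mat 1"
  using lorentz_inv_left[OF assms] matrix_left_right_inverse by blast

lemma SO_mult: "A \<in> SO \<Longrightarrow> B \<in> SO \<Longrightarrow> A ** B \<in> SO"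
  using group.is_monoid[OF group_SO_d_1, THEN monoid.m_closed, of A B] by (simp add: SO_d_1_def)

lemma SO_one: "mat 1 \<in> SO"
  by (simp add: SO_carrier)

lemma SO_mult_eq [simp]: "x \<otimes>\<^bsub>SO_d_1\<^esub> y = x ** y" "\<one>\<^bsub>SO_d_1\<^esub> = mat 1"
  by (simp_all add: SO_d_1_def)

lemma SO_inv: assumes "A \<in> SO" 
  shows "inv\<^bsub>SO_d_1\<^esub> A = lorentz_inv A" "lorentz_inv A \<in> SO"
proof -
  obtain B where B: "B \<in> SO" "B ** A = mat 1"
    using group.l_inv_ex[OF group_SO_d_1 assms] by auto
  then have "B = lorentz_inv A"
    by (metis assms lorentz_inv_right matrix_mul_assoc matrix_mul_lid matrix_mul_rid)
  with B show *: "lorentz_inv A \<in> SO" by simp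
  show "inv\<^bsub>SO_d_1\<^esub> A = lorentz_inv A"
    using group.inv_equality[OF group_SO_d_1] lorentz_inv_left[OF assms] assms * by auto
qed

lemma lorentz_inv_nth: "lorentz_inv A $ i $ j =
   (if i = None then - 1 else 1) * (if j = None then - 1 else 1) * A $ j $ i"
proof -
  have 1: "(lorentz_form ** B) $ i $ j = (if i = None then - 1 else 1) * B $ i $ j" for i j and B :: "real ^ ('a option) ^ ('a option)"
    unfolding matrix_matrix_mult_def lorentz_form_def vec_lambda_beta
    by (subst sum.mono_neutral_right[of _ "{i}"]) auto
  have 2: "(B ** lorentz_form) $ i $ j = (if j = None then - 1 else 1) * B $ i $ j" for i j and B :: "real ^ ('a option) ^ ('a option)"
    unfolding matrix_matrix_mult_def lorentz_form_def vec_lambda_beta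
    by (subst sum.mono_neutral_right[of _ "{j}"]) auto
  show ?thesis by (simp add: lorentz_inv_def 1 2 transpose_def)
qed

subsection \<open>Eichler transformations and boosts\<close>

text \<open>For null \<open>n\<close> and \<open>w\<close> orthogonal to \<open>n\<close> this is
  the parabolic isometry that translates the horospheres at \<open>n\<close> by \<open>w\<close>;
  the quadratic term corrects the norm.\<close>

definition eichler :: "('d::finite) lvec \<Rightarrow> 'd lvec \<Rightarrow> 'd lvec \<Rightarrow> 'd lvec" where
  "eichler n w x = x + lip x n *\<^sub>R w - lip x w *\<^sub>R n - (lip w w / 2 * lip x n) *\<^sub>R n"

lemma linear_eichler: "linear (eichler n w)"
  by (rule linearI) (simp_all add: eichler_def lip_simps algebra_simps add_divide_distrib)

lemma eichler_isometry:
  assumes "lip n n = 0" "lip n w = 0" shows "lip (eichler n w x) (eichler n w y) = lip x y"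
proof -
  have "lip n x = lip x n" "lip n y = lip y n" "lip w x = lip x w" "lip w y = lip y w" "lip w n = 0"
    using assms by (auto intro: lip_sym simp: lip_sym[of w n])
  then show ?thesis using assms by (simp add: eichler_def lip_simps) (simp add: field_simps)
qed

lemma eichler_add:
  assumes "lip n n = 0" "lip n w = 0" "lip n w' = 0"
  shows "eichler n w (eichler n w' x) = eichler n (w + w') x"
proof -
  have "lip w' w = lip w w'" "lip w n = 0" "lip w' n = 0"
    using assms by (auto simp: lip_sym[of w n] lip_sym[of w' n] lip_sym[of w' w])
  then show ?thesis using assms by (simp add: eichler_def lip_simps algebra_simps add_divide_distrib)
qed

abbreviation Eichler :: "('d::finite) lvec \<Rightarrow> 'd lvec \<Rightarrow> 'd lmat" where
  "Eichler n w \<equiv> matrix (eichler n w)"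

lemma Eichler_works: "Eichler n w *v x = eichler n w x"
  by (simp add: linear_eichler matrix_works)

lemma Eichler_add:
  assumes "lip n n = 0" "lip n w = 0" "lip n w' = 0"
  shows "Eichler n w ** Eichler n w' = Eichler n (w + w')"
  by (simp add: matrix_eq matrix_vector_mul_assoc[symmetric] Eichler_works eichler_add assms)

lemma Eichler_SO: assumes "lip n n = 0" "lip n w = 0" shows "Eichler n w \<in> SO"
proof -
  let ?h = "Eichler n ((1/2) *\<^sub>R w)"
  have "?h ** ?h = Eichler n ((1/2) *\<^sub>R w + (1/2) *\<^sub>R w)"
    by (rule Eichler_add) (use assms in \<open>simp_all add: lip_simps\<close>)
  also have "\<dots> = Eichler n w" by (simp flip: scaleR_left_distrib)
  finally have eq: "?h ** ?h = Eichler n w" .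
  have "?h ** ?h \<in> SO"
    by (rule isometry_square_SO, unfold Eichler_works, rule eichler_isometry)
      (use assms in \<open>simp_all add: lip_simps\<close>)
  then show ?thesis by (simp only: eq)
qed


lemma eichler_scale: "eichler (c *\<^sub>R n) w x = eichler n (c *\<^sub>R w) x"
  by (simp add: eichler_def lip_simps algebra_simps)

lemma SO_eichler: "A \<in> SO \<Longrightarrow> A *v eichler n w x = eichler (A *v n) (A *v w) (A *v x)"
  by (simp add: eichler_def lip_SO matrix_vector_right_distrib matrix_vector_mult_diff_distrib
      matrix_vector_mult_scaleR)

text \<open>When \<open>n\<close> and \<open>n'\<close> are null with product 2, the coefficient of
  \<open>n\<close> in \<open>x\<close> is \<open>lip x n' / 2\<close>: the map multiplies
  \<open>n\<close> by \<open>s\<close> and \<open>n'\<close> by \<open>inverse s\<close>, and fixes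
  their orthogonal complement.\<close>

definition boost :: "('d::finite) lvec \<Rightarrow> 'd lvec \<Rightarrow> real \<Rightarrow> 'd lvec \<Rightarrow> 'd lvec" where
  "boost n n' s x = x + ((s - 1) * (lip x n' / 2)) *\<^sub>R n + ((inverse s - 1) * (lip x n / 2)) *\<^sub>R n'"

abbreviation Boost :: "('d::finite) lvec \<Rightarrow> 'd lvec \<Rightarrow> real \<Rightarrow> 'd lmat" where
  "Boost n n' s \<equiv> matrix (boost n n' s)"

lemma linear_boost: "linear (boost n n' s)"
  by (rule linearI) (simp_all add: boost_def lip_simps algebra_simps add_divide_distrib)

lemma Boost_works: "Boost n n' s *v x = boost n n' s x"
  by (simp add: linear_boost matrix_works)

lemma SO_boost: "A \<in> SO \<Longrightarrow> A *v boost n n' s x = boost (A *v n) (A *v n') s (A *v x)"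
  by (simp add: boost_def lip_SO matrix_vector_right_distrib matrix_vector_mult_diff_distrib
      matrix_vector_mult_scaleR)

lemma boost_isometry:
  assumes "lip n n = 0" "lip n' n' = 0" "lip n n' = 2" "s \<noteq> 0"
  shows "lip (boost n n' s x) (boost n n' s y) = lip x y"
proof -
  have "lip n x = lip x n" "lip n y = lip y n" "lip n' x = lip x n'" "lip n' y = lip y n'" "lip n' n = 2"
    using assms by (auto intro: lip_sym simp: lip_sym[of n' n])
  then show ?thesis using assms by (simp add: boost_def lip_simps) (simp add: field_simps)
qed

lemma boost_mult:
  assumes "lip n n = 0" "lip n' n' = 0" "lip n n' = 2" "s \<noteq> 0" "t \<noteq> 0"
  shows "boost n n' s (boost n n' t x) = boost n n' (s * t) x"
proof -
  have 1: "lip n' n = 2" using assms by (auto simp: lip_sym[of n' n])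
  define a b where "a = lip x n'" and "b = lip x n"
  define y where "y = boost n n' t x"
  have y: "y = x + ((t - 1) * (a/2)) *\<^sub>R n + ((inverse t - 1) * (b/2)) *\<^sub>R n'"
    by (simp add: y_def boost_def a_def b_def)
  have "lip y n' = t * a" "lip y n = inverse t * b"
    unfolding y using assms 1 by (simp_all add: lip_simps a_def b_def field_simps)
  then have "boost n n' s (boost n n' t x) = x + ((t - 1) * (a/2) + (s - 1) * (t * a/2)) *\<^sub>R n 
     + ((inverse t - 1) * (b/2) + (inverse s - 1) * (inverse t * b / 2)) *\<^sub>R n'"
    unfolding y_def[symmetric] by (simp add: boost_def y scaleR_left_distrib)
  also have "\<dots> = boost n n' (s * t) x"
  proof -
    have "(t - 1) * (a/2) + (s - 1) * (t * a/2) = (s * t - 1) * (a/2)"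
      "(inverse t - 1) * (b/2) + (inverse s - 1) * (inverse t * b / 2) = (inverse (s * t) - 1) * (b/2)"
      using assms(4,5) by (simp_all add: divide_simps) (simp_all add: algebra_simps)
    then show ?thesis by (simp only: boost_def a_def b_def)
  qed
  finally show ?thesis .
qed

lemma Boost_mult:
  assumes "lip n n = 0" "lip n' n' = 0" "lip n n' = 2" "s \<noteq> 0" "t \<noteq> 0"
  shows "Boost n n' s ** Boost n n' t = Boost n n' (s * t)"
  by (simp add: matrix_eq matrix_vector_mul_assoc[symmetric] Boost_works boost_mult assms)

lemma Boost_SO:
  assumes "lip n n = 0" "lip n' n' = 0" "lip n n' = 2" "s > 0"
  shows "Boost n n' s \<in> SO"
proof -
  let ?h = "Boost n n' (sqrt s)"
  have eq: "?h ** ?h = Boost n n' s" using assms by (simp add: Boost_mult)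
  have "?h ** ?h \<in> SO"
    by (rule isometry_square_SO, unfold Boost_works, rule boost_isometry)
      (use assms in simp_all)
  then show ?thesis by (simp only: eq)
qed

lemma Boost_one: "Boost n n' 1 = mat 1"
  by (simp add: matrix_eq Boost_works boost_def)

lemma Eichler_zero: "Eichler n 0 = mat 1"
  by (simp add: matrix_eq Eichler_works eichler_def lip_expand)

definition sign_flip :: "'d::finite option set \<Rightarrow> 'd lmat" where
  "sign_flip S = (\<chi> i j. if i = j then (if i \<in> S then - 1 else 1) else 0)"

lemma sign_flip_mult_nth: "(sign_flip S *v x) $ i = (if i \<in> S then - x $ i else x $ i)"
proof -
  have "(sign_flip S *v x) $ i = (\<Sum>j\<in>UNIV. if i = j then (if i \<in> S then - 1 else 1) * x $ j else 0)"
    unfolding matrix_vector_mult_def sign_flip_def vec_lambda_beta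
    by (intro sum.cong) auto
  then show ?thesis by simp
qed

lemma sign_flip_SO: assumes "even (card S)" shows "sign_flip S \<in> SO"
proof -
  have "det (sign_flip S) = (\<Prod>i\<in>UNIV. sign_flip S $ i $ i)"
    by (rule det_diagonal) (simp add: sign_flip_def)
  also have "\<dots> = (\<Prod>i\<in>UNIV. if i \<in> S then - 1 else 1)" by (simp add: sign_flip_def)
  also have "\<dots> = (-1) ^ card S" by (subst prod.If_cases) auto
  finally have "det (sign_flip S) = 1" using assms by simp
  then show ?thesis unfolding SO_carrier isometry_iff
    by (auto simp: lip_expand sign_flip_mult_nth intro!: sum.cong)
qed

lemma inner_eq_lip: "x \<bullet> y = lip x y + 2 * x $ None * y $ None"
  by (simp add: lip_expand inner_vec_def UNIV_option_sum)

lemma lip_axis: "lip x (axis (Some i) 1) = x $ Some i" "lip x (axis None 1) = - (x $ None)"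
proof -
  have "(\<Sum>j\<in>UNIV. x $ Some j * axis (Some i) 1 $ Some j) = (\<Sum>j\<in>UNIV. if i = j then x $ Some j else 0)"
    by (intro sum.cong) (auto simp: axis_def)
  then show "lip x (axis (Some i) 1) = x $ Some i" by (simp add: lip_expand axis_def)
  show "lip x (axis None 1) = - (x $ None)" by (simp add: lip_expand axis_def)
qed

lemma matrix_axis_nth: "(A *v axis j 1) $ i = (A :: real^'n^'m) $ i $ j"
  by (simp add: matrix_vector_mul_component column_def matrix_vector_mult_basis)

lemma SO_row_zero:
  assumes "A \<in> SO"
  shows "(A $ None $ None)\<^sup>2 = 1 + (\<Sum>i\<in>UNIV. (A $ None $ Some i)\<^sup>2)"
proof -
  have "lip (lorentz_inv A *v axis None 1) (lorentz_inv A *v axis None 1) = - 1"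
    by (subst lip_SO[OF SO_inv(2)[OF assms]]) (simp add: lip_axis)
  then show ?thesis by (simp add: lip_expand matrix_axis_nth lorentz_inv_nth power2_eq_square)
qed

lemma SO_column:
  assumes "A \<in> SO"
  shows "(\<Sum>i\<in>UNIV. (A $ Some i $ j)\<^sup>2) = (if j = None then - 1 else 1) + (A $ None $ j)\<^sup>2"
proof -
  have "lip (A *v axis j 1) (A *v axis j 1) = (if j = None then - 1 else 1)"
    by (subst lip_SO[OF assms]) (cases j; simp add: lip_axis)
  then show ?thesis by (simp add: lip_expand matrix_axis_nth power2_eq_square split: if_splits)
qed

text \<open>The Euclidean product differs from the Lorentz form by twice the product of the time
  coordinates, which such a matrix preserves.\<close>

lemma SO_orthogonal:
  assumes "A \<in> SO" "\<And>x. (A *v x) $ None = \<sigma> * x $ None" "\<sigma>\<^sup>2 = 1"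
  shows "orthogonal_matrix A"
proof -
  have "(A *v x) \<bullet> (A *v y) = x \<bullet> y" for x y
    using assms by (simp add: inner_eq_lip lip_SO power2_eq_square)
  then have "orthogonal_transformation ((*v) A)"
    by (simp add: orthogonal_transformation_def)
  then show ?thesis by (simp add: orthogonal_transformation_matrix)
qed

lemma null_vector_nz:
  assumes "lip x x = 0" "x $ None = 0" shows "x = 0"
  using assms inner_eq_lip[of x x] by (simp add: inner_eq_zero_iff)

section \<open>Null frame and Iwasawa decomposition\<close>

locale lorentz_frame =
  fixes i1 i2 :: "'d::finite"
  assumes i12: "i1 \<noteq> i2"
begin

definition nu :: "'d lvec" where "nu = axis (Some i1) 1 + axis None 1"
definition nu' :: "'d lvec" where "nu' = axis (Some i1) 1 - axis None 1"

lemma lip_nu: "lip x nu = x $ Some i1 - x $ None" "lip x nu' = x $ Some i1 + x $ None"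
  by (simp_all add: nu_def nu'_def lip_simps lip_axis)

lemma nu_nth: "nu $ i = (if i = Some i1 \<or> i = None then 1 else 0)"
  "nu' $ i = (if i = Some i1 then 1 else if i = None then - 1 else 0)"
  by (auto simp: nu_def nu'_def axis_def)

lemma lip_nu_nu: "lip nu nu = 0" "lip nu' nu' = 0" "lip nu nu' = 2" "lip nu' nu = 2"
  by (simp_all add: lip_nu nu_nth)

lemmas Boost_nu = Boost_SO[OF lip_nu_nu(1-3)] Boost_mult[OF lip_nu_nu(1-3)]

text \<open>For \<open>h\<close> in the group, \<open>h *v nu\<close> is null, so its length is
  \<open>sqrt 2\<close> times the absolute value of \<open>rho h\<close>. Small values mean that
  \<open>nu\<close> is shortened, that is, that \<open>h\<close> lies far out in the cusp.\<close>

definition rho :: "'d lmat \<Rightarrow> real" where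
  "rho h = (h *v nu) $ None"

lemma boost_nu: "boost nu nu' s nu = s *\<^sub>R nu"
  by (simp add: boost_def lip_nu_nu algebra_simps)

lemma rho_expand: "rho h = h $ None $ Some i1 + h $ None $ None"
  by (simp add: rho_def nu_def matrix_vector_right_distrib matrix_axis_nth)

lemma rho_nz: assumes "h \<in> SO" shows "rho h \<noteq> 0"
proof
  assume "rho h = 0"
  then have "h *v nu = 0"
    by (intro null_vector_nz) (simp_all add: lip_SO[OF assms] lip_nu_nu rho_def)
  then have "lip (h *v nu) (h *v nu') = 0" by (simp add: lip_expand)
  then show False by (simp add: lip_SO[OF assms] lip_nu_nu)
qed

definition horo :: "'d lvec \<Rightarrow> bool" where
  "horo w \<longleftrightarrow> w $ Some i1 = 0 \<and> w $ None = 0"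

lemma horo_lip: "horo w \<Longrightarrow> lip nu w = 0" "horo w \<Longrightarrow> lip nu' w = 0"
   "horo w \<Longrightarrow> lip w nu = 0" "horo w \<Longrightarrow> lip w nu' = 0"
  by (simp_all add: lip_sym[of nu] lip_sym[of nu'] lip_nu horo_def)

lemma Eichler_nu_SO: "horo w \<Longrightarrow> Eichler nu w \<in> SO"
  by (simp add: Eichler_SO horo_lip lip_nu_nu)

lemma Eichler_nu_mult: "horo w \<Longrightarrow> horo w' \<Longrightarrow> Eichler nu w ** Eichler nu w' = Eichler nu (w + w')"
  by (simp add: Eichler_add horo_lip lip_nu_nu)

lemma eichler_nu_nu: "horo w \<Longrightarrow> eichler nu w nu = nu"
  by (simp add: eichler_def horo_lip lip_nu_nu)

lemma eichler_nu_axis: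
  "horo w \<Longrightarrow> i \<noteq> i1 \<Longrightarrow> eichler nu w (axis (Some i) 1) = axis (Some i) 1 - (w $ Some i) *\<^sub>R nu"
  by (simp add: eichler_def lip_nu lip_sym[of "axis (Some i) 1" w] lip_axis) (simp add: axis_def)

lemma boost_nu_axis: "i \<noteq> i1 \<Longrightarrow> boost nu nu' s (axis (Some i) 1) = axis (Some i) 1"
  by (simp add: boost_def lip_nu) (simp add: axis_def)

text \<open>The boost is determined by normalizing \<open>rho\<close> to absolute value one, the
  Eichler part by clearing the time row. The maximal compact subgroup has two components, hence the
  sign of \<open>rho h\<close> in \<open>k\<close>.\<close>

lemma KAN_decomposition:
  assumes h: "h \<in> SO"
  obtains k w where "k \<in> SO" "\<And>x. (k *v x) $ None = sgn (rho h) * x $ None"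
    "orthogonal_matrix k" "horo w" "h = k ** Eichler nu w ** Boost nu nu' \<bar>rho h\<bar>"
proof -
  define \<sigma> where "\<sigma> = sgn (rho h)"
  define s where "s = inverse \<bar>rho h\<bar>"
  have \<sigma>: "\<sigma> * \<sigma> = 1" "\<sigma> \<noteq> 0" using rho_nz[OF h] by (auto simp: \<sigma>_def sgn_if)
  have s: "s > 0" using rho_nz[OF h] by (simp add: s_def)
  define h1 where "h1 = h ** Boost nu nu' s"
  have h1: "h1 \<in> SO" unfolding h1_def by (intro SO_mult h Boost_nu s)
  have h1nu: "(h1 *v nu) $ None = \<sigma>"
    using rho_nz[OF h] by (simp add: h1_def matrix_vector_mul_assoc[symmetric] Boost_works boost_nu
      matrix_vector_mult_scaleR rho_def[symmetric] s_def \<sigma>_def sgn_real_def)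
  \<comment> \<open>An Eichler transformation subtracts \<open>w $ Some i * \<sigma>\<close> from
    the time row, and \<open>\<sigma>\<close> is its own inverse; so this choice clears the row
    outside \<open>Some i1\<close> and \<open>None\<close>.\<close>
  define w where "w = (\<chi> i. if i = Some i1 \<or> i = None then 0 else \<sigma> * h1 $ None $ i)"
  have w: "horo w" "horo (- w)" by (simp_all add: w_def horo_def)
  define k where "k = h1 ** Eichler nu w"
  have k: "k \<in> SO" unfolding k_def by (intro SO_mult h1 Eichler_nu_SO w)
  have knu: "(k *v nu) $ None = \<sigma>"
    using h1nu by (simp add: k_def matrix_vector_mul_assoc[symmetric] Eichler_works eichler_nu_nu w)
  have ki: "k $ None $ Some i = 0" if "i \<noteq> i1" for i
  proof -
    have "k $ None $ Some i = (h1 *v (axis (Some i) 1 - (w $ Some i) *\<^sub>R nu)) $ None"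
      using that by (simp add: matrix_axis_nth[symmetric] k_def matrix_vector_mul_assoc[symmetric]
          Eichler_works eichler_nu_axis w)
    also have "\<dots> = 0"
      using that \<sigma> by (simp add: matrix_vector_mult_diff_distrib matrix_vector_mult_scaleR h1nu 
          matrix_axis_nth w_def)
    finally show ?thesis .
  qed
  have "(\<Sum>i\<in>UNIV. (k $ None $ Some i)\<^sup>2) = (\<Sum>i\<in>UNIV. if i1 = i then (k $ None $ Some i1)\<^sup>2 else 0)"
    by (intro sum.cong) (auto simp: ki)
  then have 1: "(k $ None $ None)\<^sup>2 = 1 + (k $ None $ Some i1)\<^sup>2"
    using SO_row_zero[OF k] by simp
  have 2: "k $ None $ Some i1 + k $ None $ None = \<sigma>" using knu rho_expand[of k] rho_def[of k] by simp
  \<comment> \<open>The two remaining entries have sum \<open>\<sigma>\<close> and difference of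
    squares one, so their difference is \<open>\<sigma>\<close> as well and the entry at
    \<open>Some i1\<close> vanishes.\<close>
  have "k $ None $ Some i1 = \<sigma> - k $ None $ None" using 2 by simp
  with 1 have "2 * \<sigma> * k $ None $ None = 2" using \<sigma> by (simp add: power2_eq_square algebra_simps)
  then have k0: "k $ None $ None = \<sigma>" 
    using \<sigma> by (metis mult.assoc mult.left_commute mult.right_neutral mult_cancel_left zero_neq_numeral)
  with 2 have k1: "k $ None $ Some i1 = 0" by simp
  have krow: "(k *v x) $ None = \<sigma> * x $ None" for x
  proof -
    have "k $ None $ Some i = 0" for i using ki k1 by (cases "i = i1") auto
    then show ?thesis by (simp add: matrix_vector_mult_def UNIV_option_sum k0)
  qed
  have "k ** Eichler nu (- w) = h1 ** (Eichler nu w ** Eichler nu (- w))"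
    by (simp add: k_def matrix_mul_assoc)
  also have "\<dots> = h1" by (simp only: Eichler_nu_mult w) (simp add: Eichler_zero)
  finally have "k ** Eichler nu (- w) ** Boost nu nu' \<bar>rho h\<bar> = h ** (Boost nu nu' s ** Boost nu nu' \<bar>rho h\<bar>)"
    by (simp add: h1_def matrix_mul_assoc)
  also have "\<dots> = h"
    using rho_nz[OF h] s by (simp add: Boost_nu s_def Boost_one)
  finally have "h = k ** Eichler nu (- w) ** Boost nu nu' \<bar>rho h\<bar>" ..
  moreover have "orthogonal_matrix k"
    by (rule SO_orthogonal[OF k krow]) (simp add: \<sigma> power2_eq_square)
  ultimately show thesis using k krow w that unfolding \<sigma>_def by blast
qed

text \<open>
  Boosts are conjugate to their inverses, and Eichler transformations to their squares.
\<close>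

lemma SO_character_trivial:
  fixes chi :: "'d lmat \<Rightarrow> real"
  assumes mult: "\<And>g h. g \<in> SO \<Longrightarrow> h \<in> SO \<Longrightarrow> chi (g ** h) = chi g * chi h"
    and pos: "\<And>g. g \<in> SO \<Longrightarrow> chi g > 0"
    and orth: "\<And>g. g \<in> SO \<Longrightarrow> orthogonal_matrix g \<Longrightarrow> chi g = 1"
    and g: "g \<in> SO"
  shows "chi g = 1"
proof -
  have one: "chi (mat 1) = 1" by (rule orth) (simp_all add: SO_one orthogonal_matrix_id)
  have boost1: "chi (Boost nu nu' s) = 1" if s: "s > 0" for s
  proof -
    \<comment> \<open>This flip exchanges \<open>nu\<close> with \<open>- nu'\<close> and thus the
      two eigenvalues of the boost. Negating \<open>Some i2\<close> as well keeps the determinant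
      one.\<close>
    let ?f = "sign_flip {Some i1, Some i2}"
    have f: "?f \<in> SO" using i12 by (intro sign_flip_SO) simp
    have fx: "?f *v nu = - nu'" "?f *v nu' = - nu"
      by (auto simp: vec_eq_iff sign_flip_mult_nth nu_nth i12)
    have "?f *v boost nu nu' s x = boost nu nu' (inverse s) (?f *v x)" for x
      unfolding SO_boost[OF f] fx by (simp add: boost_def lip_simps)
    then have "?f ** Boost nu nu' s = Boost nu nu' (inverse s) ** ?f"
      by (simp add: matrix_eq matrix_vector_mul_assoc[symmetric] Boost_works)
    then have "chi ?f * chi (Boost nu nu' s) = chi (Boost nu nu' (inverse s)) * chi ?f"
      using s by (metis Boost_nu(1) f mult inverse_positive_iff_positive)
    then have 1: "chi (Boost nu nu' s) = chi (Boost nu nu' (inverse s))" using pos[OF f] by simp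
    have "chi (Boost nu nu' s) * chi (Boost nu nu' (inverse s)) = chi (Boost nu nu' s ** Boost nu nu' (inverse s))"
      using s by (simp add: mult[symmetric] Boost_nu(1))
    also have "\<dots> = 1" using s by (simp add: Boost_nu Boost_one one)
    finally have "chi (Boost nu nu' s) * chi (Boost nu nu' s) = 1" by (simp add: 1[symmetric])
    then show ?thesis using pos[OF Boost_nu(1)[OF s]]
      by (metis less_asym mult_cancel_left2 square_eq_1_iff zero_less_one neg_less_0_iff_less)
  qed
  have eichler1: "chi (Eichler nu w) = 1" if w: "horo w" for w
  proof -
    \<comment> \<open>Conjugation by this boost doubles \<open>w\<close>, that is, squares the
      Eichler transformation; the value of \<open>chi\<close> therefore equals its own
      square.\<close>
    let ?a = "Boost nu nu' 2"
    have a: "?a \<in> SO" by (simp add: Boost_nu)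
    have aw: "?a *v w = w" "?a *v nu = 2 *\<^sub>R nu"
      by (simp_all add: Boost_works boost_nu) (simp add: boost_def w horo_lip)
    have "?a *v eichler nu w x = eichler nu (w + w) (?a *v x)" for x
      unfolding SO_eichler[OF a] aw by (simp only: eichler_scale) (simp only: scaleR_2)
    then have "?a ** Eichler nu w = Eichler nu (w + w) ** ?a"
      by (simp add: matrix_eq matrix_vector_mul_assoc[symmetric] Eichler_works)
    also have "\<dots> = Eichler nu w ** Eichler nu w ** ?a" by (simp add: Eichler_nu_mult w)
    finally have "chi ?a * chi (Eichler nu w) = chi (Eichler nu w) * chi (Eichler nu w) * chi ?a"
      using w a by (metis Eichler_nu_SO SO_mult mult)
    then show ?thesis using pos[OF a] pos[OF Eichler_nu_SO[OF w]] by simp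
  qed
  obtain k w where k: "k \<in> SO" "orthogonal_matrix k" "horo w"
    "g = k ** Eichler nu w ** Boost nu nu' \<bar>rho g\<bar>"
    using KAN_decomposition[OF g] by metis
  have r: "\<bar>rho g\<bar> > 0" using rho_nz[OF g] by simp
  have "chi g = chi k * chi (Eichler nu w) * chi (Boost nu nu' \<bar>rho g\<bar>)"
    by (subst k(4)) (simp only: mult[OF SO_mult[OF k(1) Eichler_nu_SO[OF k(3)]] Boost_nu(1)[OF r]]
        mult[OF k(1) Eichler_nu_SO[OF k(3)]])
  then show ?thesis using orth[OF k(1,2)] eichler1[OF k(3)] boost1[OF r] by simp
qed

end

subsection \<open>Uniqueness of invariant measures\<close>

text \<open>
  Fubini's theorem and the substitutions \<open>x := i y x\<close> and \<open>y := x y\<close> turn \<open>M A\<close> into the product of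
  \<open>M B\<close> with an integral that does not involve \<open>M\<close>.
\<close>

theorem left_invariant_measures_proportional:
  fixes m :: "'a::second_countable_topology \<Rightarrow> 'a \<Rightarrow> 'a" and M N :: "'a measure"
  assumes sf: "sigma_finite_measure M" "sigma_finite_measure N"
    and sets: "sets M = sets borel" "sets N = sets borel"
    and m: "(\<lambda>(x, y). m x y) \<in> borel \<Otimes>\<^sub>M borel \<rightarrow>\<^sub>M borel" and i: "i \<in> borel \<rightarrow>\<^sub>M borel"
    and G: "AE x in M. x \<in> G" "AE x in N. x \<in> G"
    and inv: "\<And>g. g \<in> G \<Longrightarrow> distr M borel (m g) = M" "\<And>g. g \<in> G \<Longrightarrow> distr N borel (m g) = N"
    and i_closed: "\<And>x. x \<in> G \<Longrightarrow> i x \<in> G"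
    and cancel: "\<And>x y. x \<in> G \<Longrightarrow> y \<in> G \<Longrightarrow> m x (m (i x) y) = y"
    and cancel': "\<And>x y. x \<in> G \<Longrightarrow> y \<in> G \<Longrightarrow> m (i (m x y)) x = i y"
    and B: "B \<in> sets borel" "\<And>x. x \<in> G \<Longrightarrow> emeasure N {y. m y x \<in> B} \<noteq> 0"
       "\<And>x. x \<in> G \<Longrightarrow> emeasure N {y. m y x \<in> B} \<noteq> \<infinity>"
    and A: "A \<in> sets borel"
  shows "emeasure M A * emeasure N B = emeasure N A * emeasure M B"
proof -
  have m' [measurable]: "(\<lambda>x. m (f x) (g x)) \<in> borel_measurable L"
    if [measurable]: "f \<in> borel_measurable L" "g \<in> borel_measurable L" for f g and L :: "'b measure"
    using measurable_compose[OF measurable_Pair[OF that] m] by simp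
  have m'' [measurable]: "(\<lambda>x. m (f x) (g x)) \<in> borel_measurable L"
    if [measurable]: "f \<in> borel_measurable L" "g \<in> borel_measurable L" for f g and L :: "('a \<times> 'a) measure"
    using measurable_compose[OF measurable_Pair[OF that] m] by simp
  have m1 [measurable]: "(\<lambda>x. m (f x) (g x)) \<in> borel_measurable L"
    if [measurable]: "f \<in> borel_measurable L" "g \<in> borel_measurable L" for f g and L :: "'a measure"
    using measurable_compose[OF measurable_Pair[OF that] m] by simp
  note [measurable] = i B(1) A
  note [measurable_cong] = sets
  interpret N: sigma_finite_measure N by fact
  \<comment> \<open>\<open>D x\<close> is the \<open>N\<close>-measure of a right translate of
    \<open>B\<close>, and dividing by it inserts an inner integral of total weight one. Right
    translates may have different measures here, so unimodularity is not presupposed.\<close>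
  define D where "D x = (\<integral>\<^sup>+ y. indicator B (m y x) \<partial>N)" for x
  have D_meas [measurable]: "D \<in> borel_measurable borel"
    unfolding D_def by measurable
  have D: "D x = emeasure N {y. m y x \<in> B}" for x
  proof -
    have "{y. m y x \<in> B} \<in> sets N" by (measurable; simp add: sets)
    then show ?thesis unfolding D_def
      by (subst nn_integral_indicator[symmetric], simp)
         (rule arg_cong[where f="nn_integral N"], auto simp: indicator_def fun_eq_iff)
  qed
  have D1: "inverse (D x) * D x = 1" if "x \<in> G" for x
    using B(2,3)[OF that] ennreal_divide_self[of "D x"] unfolding D
    by (simp add: divide_ennreal_def mult.commute less_top)
  define C where "C = (\<integral>\<^sup>+ y. indicator A (i y) * inverse (D (i y)) \<partial>N)"
  have main: "emeasure K A = emeasure K B * C"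
    if sfK: "sigma_finite_measure K" and setsK: "sets K = sets borel" and GK: "AE x in K. x \<in> G"
      and invK: "\<And>g. g \<in> G \<Longrightarrow> distr K borel (m g) = K" for K
  proof -
    note [measurable_cong] = setsK
    interpret K: sigma_finite_measure K by fact
    interpret P: pair_sigma_finite N K by standard
    let ?F = "\<lambda>x y. indicator A x * inverse (D x) * indicator B (m y x) :: ennreal"
    let ?H = "\<lambda>x y. indicator A (m (i y) x) * inverse (D (m (i y) x)) * indicator B x :: ennreal"
    have "emeasure K A = (\<integral>\<^sup>+ x. indicator A x \<partial>K)"
      by (simp add: setsK A)
    also have "\<dots> = (\<integral>\<^sup>+ x. (\<integral>\<^sup>+ y. ?F x y \<partial>N) \<partial>K)"
    proof (rule nn_integral_cong_AE, use GK in eventually_elim)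
      fix x assume x: "x \<in> G"
      have "(\<integral>\<^sup>+ y. ?F x y \<partial>N) = indicator A x * inverse (D x) * D x"
        unfolding D_def[of x] by (rule nn_integral_cmult) measurable
      then show "indicator A x = (\<integral>\<^sup>+ y. ?F x y \<partial>N)"
        by (simp add: mult.assoc D1[OF x])
    qed
    also have "\<dots> = (\<integral>\<^sup>+ y. (\<integral>\<^sup>+ x. ?F x y \<partial>K) \<partial>N)"
      using P.Fubini'[of "\<lambda>y x. ?F x y"] by simp
    also have "\<dots> = (\<integral>\<^sup>+ y. (\<integral>\<^sup>+ x. ?H x y \<partial>K) \<partial>N)"
    proof (rule nn_integral_cong_AE, use G(2) in eventually_elim)
      fix y assume y: "y \<in> G"
      have "(\<integral>\<^sup>+ x. ?F x y \<partial>K) = (\<integral>\<^sup>+ x. ?F x y \<partial>(distr K borel (m (i y))))"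
        using invK[OF i_closed[OF y]] by simp
      also have "\<dots> = (\<integral>\<^sup>+ x. ?F (m (i y) x) y \<partial>K)"
        by (rule nn_integral_distr) measurable
      also have "\<dots> = (\<integral>\<^sup>+ x. ?H x y \<partial>K)"
        by (rule nn_integral_cong_AE, use GK in eventually_elim) (simp add: cancel y)
      finally show "(\<integral>\<^sup>+ x. ?F x y \<partial>K) = (\<integral>\<^sup>+ x. ?H x y \<partial>K)" .
    qed
    also have "\<dots> = (\<integral>\<^sup>+ x. (\<integral>\<^sup>+ y. ?H x y \<partial>N) \<partial>K)"
      using P.Fubini'[of "\<lambda>y x. ?H x y"] by simp
    also have "\<dots> = (\<integral>\<^sup>+ x. indicator B x * C \<partial>K)"
    proof (rule nn_integral_cong_AE, use GK in eventually_elim)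
      fix x assume x: "x \<in> G"
      have "(\<integral>\<^sup>+ y. ?H x y \<partial>N) = (\<integral>\<^sup>+ y. ?H x y \<partial>(distr N borel (m x)))"
        using inv(2)[OF x] by simp
      also have "\<dots> = (\<integral>\<^sup>+ y. ?H x (m x y) \<partial>N)"
        by (rule nn_integral_distr) measurable
      also have "\<dots> = (\<integral>\<^sup>+ y. indicator B x * (indicator A (i y) * inverse (D (i y))) \<partial>N)"
        by (rule nn_integral_cong_AE, use G(2) in eventually_elim) (simp add: cancel' x mult_ac)
      also have "\<dots> = indicator B x * C"
        unfolding C_def by (rule nn_integral_cmult) measurable
      finally show "(\<integral>\<^sup>+ y. ?H x y \<partial>N) = indicator B x * C" .
    qed
    also have "\<dots> = emeasure K B * C"
      by (subst nn_integral_multc) (simp_all add: setsK)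
    finally show ?thesis .
  qed
  show ?thesis
    using main[OF sf(1) sets(1) G(1) inv(1)] main[OF sf(2) sets(2) G(2) inv(2)]
    by (simp add: mult_ac)
qed

subsection \<open>Unimodularity\<close>

lemma continuous_on_matrix_mult [continuous_intros]:
  fixes f :: "'a::topological_space \<Rightarrow> real^'n^'m" and g :: "'a \<Rightarrow> real^'p^'n"
  assumes "continuous_on S f" "continuous_on S g"
  shows "continuous_on S (\<lambda>x. f x ** g x)"
  unfolding matrix_matrix_mult_def
  by (intro continuous_on_vec_lambda continuous_on_sum continuous_on_mult
      continuous_on_component assms)

lemma continuous_on_transpose [continuous_intros]:
  fixes f :: "'a::topological_space \<Rightarrow> real^'n^'m"
  assumes "continuous_on S f" shows "continuous_on S (\<lambda>x. transpose (f x))"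
  unfolding transpose_def by (intro continuous_on_vec_lambda continuous_on_component assms)

lemma continuous_on_lorentz_inv [continuous_intros]:
  assumes "continuous_on S f" shows "continuous_on S (\<lambda>x. lorentz_inv (f x))"
  unfolding lorentz_inv_def by (intro continuous_intros assms)

lemma borel_matrix_mult [measurable]:
  fixes f g :: "'a \<Rightarrow> real^'n^'n"
  assumes [measurable]: "f \<in> borel_measurable M" "g \<in> borel_measurable M"
  shows "(\<lambda>x. f x ** g x) \<in> borel_measurable M"
proof -
  have "(\<lambda>p. fst p ** snd p) \<in> borel_measurable (borel :: ((real^'n^'n) \<times> (real^'n^'n)) measure)"
    by (intro borel_measurable_continuous_onI continuous_intros)
  then have "(\<lambda>p. fst p ** snd p) \<in> borel_measurable (borel \<Otimes>\<^sub>M borel :: ((real^'n^'n) \<times> (real^'n^'n)) measure)"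
    by (simp add: borel_prod)
  from measurable_compose[OF measurable_Pair[OF assms] this] show ?thesis by simp
qed

lemma borel_matrix_mult_right [measurable]: 
  fixes h :: "real^'n^'n"
  shows "(\<lambda>x. x ** h) \<in> borel_measurable borel"
  by (intro borel_measurable_continuous_onI continuous_intros)

lemma borel_lorentz_inv [measurable]: "lorentz_inv \<in> borel_measurable borel"
  by (intro borel_measurable_continuous_onI continuous_intros)

lemma closed_SO: "closed (carrier (SO_d_1 :: ('d::finite) lmat monoid))"
proof -
  have "carrier (SO_d_1 :: 'd lmat monoid) = {A. transpose A ** lorentz_form ** A = lorentz_form} \<inter> {A. det A = 1}"
    by (auto simp: SO_carrier)
  moreover have "continuous_on UNIV (det :: 'd lmat \<Rightarrow> real)"
    unfolding det_def by (intro continuous_intros)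
  ultimately show ?thesis
    by (auto intro!: closed_Int closed_Collect_eq continuous_intros)
qed

lemma SO_borel [measurable]: "SO \<in> sets borel"
  by (intro borel_closed closed_SO)

lemma SO_inv_mult_cancel:
  assumes "x \<in> SO" 
  shows "lorentz_inv x ** (x ** y) = y" "x ** (lorentz_inv x ** y) = y"
    "y ** x ** lorentz_inv x = y" "y ** lorentz_inv x ** x = y"
  using assms by (simp_all add: matrix_mul_assoc lorentz_inv_left lorentz_inv_right)
    (simp_all add: matrix_mul_assoc[symmetric] lorentz_inv_left lorentz_inv_right)

lemma bounded_right_vimage:
  fixes A :: "('d::finite) lmat set"
  assumes "bounded A" "h \<in> SO" shows "bounded {x. x ** h \<in> A}"
proof -
  have "compact ((\<lambda>x. x ** lorentz_inv h) ` closure A)"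
    using assms(1) by (intro compact_continuous_image continuous_intros) simp
  moreover have "{x. x ** h \<in> A} \<subseteq> (\<lambda>x. x ** lorentz_inv h) ` closure A"
  proof
    fix x assume "x \<in> {x. x ** h \<in> A}"
    then have "x ** h \<in> closure A" using closure_subset by auto
    moreover have "x = x ** h ** lorentz_inv h" using SO_inv_mult_cancel assms by metis
    ultimately show "x \<in> (\<lambda>x. x ** lorentz_inv h) ` closure A" by blast
  qed
  ultimately show ?thesis by (meson bounded_subset compact_imp_bounded)
qed

lemma right_vimage_borel:
  fixes h :: "('d::finite) lmat"
  shows "A \<in> sets borel \<Longrightarrow> {x. x ** h \<in> A} \<in> sets borel"
  using measurable_sets[of "\<lambda>x. x ** h" borel borel A] by (simp add: vimage_def borel_matrix_mult_right)

text \<open>Left Haar measure extended by zero to all matrices: the underlying space is then a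
  vector space with its Borel sets, on which multiplication is defined and continuous
  everywhere.\<close>

definition left_haar :: "('d::finite) lmat measure \<Rightarrow> bool" where
  "left_haar M \<longleftrightarrow> sets M = sets borel \<and> emeasure M (- SO) = 0 \<and>
     (\<forall>g\<in>SO. distr M borel ((**) g) = M) \<and>
     (\<forall>A. bounded A \<and> A \<in> sets borel \<longrightarrow> emeasure M A < \<infinity>) \<and> emeasure M UNIV \<noteq> 0"

context
  fixes M :: "('d::finite) lmat measure"
  assumes M: "left_haar M"
begin

lemma left_haar_sets [measurable_cong]: "sets M = sets borel"
  and left_haar_space [simp]: "space M = UNIV"
  and left_haar_bounded: "bounded A \<Longrightarrow> A \<in> sets borel \<Longrightarrow> emeasure M A < \<infinity>"
  using M sets_eq_imp_space_eq[of M borel] by (auto simp: left_haar_def)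

lemma left_haar_AE: "AE x in M. x \<in> SO"
  using M by (intro AE_I'[of "- SO"]) (auto simp: left_haar_def null_sets_def)

lemma left_haar_inv: assumes "g \<in> SO" "A \<in> sets borel"
  shows "emeasure M {x. g ** x \<in> A} = emeasure M A"
proof -
  have "emeasure M A = emeasure (distr M borel ((**) g)) A"
    using M assms by (simp add: left_haar_def)
  also have "\<dots> = emeasure M {x. g ** x \<in> A}"
    using assms(2) by (subst emeasure_distr) (auto simp: vimage_def)
  finally show ?thesis ..
qed

lemma left_haar_sigma_finite: "sigma_finite_measure M"
proof (rule sigma_finite_measure.intro, intro exI conjI)
  show "countable (range (\<lambda>n. cball 0 (real n) :: 'd lmat set))" by simp
  show "range (\<lambda>n. cball 0 (real n)) \<subseteq> sets M" by (auto simp: left_haar_sets)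
  show "\<Union> (range (\<lambda>n. cball 0 (real n))) = space M"
    by (auto simp: real_arch_simple)
  show "\<forall>a\<in>range (\<lambda>n. cball 0 (real n)). emeasure M a \<noteq> \<infinity>"
    using left_haar_bounded by (auto simp: less_top)
qed

text \<open>Countably many left translates of \<open>U\<close> cover the group by the Lindelof
  property; if \<open>U\<close> were null, so would be the whole group.\<close>

lemma left_haar_open_pos:
  assumes "open U" "u \<in> U" "u \<in> SO" shows "emeasure M U \<noteq> 0"
proof
  assume 0: "emeasure M U = 0"
  define V where "V g = {x. (u ** lorentz_inv g) ** x \<in> U}" for g
  have V: "open (V g)" for g
    unfolding V_def using open_vimage[OF assms(1), of "(**) (u ** lorentz_inv g)"]
    by (simp add: vimage_def continuous_on_matrix_mult)
  have mV: "emeasure M (V g) = 0" if "g \<in> SO" for g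
    unfolding V_def using 0 assms that by (subst left_haar_inv) (auto simp: SO_mult SO_inv)
  obtain F where F: "F \<subseteq> V ` SO" "countable F" "\<Union>F = (\<Union>g\<in>SO. V g)"
    using Lindelof[of "V ` SO"] V by auto
  have "SO \<subseteq> \<Union>F"
    unfolding F(3) V_def using assms by (auto simp: matrix_mul_assoc[symmetric] lorentz_inv_left intro!: bexI)
  then have "UNIV \<subseteq> \<Union>F \<union> (- SO)" by auto
  moreover have "\<Union>F \<in> null_sets M"
  proof (rule null_sets_UN'[OF F(2), of "\<lambda>x. x", simplified])
    fix A assume "A \<in> F"
    then obtain g where "g \<in> SO" "A = V g" using F(1) by auto
    then show "A \<in> null_sets M" using mV V by (auto simp: null_sets_def left_haar_sets)
  qed
  moreover have "- SO \<in> null_sets M"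
    using M by (auto simp: null_sets_def left_haar_def)
  ultimately have "UNIV \<in> null_sets M"
    by (metis null_sets.Un top.extremum_uniqueI)
  then show False using M by (auto simp: left_haar_def null_sets_def)
qed

lemma left_haar_right_translate:
  assumes h: "h \<in> SO"
  shows "left_haar (distr M borel (\<lambda>x. x ** h))"
proof -
  have e: "emeasure (distr M borel (\<lambda>x. x ** h)) A = emeasure M {x. x ** h \<in> A}" if "A \<in> sets borel" for A
    using that by (subst emeasure_distr) (auto simp: vimage_def)
  have 1: "{x. x ** h \<in> - SO} = - SO"
  proof -
    have "x ** h \<in> SO \<longleftrightarrow> x \<in> SO" for x
      using SO_mult[OF _ h] SO_mult[OF _ SO_inv(2)[OF h]] SO_inv_mult_cancel(3)[OF h] by metis
    then show ?thesis by auto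
  qed
  have "distr (distr M borel (\<lambda>x. x ** h)) borel ((**) g) = distr M borel (\<lambda>x. x ** h)"
    if g: "g \<in> SO" for g
  proof -
    have "distr (distr M borel (\<lambda>x. x ** h)) borel ((**) g) = distr (distr M borel ((**) g)) borel (\<lambda>x. x ** h)"
      by (simp add: distr_distr comp_def matrix_mul_assoc)
    then show ?thesis using M g by (simp add: left_haar_def)
  qed
  moreover have "emeasure M {x. x ** h \<in> A} < \<infinity>" if "bounded A" "A \<in> sets borel" for A
  proof (rule left_haar_bounded)
    show "{x. x ** h \<in> A} \<in> sets borel"
      by (rule right_vimage_borel[OF that(2)])
  qed (rule bounded_right_vimage[OF that(1) h])
  moreover have "emeasure M (- SO) = 0" "emeasure M UNIV \<noteq> 0"
    using M by (auto simp: left_haar_def)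
  ultimately show ?thesis
    unfolding left_haar_def using 1 e[of "- SO"] e[of UNIV] e by auto
qed

end

text \<open>The ball contains the identity, so its right translates are open, meet the group and are
  bounded. It is also invariant under orthogonal matrices, which later makes it the test set for the
  modular character.\<close>

lemma left_haar_proportional:
  fixes M N :: "('d::finite) lmat measure"
  assumes M: "left_haar M" and N: "left_haar N" and A: "A \<in> sets borel"
  defines "B \<equiv> ball 0 (norm (mat 1 :: 'd lmat) + 1)"
  shows "emeasure M A * emeasure N B = emeasure N A * emeasure M B"
proof (rule left_invariant_measures_proportional[where m="(**)" and i=lorentz_inv and G="SO"])
  fix x :: "'d lmat" assume x: "x \<in> SO"
  have o: "open {y. y ** x \<in> B}"
    using open_vimage[of B "\<lambda>y. y ** x"] 
    by (simp add: vimage_def continuous_on_matrix_mult B_def)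
  then show "emeasure N {y. y ** x \<in> B} \<noteq> 0"
    using x by (intro left_haar_open_pos[OF N o, of "lorentz_inv x"]) (auto simp: SO_inv B_def lorentz_inv_left)
  have "bounded {y. y ** x \<in> B}" by (rule bounded_right_vimage[OF _ x]) (simp add: B_def)
  then show "emeasure N {y. y ** x \<in> B} \<noteq> \<infinity>"
    using left_haar_bounded[OF N, of "{y. y ** x \<in> B}"] o by (simp add: less_top)
next
  fix x y :: "'d lmat" assume "x \<in> SO" "y \<in> SO"
  then show "lorentz_inv (x ** y) ** x = lorentz_inv y" "x ** (lorentz_inv x ** y) = y"
    by (simp_all add: lorentz_inv_mult SO_inv_mult_cancel)
qed (use assms left_haar_sigma_finite left_haar_AE left_haar_sets in
     \<open>auto simp: left_haar_def SO_inv intro!: borel_measurable_continuous_onI\<close>)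

lemma norm_mult_orthogonal:
  fixes x k :: "real ^ 'n ^ 'n"
  assumes "orthogonal_matrix k" shows "norm (x ** k) = norm x"
proof -
  have o: "orthogonal_transformation ((*v) (transpose k))"
    using assms by (simp add: orthogonal_transformation_matrix orthogonal_matrix_transpose)
  have "norm ((x ** k) $ i) = norm (x $ i)" for i
  proof -
    have "(x ** k) $ i = transpose k *v (x $ i)"
      by (simp add: vec_eq_iff matrix_matrix_mult_def matrix_vector_mult_def transpose_def mult.commute)
    then show ?thesis using orthogonal_transformation_norm[OF o] by metis
  qed
  then show ?thesis by (simp add: norm_vec_def)
qed

text \<open>
  The factor by which the elements of the group rescale the measure is a character, hence trivial.
\<close>

lemma (in lorentz_frame) rescaled_measure_invariant:
  fixes F :: "'d lmat \<Rightarrow> 'b set \<Rightarrow> ennreal"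
  assumes one: "\<And>A. A \<in> \<A> \<Longrightarrow> F (mat 1) A = \<nu> A"
    and scale: "\<And>g A. g \<in> SO \<Longrightarrow> A \<in> \<A> \<Longrightarrow> F g A * \<nu> B = \<nu> A * F g B"
    and B: "B \<in> \<A>" "\<And>g. g \<in> SO \<Longrightarrow> F g B \<noteq> 0 \<and> F g B \<noteq> \<infinity>"
    and mult: "\<And>g h A. g \<in> SO \<Longrightarrow> h \<in> SO \<Longrightarrow> A \<in> \<A> \<Longrightarrow> F (g ** h) A = F g (T h A)"
    and T: "\<And>h A. h \<in> SO \<Longrightarrow> A \<in> \<A> \<Longrightarrow> T h A \<in> \<A>"
    and orth: "\<And>k. k \<in> SO \<Longrightarrow> orthogonal_matrix k \<Longrightarrow> F k B = \<nu> B"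
    and h: "h \<in> SO" and A: "A \<in> \<A>"
  shows "F h A = \<nu> A"
proof -
  have \<nu>B: "\<nu> B \<noteq> 0" "\<nu> B \<noteq> \<infinity>" using B(2)[OF SO_one] one[OF B(1)] by auto
  have cancel: "x = y" if "x * \<nu> B = y * \<nu> B" for x y
    using that \<nu>B by (metis ennreal_mult_cancel_left mult.commute infinity_ennreal_def)
  \<comment> \<open>The modular function: the factor by which \<open>F g\<close> rescales the test
    set \<open>B\<close> and, by \<open>scale\<close>, every other set.\<close>
  define chi where "chi g = enn2real (F g B) / enn2real (\<nu> B)" for g
  have chi_pos: "chi g > 0" if "g \<in> SO" for g
    using B(2)[OF that] \<nu>B
    by (simp add: chi_def enn2real_positive_iff less_top zero_less_iff_neq_zero)
  have chi: "ennreal (chi g) * \<nu> B = F g B" if "g \<in> SO" for g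
  proof -
    have "enn2real (\<nu> B) \<noteq> 0" using \<nu>B by (simp add: enn2real_eq_0_iff)
    then have "ennreal (chi g) * ennreal (enn2real (\<nu> B)) = ennreal (enn2real (F g B))"
      by (simp add: chi_def flip: ennreal_mult)
    moreover have "ennreal (enn2real (\<nu> B)) = \<nu> B" "ennreal (enn2real (F g B)) = F g B"
      using B(2)[OF that] \<nu>B by (simp_all add: less_top)
    ultimately show ?thesis by simp
  qed
  have F: "F g A = ennreal (chi g) * \<nu> A" if g: "g \<in> SO" and A: "A \<in> \<A>" for g A
    by (rule cancel) (metis scale[OF g A] chi[OF g] mult.assoc mult.commute)
  have "chi h = 1"
  proof (rule SO_character_trivial[OF _ chi_pos _ h])
    fix g h :: "'d lmat"
    assume g: "g \<in> SO" and h: "h \<in> SO"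
    have "F (g ** h) B = ennreal (chi g) * (F h B)"
    proof -
      have "F (g ** h) B = F g (T h B)" by (rule mult[OF g h B(1)])
      also have "\<dots> = ennreal (chi g) * \<nu> (T h B)" by (rule F[OF g T[OF h B(1)]])
      also have "\<nu> (T h B) = F (mat 1) (T h B)" by (rule one[OF T[OF h B(1)], symmetric])
      also have "\<dots> = F (mat 1 ** h) B" by (rule mult[OF SO_one h B(1), symmetric])
      finally show ?thesis by (simp only: matrix_mul_lid)
    qed
    then have "ennreal (chi (g ** h)) * \<nu> B = (ennreal (chi g) * ennreal (chi h)) * \<nu> B"
      by (simp only: F[OF SO_mult[OF g h] B(1)] F[OF h B(1)] mult.assoc)
    then have "ennreal (chi (g ** h)) = ennreal (chi g) * ennreal (chi h)" by (rule cancel)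
    then show "chi (g ** h) = chi g * chi h"
      using chi_pos[OF g] chi_pos[OF h] chi_pos[OF SO_mult[OF g h]]
      by (simp add: ennreal_mult[symmetric] less_imp_le)
  next
    fix k :: "'d lmat"
    assume k: "k \<in> SO" and o: "orthogonal_matrix k"
    then show "chi k = 1" using orth[OF k o] \<nu>B by (simp add: chi_def enn2real_eq_0_iff)
  qed auto
  then show ?thesis using F[OF h A] by simp
qed

theorem (in lorentz_frame) left_haar_unimodular:
  fixes M :: "'d lmat measure"
  assumes M: "left_haar M" and h: "h \<in> SO" and A: "A \<in> sets borel"
  shows "emeasure M {x. x ** h \<in> A} = emeasure M A"
proof -
  define B where "B = ball (0 :: 'd lmat) (norm (mat 1 :: 'd lmat) + 1)"
  let ?N = "\<lambda>h :: 'd lmat. distr M borel (\<lambda>x. x ** h)"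
  have N: "emeasure (?N h) A = emeasure M {x. x ** h \<in> A}" if "A \<in> sets borel"
    for h :: "'d lmat" and A
    using that M by (subst emeasure_distr)
      (auto simp: vimage_def left_haar_space measurable_cong_sets[OF left_haar_sets[OF M] refl]
         borel_matrix_mult_right)
  have Bb: "B \<in> sets borel" "bounded B" by (auto simp: B_def)
  show ?thesis
  proof (rule rescaled_measure_invariant[where \<A>="sets borel" and B=B and 
        F="\<lambda>h A. emeasure M {x. x ** h \<in> A}" and T="\<lambda>h A. {x. x ** h \<in> A}"])
    fix g :: "'d lmat" assume g: "g \<in> SO"
    note lh = left_haar_right_translate[OF M g]
    show "emeasure M {x. x ** g \<in> A} * emeasure M B = emeasure M A * emeasure M {x. x ** g \<in> B}"
      if "A \<in> sets borel" for A
      using left_haar_proportional[OF lh M that] by (simp only: N that Bb B_def[symmetric])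
    show "emeasure M {x. x ** g \<in> B} \<noteq> 0 \<and> emeasure M {x. x ** g \<in> B} \<noteq> \<infinity>"
      using left_haar_bounded[OF lh Bb(2,1)] left_haar_open_pos[OF lh, of B "mat 1"] SO_one
      by (auto simp: N[OF Bb(1), symmetric]) (auto simp: B_def)
    show "{x. x ** g \<in> A} \<in> sets borel" if "A \<in> sets borel" for A
      by (rule right_vimage_borel[OF that])
  next
    fix k :: "'d lmat" assume "orthogonal_matrix k"
    then have "{x. x ** k \<in> B} = B" by (auto simp: B_def norm_mult_orthogonal)
    then show "emeasure M {x. x ** k \<in> B} = emeasure M B" by simp
  qed (use Bb h A in \<open>auto simp: matrix_mul_assoc\<close>)
qed

text \<open>
  The elements of the group have determinant one, so they preserve Lebesgue measure. The change of
  variables formula of the library needs a well-ordered index type, which an option type over an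
  arbitrary finite type is not.
\<close>

theorem (in lorentz_frame) lborel_SO_invariant:
  fixes A :: "'d lvec set"
  assumes h: "h \<in> SO" and A: "A \<in> sets borel"
  shows "emeasure lborel {x. h *v x \<in> A} = emeasure lborel A"
proof -
  define B :: "'d lvec set" where "B = ball 0 1"
  have Bb: "B \<in> sets borel" by (auto simp: B_def)
  have B0: "emeasure lborel B \<noteq> 0" "emeasure lborel B \<noteq> \<infinity>"
    using content_ball_pos[of 1 "0 :: 'd lvec"] emeasure_lborel_ball_finite[of "0 :: 'd lvec" 1]
    by (auto simp: B_def measure_def)
  have meas [measurable]: "(*v) g \<in> borel_measurable borel" for g :: "'d lmat"
    by (intro borel_measurable_continuous_onI linear_continuous_on) (simp add: linear_linear)
  define N :: "'d lmat \<Rightarrow> 'd lvec measure" where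
    "N g = distr lborel borel ((*v) (lorentz_inv g))" for g
  have N: "emeasure (N g) A = emeasure lborel {x. lorentz_inv g *v x \<in> A}" if "A \<in> sets borel" for g A
    using that by (simp add: N_def emeasure_distr vimage_def)
  have im: "{x. lorentz_inv g *v x \<in> B} = (*v) g ` B" if "g \<in> SO" for g B
  proof -
    have "lorentz_inv g *v (g *v x) = x" "g *v (lorentz_inv g *v x) = x" for x
      using that by (simp_all add: matrix_vector_mul_assoc lorentz_inv_left lorentz_inv_right)
    then show ?thesis by (auto simp: image_iff) (metis)
  qed
  have fin: "emeasure lborel ((*v) g ` B) < \<infinity>" for g :: "'d lmat"
  proof -
    have "compact ((*v) g ` cball 0 1)"
      by (intro compact_continuous_image linear_continuous_on) (simp_all add: linear_linear)
    then have "emeasure lborel ((*v) g ` cball 0 1) < \<infinity>" "(*v) g ` cball 0 1 \<in> sets lborel"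
      by (rule emeasure_compact_finite) (simp add: borel_closed compact_imp_closed \<open>compact _\<close>)
    moreover have "(*v) g ` B \<subseteq> (*v) g ` cball 0 1" unfolding B_def by (intro image_mono ball_subset_cball)
    ultimately show ?thesis by (meson emeasure_mono order.strict_trans1)
  qed
  have sf: "sigma_finite_measure (N g)" if g: "g \<in> SO" for g
  proof (rule sigma_finite_measure.intro, intro exI conjI)
    show "countable (range (\<lambda>n. (*v) (lorentz_inv g) ` cball 0 (real n) :: 'd lvec set))" by simp
    have c: "compact ((*v) (lorentz_inv g) ` cball 0 (real n))" for n
      by (intro compact_continuous_image linear_continuous_on) (simp_all add: linear_linear)
    then have b: "(*v) (lorentz_inv g) ` cball 0 (real n) \<in> sets borel" for n
      by (intro borel_closed compact_imp_closed)
    then show "range (\<lambda>n. (*v) (lorentz_inv g) ` cball 0 (real n)) \<subseteq> sets (N g)" by (auto simp: N_def)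
    have gg: "lorentz_inv g *v (g *v x) = x" "g *v (lorentz_inv g *v x) = x" for x
      using g by (simp_all add: matrix_vector_mul_assoc lorentz_inv_left lorentz_inv_right)
    have "x \<in> (\<Union>n. (*v) (lorentz_inv g) ` cball 0 (real n))" for x
    proof -
      obtain n where "norm (g *v x) \<le> real n" using real_arch_simple by blast
      then have "x \<in> (*v) (lorentz_inv g) ` cball 0 (real n)"
        by (intro image_eqI[of _ _ "g *v x"]) (auto simp: gg)
      then show ?thesis by blast
    qed
    then show "\<Union> (range (\<lambda>n. (*v) (lorentz_inv g) ` cball 0 (real n))) = space (N g)"
      by (auto simp: N_def)
    have "{x. lorentz_inv g *v x \<in> (*v) (lorentz_inv g) ` cball 0 (real n)} = cball 0 (real n)" for n
      using gg by (auto simp: image_iff) (metis mem_cball_0)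
    then show "\<forall>a\<in>range (\<lambda>n. (*v) (lorentz_inv g) ` cball 0 (real n)). emeasure (N g) a \<noteq> \<infinity>"
      using emeasure_lborel_cball_finite by (auto simp: N[OF b] less_top)
  qed
  \<comment> \<open>A linear map carries translations to translations, so the image of Lebesgue
    measure is again translation invariant and uniqueness applies to the additive group.\<close>
  have scale: "emeasure (N g) A * emeasure lborel B = emeasure lborel A * emeasure (N g) B"
    if g: "g \<in> SO" and A: "A \<in> sets borel" for g A
  proof (rule left_invariant_measures_proportional[where m="(+)" and i=uminus and G=UNIV, OF sf[OF g]])
    fix a :: "'d lvec"
    have *: "(+) a \<circ> (*v) (lorentz_inv g) = (*v) (lorentz_inv g) \<circ> (+) (g *v a)"
      using g by (auto simp: fun_eq_iff matrix_vector_right_distrib matrix_vector_mul_assoc lorentz_inv_left)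
    have "distr (N g) borel ((+) a) = distr (distr lborel borel ((+) (g *v a))) borel ((*v) (lorentz_inv g))"
      unfolding N_def by (simp add: distr_distr *)
    then show "distr (N g) borel ((+) a) = N g"
      by (simp add: N_def lborel_distr_plus)
    have "{y. y + a \<in> B} = ball (- a) 1"
      by (auto simp: B_def dist_norm algebra_simps norm_minus_commute)
    then show "emeasure lborel {y. y + a \<in> B} \<noteq> 0" "emeasure lborel {y. y + a \<in> B} \<noteq> \<infinity>"
      using content_ball_pos[of 1 "- a"] emeasure_lborel_ball_finite[of "- a" 1]
      by (auto simp: measure_def)
  qed (use A Bb sigma_finite_lborel in \<open>auto simp: N_def lborel_distr_plus\<close>)
  \<comment> \<open>Preimages compose in reverse order. The inverse inside \<open>F\<close> restores
    the order that multiplicativity asks for, and applying the result to the inverse of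
    \<open>h\<close> undoes it.\<close>
  have "emeasure lborel {x. lorentz_inv (lorentz_inv h) *v x \<in> A} = emeasure lborel A"
  proof (rule rescaled_measure_invariant[where \<A>="sets borel" and B=B and 
        F="\<lambda>h A. emeasure lborel {x. lorentz_inv h *v x \<in> A}" and T="\<lambda>h A. {x. lorentz_inv h *v x \<in> A}"])
    fix g :: "'d lmat" assume g: "g \<in> SO"
    show "emeasure lborel {x. lorentz_inv g *v x \<in> A} * emeasure lborel B
        = emeasure lborel A * emeasure lborel {x. lorentz_inv g *v x \<in> B}"
      if "A \<in> sets borel" for A
      using scale[OF g that] by (simp only: N that Bb)
    have "open {x. lorentz_inv g *v x \<in> B}"
      using open_vimage[of B "(*v) (lorentz_inv g)"]
      by (simp add: B_def vimage_def linear_continuous_on linear_linear)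
    then have o: "open {x. lorentz_inv g *v x \<in> B}" .
    have z: "0 \<in> {x. lorentz_inv g *v x \<in> B}" by (simp add: B_def)
    obtain e where e: "e > 0" "ball 0 e \<subseteq> {x. lorentz_inv g *v x \<in> B}" using openE[OF o z] by blast
    have "{x. lorentz_inv g *v x \<in> B} \<in> sets lborel" using o by simp
    then have "emeasure lborel (ball (0 :: 'd lvec) e) \<le> emeasure lborel {x. lorentz_inv g *v x \<in> B}"
      using emeasure_mono[OF e(2)] by blast
    then have "emeasure lborel {x. lorentz_inv g *v x \<in> B} \<noteq> 0"
      using content_ball_pos[OF e(1), of "0 :: 'd lvec"] by (auto simp: measure_def)
    then show "emeasure lborel {x. lorentz_inv g *v x \<in> B} \<noteq> 0 \<and> emeasure lborel {x. lorentz_inv g *v x \<in> B} \<noteq> \<infinity>"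
      using fin[of g] im[OF g] by (auto simp: less_top)
    show "{x. lorentz_inv g *v x \<in> A} \<in> sets borel" if "A \<in> sets borel" for A
      using measurable_sets[of "(*v) (lorentz_inv g)" borel borel A] that by (simp add: vimage_def)
  next
    fix k :: "'d lmat" assume k: "k \<in> SO" and o: "orthogonal_matrix k"
    have "norm (k *v x) = norm x" for x
      using o by (simp add: orthogonal_transformation_matrix orthogonal_transformation_norm)
    moreover have "k *v (lorentz_inv k *v x) = x" for x
      using k by (simp add: matrix_vector_mul_assoc lorentz_inv_right)
    ultimately have "norm (lorentz_inv k *v x) = norm x" for x by metis
    then have "{x. lorentz_inv k *v x \<in> B} = B" by (auto simp: B_def)
    then show "emeasure lborel {x. lorentz_inv k *v x \<in> B} = emeasure lborel B" by simp
  qed (use Bb h A in \<open>auto simp: lorentz_inv_mult matrix_vector_mul_assoc lorentz_inv_one SO_inv\<close>)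
  then show ?thesis by (simp add: lorentz_inv_involution)
qed

subsection \<open>Fundamental domains\<close>

definition int_matrix :: "real ^ 'n ^ 'm \<Rightarrow> bool" where
  "int_matrix A \<longleftrightarrow> (\<forall>i j. A $ i $ j \<in> \<int>)"

lemma countable_int_matrix: "countable {A :: real ^ 'n ^ 'm. int_matrix A}"
proof -
  have "{A :: real ^ 'n ^ 'm. int_matrix A} \<subseteq> (\<lambda>f. \<chi> i j. f i j) ` {f. \<forall>i j. f i j \<in> \<int>}"
  proof
    fix A :: "real ^ 'n ^ 'm" assume "A \<in> {A. int_matrix A}"
    then show "A \<in> (\<lambda>f. \<chi> i j. f i j) ` {f. \<forall>i j. f i j \<in> \<int>}"
      by (intro image_eqI[of _ _ "\<lambda>i j. A $ i $ j"]) (auto simp: int_matrix_def vec_eq_iff)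
  qed
  moreover have "countable {f :: 'm \<Rightarrow> 'n \<Rightarrow> real. \<forall>i j. f i j \<in> \<int>}"
  proof -
    have "{f :: 'm \<Rightarrow> 'n \<Rightarrow> real. \<forall>i j. f i j \<in> \<int>} \<subseteq> (\<lambda>f i j. of_int (f i j)) ` UNIV"
    proof
      fix f :: "'m \<Rightarrow> 'n \<Rightarrow> real" assume "f \<in> {f. \<forall>i j. f i j \<in> \<int>}"
      then have "f = (\<lambda>i j. of_int \<lfloor>f i j\<rfloor>)" by (auto simp: fun_eq_iff Ints_def)
      then show "f \<in> range (\<lambda>f i j. of_int (f i j))"
        by (rule image_eqI[where x="\<lambda>i j. \<lfloor>f i j\<rfloor>", OF _ UNIV_I])
    qed
    moreover have "countable (UNIV :: ('m \<Rightarrow> 'n \<Rightarrow> int) set)" by simp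
    ultimately show ?thesis by (meson countable_image countable_subset)
  qed
  ultimately show ?thesis by (meson countable_image countable_subset)
qed

lemma int_matrix_norm_less_one:
  fixes A :: "real ^ 'n ^ 'm"
  assumes "int_matrix A" "norm A < 1" shows "A = 0"
proof -
  have "A $ i $ j = 0" for i j
  proof -
    have "\<bar>A $ i $ j\<bar> < 1"
      using assms(2) component_le_norm_cart[of "A $ i" j] Finite_Cartesian_Product.norm_nth_le[of A i] by linarith
    then show ?thesis using assms(1) Ints_nonzero_abs_less1 by (auto simp: int_matrix_def)
  qed
  then show ?thesis by (simp add: vec_eq_iff)
qed

lemma int_matrix_diff: "int_matrix A \<Longrightarrow> int_matrix B \<Longrightarrow> int_matrix (A - B)"
  by (simp add: int_matrix_def)

lemma int_matrix_mult: "int_matrix A \<Longrightarrow> int_matrix B \<Longrightarrow> int_matrix (A ** B)"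
  by (auto simp: int_matrix_def matrix_matrix_mult_def)

lemma int_matrix_one: "int_matrix (mat 1)"
  by (simp add: int_matrix_def mat_def)

lemma int_matrix_lorentz_inv: "int_matrix A \<Longrightarrow> int_matrix (lorentz_inv A)"
  by (simp add: int_matrix_def lorentz_inv_nth)

section \<open>Haar measure, packing and covering\<close>

locale so_haar = lorentz_frame i1 i2 for i1 i2 :: "'d::finite" +
  fixes \<mu> :: "'d lmat measure"
  assumes haar: "haar_measure SO_d_1 \<mu>"
begin

lemma sets_\<mu>: "A \<in> sets \<mu> \<longleftrightarrow> A \<subseteq> SO \<and> A \<in> sets borel"
  using haar sets_restrict_space_iff[of "SO" borel A] SO_borel
  by (auto simp: haar_measure_def)

lemma space_\<mu>: "space \<mu> = SO"
  using haar sets_eq_imp_space_eq[of \<mu> "restrict_space borel (SO)"]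
  by (auto simp: haar_measure_def space_restrict_space)

lemma haar_left: "g \<in> SO \<Longrightarrow> A \<in> sets \<mu> \<Longrightarrow> emeasure \<mu> (g <#\<^bsub>SO_d_1\<^esub> A) = emeasure \<mu> A"
  using haar unfolding haar_measure_def by blast

definition haar_ext :: "'d lmat measure" where
  "haar_ext = distr \<mu> borel (\<lambda>x. x)"

lemma id_measurable: "(\<lambda>x. x) \<in> \<mu> \<rightarrow>\<^sub>M borel"
  by (rule measurableI) (auto simp: space_\<mu> sets_\<mu> intro: sets.Int SO_borel)

lemma emeasure_haar_ext: "A \<in> sets borel \<Longrightarrow> emeasure haar_ext A = emeasure \<mu> (A \<inter> SO)"
  using id_measurable by (simp add: haar_ext_def emeasure_distr space_\<mu>)

lemma sets_haar_ext [measurable_cong]: "sets haar_ext = sets borel"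
  and space_haar_ext [simp]: "space haar_ext = UNIV"
  by (simp_all add: haar_ext_def)

lemma emeasure_\<mu>: "A \<in> sets \<mu> \<Longrightarrow> emeasure \<mu> A = emeasure haar_ext A"
  using emeasure_haar_ext[of A] sets_\<mu>[of A] by (simp add: Int_absorb2)

lemma left_haar_ext: "left_haar haar_ext"
  unfolding left_haar_def
proof (intro conjI ballI allI impI)
  show "emeasure haar_ext (- SO) = 0"
    by (subst emeasure_haar_ext) (auto intro!: borel_comp)
  show "emeasure haar_ext UNIV \<noteq> 0"
    using haar by (simp add: emeasure_haar_ext haar_measure_def)
  fix g :: "'d lmat" assume g: "g \<in> SO"
  have meas: "(**) g \<in> borel_measurable borel"
    by (intro borel_measurable_continuous_onI continuous_intros)
  show "distr haar_ext borel ((**) g) = haar_ext"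
  proof (rule measure_eqI)
    fix A assume "A \<in> sets (distr haar_ext borel ((**) g))"
    then have A: "A \<in> sets borel" by simp
    define B where "B = {x. g ** x \<in> A}"
    have B: "B \<in> sets borel" using measurable_sets[OF meas A] by (simp add: B_def vimage_def)
    have "g <#\<^bsub>SO_d_1\<^esub> (B \<inter> SO) = A \<inter> SO"
    proof (intro subset_antisym subsetI)
      fix x assume x: "x \<in> A \<inter> SO"
      then have "lorentz_inv g ** x \<in> B \<inter> SO"
        using g by (auto simp: B_def SO_mult SO_inv matrix_mul_assoc lorentz_inv_right)
      moreover have "x = g ** (lorentz_inv g ** x)" using SO_inv_mult_cancel[OF g] by simp
      ultimately show "x \<in> g <#\<^bsub>SO_d_1\<^esub> (B \<inter> SO)" by (auto simp: l_coset_def)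
    qed (use g in \<open>auto simp: l_coset_def B_def SO_mult\<close>)
    moreover have "B \<inter> SO \<in> sets \<mu>" using B SO_borel by (auto simp: sets_\<mu>)
    ultimately have "emeasure \<mu> (B \<inter> SO) = emeasure \<mu> (A \<inter> SO)"
      using haar_left[OF g] by metis
    moreover have "emeasure (distr haar_ext borel ((**) g)) A = emeasure haar_ext B"
    proof -
      have "(**) g \<in> haar_ext \<rightarrow>\<^sub>M borel"
        unfolding measurable_cong_sets[OF sets_haar_ext refl] by (rule meas)
      then show ?thesis by (simp add: emeasure_distr[OF _ A] B_def vimage_def)
    qed
    ultimately show "emeasure (distr haar_ext borel ((**) g)) A = emeasure haar_ext A"
      using A B by (simp add: emeasure_haar_ext)
  qed (simp add: sets_haar_ext)
next
  fix A :: "'d lmat set" assume A: "bounded A \<and> A \<in> sets borel"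
  define K where "K = closure A \<inter> SO"
  have K: "compact K" "K \<subseteq> SO" unfolding K_def using A closed_SO by (auto intro: compact_Int_closed)
  have "emeasure \<mu> (A \<inter> SO) \<le> emeasure \<mu> K"
    using closure_subset[of A] K by (intro emeasure_mono) (auto simp: sets_\<mu> K_def intro!: borel_closed compact_imp_closed)
  also have "\<dots> < \<infinity>" using haar K by (simp add: haar_measure_def)
  finally show "emeasure haar_ext A < \<infinity>" using A by (simp add: emeasure_haar_ext)
qed (simp add: sets_haar_ext)

lemmas right_invariant = left_haar_unimodular[OF left_haar_ext]

lemma right_translate_image:
  fixes h :: "'d lmat" and A :: "'d lmat set"
  assumes "h \<in> SO"
  shows "(\<lambda>x. x ** h) ` A = {x. x ** lorentz_inv h \<in> A}"
proof -
  have "x ** h ** lorentz_inv h = x" "x ** lorentz_inv h ** h = x" for x :: "'d lmat"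
    by (simp_all only: SO_inv_mult_cancel(3,4)[OF assms])
  then show ?thesis by (auto simp: image_iff) metis
qed

lemma right_translate:
  assumes "h \<in> SO" "A \<in> sets borel"
  shows "(\<lambda>x. x ** h) ` A \<in> sets borel" "emeasure haar_ext ((\<lambda>x. x ** h) ` A) = emeasure haar_ext A"
  using right_invariant[OF SO_inv(2)[OF assms(1)] assms(2)] right_vimage_borel[OF assms(2)]
  by (simp_all add: right_translate_image[OF assms(1)])

text \<open>Unfolding: sum over \<open>\<gamma>\<close> the measures of the points \<open>x\<close>
  of \<open>F\<close> with \<open>x ** \<gamma>\<close> in \<open>S\<close>. Covering counts every
  point of \<open>F\<close> at least once. Right invariance moves the translation from
  \<open>S\<close> to \<open>F\<close>, and then packing counts every point of \<open>S\<close> at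
  most once.\<close>

lemma packing_le_covering:
  assumes \<Gamma>: "countable \<Gamma>" "\<Gamma> \<subseteq> SO"
    and F: "F \<in> sets borel" and S: "S \<in> sets borel"
    and covering: "\<And>x. x \<in> F \<Longrightarrow> \<exists>\<gamma>\<in>\<Gamma>. x ** \<gamma> \<in> S"
    and packing: "\<And>x y \<gamma> \<delta>. x \<in> F \<Longrightarrow> y \<in> F \<Longrightarrow> \<gamma> \<in> \<Gamma> \<Longrightarrow> \<delta> \<in> \<Gamma> \<Longrightarrow> x ** \<gamma> = y ** \<delta> \<Longrightarrow> \<gamma> = \<delta>"
  shows "emeasure haar_ext F \<le> emeasure haar_ext S"
proof -
  note [measurable] = F S
  have ind: "(\<lambda>x. indicator A (x ** \<gamma>) :: ennreal) \<in> borel_measurable haar_ext" if [measurable]: "A \<in> sets borel"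
    for A and \<gamma> :: "'d lmat"
    unfolding measurable_cong_sets[OF sets_haar_ext refl]
    by (rule measurable_compose[OF borel_matrix_mult_right]) measurable
  have "emeasure haar_ext F = (\<integral>\<^sup>+ x. indicator F x \<partial>haar_ext)"
    by (simp add: sets_haar_ext F)
  also have "\<dots> \<le> (\<integral>\<^sup>+ x. (\<integral>\<^sup>+ \<gamma>. indicator F x * indicator S (x ** \<gamma>) \<partial>count_space \<Gamma>) \<partial>haar_ext)"
  proof (rule nn_integral_mono)
    fix x
    show "indicator F x \<le> (\<integral>\<^sup>+ \<gamma>. indicator F x * indicator S (x ** \<gamma>) \<partial>count_space \<Gamma>)"
    proof (cases "x \<in> F")
      case True
      then obtain \<gamma> where \<gamma>: "\<gamma> \<in> \<Gamma>" "x ** \<gamma> \<in> S" using covering by blast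
      have "indicator F x * indicator S (x ** \<gamma>) \<le> (\<integral>\<^sup>+ \<gamma>. indicator F x * indicator S (x ** \<gamma>) \<partial>count_space \<Gamma>)"
        using \<gamma>(1) by (rule nn_integral_ge_point)
      then show ?thesis using \<gamma> True by simp
    qed simp
  qed
  also have "\<dots> = (\<integral>\<^sup>+ \<gamma>. (\<integral>\<^sup>+ x. indicator F x * indicator S (x ** \<gamma>) \<partial>haar_ext) \<partial>count_space \<Gamma>)"
    by (rule nn_integral_count_space_nn_integral[OF \<Gamma>(1)]) (auto intro!: borel_measurable_times ind S
        simp: measurable_cong_sets[OF sets_haar_ext refl])
  also have "\<dots> = (\<integral>\<^sup>+ \<gamma>. (\<integral>\<^sup>+ x. indicator F (x ** lorentz_inv \<gamma>) * indicator S x \<partial>haar_ext) \<partial>count_space \<Gamma>)"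
  proof (rule nn_integral_cong)
    fix \<gamma> assume "\<gamma> \<in> space (count_space \<Gamma>)"
    then have \<gamma>: "\<gamma> \<in> SO" using \<Gamma> by auto
    have 1: "{x. x ** \<gamma> \<in> {x. x ** lorentz_inv \<gamma> \<in> F \<and> x \<in> S}} = {x. x \<in> F \<and> x ** \<gamma> \<in> S}"
      using SO_inv_mult_cancel[OF \<gamma>] by auto
    have m: "{x. x ** lorentz_inv \<gamma> \<in> F \<and> x \<in> S} \<in> sets borel" by measurable
    have m2: "{x. x \<in> F \<and> x ** \<gamma> \<in> S} \<in> sets borel" by measurable
    have "(\<integral>\<^sup>+ x. indicator F x * indicator S (x ** \<gamma>) \<partial>haar_ext) = (\<integral>\<^sup>+ x. indicator {x. x \<in> F \<and> x ** \<gamma> \<in> S} x \<partial>haar_ext)"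
      by (intro nn_integral_cong) (auto simp: indicator_def)
    also have "\<dots> = emeasure haar_ext {x. x \<in> F \<and> x ** \<gamma> \<in> S}" using m2 by (simp add: sets_haar_ext)
    also have "\<dots> = emeasure haar_ext {x. x ** lorentz_inv \<gamma> \<in> F \<and> x \<in> S}"
      using right_invariant[OF \<gamma> m] unfolding 1 .
    also have "\<dots> = (\<integral>\<^sup>+ x. indicator {x. x ** lorentz_inv \<gamma> \<in> F \<and> x \<in> S} x \<partial>haar_ext)"
      using m by (simp add: sets_haar_ext)
    also have "\<dots> = (\<integral>\<^sup>+ x. indicator F (x ** lorentz_inv \<gamma>) * indicator S x \<partial>haar_ext)"
      by (intro nn_integral_cong) (auto simp: indicator_def)
    finally show "(\<integral>\<^sup>+ x. indicator F x * indicator S (x ** \<gamma>) \<partial>haar_ext)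
        = (\<integral>\<^sup>+ x. indicator F (x ** lorentz_inv \<gamma>) * indicator S x \<partial>haar_ext)" .
  qed
  also have "\<dots> = (\<integral>\<^sup>+ x. (\<integral>\<^sup>+ \<gamma>. indicator F (x ** lorentz_inv \<gamma>) * indicator S x \<partial>count_space \<Gamma>) \<partial>haar_ext)"
    by (rule nn_integral_count_space_nn_integral[OF \<Gamma>(1), symmetric]) (auto intro!: borel_measurable_times ind F S
        simp: measurable_cong_sets[OF sets_haar_ext refl])
  also have "\<dots> \<le> (\<integral>\<^sup>+ x. indicator S x \<partial>haar_ext)"
  proof (rule nn_integral_mono_AE, use left_haar_AE[OF left_haar_ext] in eventually_elim)
    fix x :: "'d lmat" assume x: "x \<in> SO"
    show "(\<integral>\<^sup>+ \<gamma>. indicator F (x ** lorentz_inv \<gamma>) * indicator S x \<partial>count_space \<Gamma>) \<le> indicator S x"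
    proof (cases "\<exists>\<gamma>\<in>\<Gamma>. x ** lorentz_inv \<gamma> \<in> F")
      case True
      then obtain \<gamma> where \<gamma>: "\<gamma> \<in> \<Gamma>" "x ** lorentz_inv \<gamma> \<in> F" by blast
      have "\<delta> = \<gamma>" if "\<delta> \<in> \<Gamma>" "x ** lorentz_inv \<delta> \<in> F" for \<delta>
        using \<Gamma> by (intro packing[OF that(2) \<gamma>(2) that(1) \<gamma>(1)])
          (use that(1) \<gamma>(1) in \<open>auto simp: SO_inv_mult_cancel subset_iff\<close>)
      then have "(\<integral>\<^sup>+ \<gamma>. indicator F (x ** lorentz_inv \<gamma>) * indicator S x \<partial>count_space \<Gamma>)
          \<le> (\<integral>\<^sup>+ \<delta>. indicator {\<gamma>} \<delta> * indicator S x \<partial>count_space \<Gamma>)"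
        by (intro nn_integral_mono) (auto simp: indicator_def)
      also have "\<dots> = indicator S x" using \<gamma>(1) by (subst nn_integral_multc) auto
      finally show ?thesis .
    next
      case False
      then have "(\<integral>\<^sup>+ \<gamma>. indicator F (x ** lorentz_inv \<gamma>) * indicator S x \<partial>count_space \<Gamma>) = (\<integral>\<^sup>+ \<gamma>. 0 \<partial>count_space \<Gamma>)"
        by (intro nn_integral_cong) auto
      then show ?thesis by simp
    qed
  qed
  also have "\<dots> = emeasure haar_ext S" by (simp add: sets_haar_ext S)
  finally show ?thesis .
qed

lemma subgroup_SO_D:
  assumes "subgroup \<Gamma> SO_d_1"
  shows "\<Gamma> \<subseteq> SO" "mat 1 \<in> \<Gamma>" "x \<in> \<Gamma> \<Longrightarrow> y \<in> \<Gamma> \<Longrightarrow> x ** y \<in> \<Gamma>" "x \<in> \<Gamma> \<Longrightarrow> lorentz_inv x \<in> \<Gamma>"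
  using subgroup.subset[OF assms] subgroup.one_closed[OF assms] subgroup.m_closed[OF assms, of x y]
    subgroup.m_inv_closed[OF assms, of x] SO_inv(1)[of x] by auto

lemma fundamental_domain_iff:
  "fundamental_domain SO_d_1 \<mu> \<Gamma> F \<longleftrightarrow> F \<in> sets \<mu> \<and> (\<forall>a\<in>SO. \<exists>!x. x \<in> F \<and> (\<exists>\<gamma>\<in>\<Gamma>. x = a ** \<gamma>))"
  unfolding fundamental_domain_def LCOSETS_def l_coset_def by (auto simp: conj_commute)

lemma fundamental_domain_packing:
  assumes F: "fundamental_domain SO_d_1 \<mu> \<Gamma> F" and \<Gamma>: "subgroup \<Gamma> SO_d_1"
    and "x \<in> F" "y \<in> F" "\<gamma> \<in> \<Gamma>" "\<delta> \<in> \<Gamma>" "x ** \<gamma> = y ** \<delta>"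
  shows "\<gamma> = \<delta> \<and> x = y"
proof -
  have x: "x \<in> SO" using F assms(3) by (auto simp: fundamental_domain_iff sets_\<mu>)
  have g: "\<gamma> \<in> SO" "\<delta> \<in> SO" using subgroup_SO_D(1)[OF \<Gamma>] assms by auto
  have "y = x ** (\<gamma> ** lorentz_inv \<delta>)" using assms(7) SO_inv_mult_cancel[OF g(2)] by (metis matrix_mul_assoc)
  moreover have "\<gamma> ** lorentz_inv \<delta> \<in> \<Gamma>" "x = x ** mat 1" "mat 1 \<in> \<Gamma>" using subgroup_SO_D[OF \<Gamma>] assms by auto
  ultimately have "x = y" using F x assms(3,4) unfolding fundamental_domain_iff by metis
  then show ?thesis using assms(7) SO_inv_mult_cancel(1)[OF x] by metis
qed

lemma fundamental_domain_covering:
  assumes F: "fundamental_domain SO_d_1 \<mu> \<Gamma> F" and \<Gamma>: "subgroup \<Gamma> SO_d_1"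
    and x: "x \<in> SO"
  shows "\<exists>\<gamma>\<in>\<Gamma>. x ** \<gamma> \<in> F"
  using F x unfolding fundamental_domain_iff by metis

lemma covolume_eq:
  assumes F: "fundamental_domain SO_d_1 \<mu> \<Gamma> F" and \<Gamma>: "subgroup \<Gamma> SO_d_1" "countable \<Gamma>"
  shows "covolume SO_d_1 \<mu> \<Gamma> = emeasure haar_ext F"
  unfolding covolume_def
proof (rule the_equality)
  have le: "emeasure \<mu> F1 \<le> emeasure \<mu> F2"
    if "fundamental_domain SO_d_1 \<mu> \<Gamma> F1" "fundamental_domain SO_d_1 \<mu> \<Gamma> F2" for F1 F2
  proof -
    have s: "F1 \<in> sets \<mu>" "F2 \<in> sets \<mu>" using that by (auto simp: fundamental_domain_iff)
    have "emeasure haar_ext F1 \<le> emeasure haar_ext F2"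
      by (rule packing_le_covering[OF \<Gamma>(2) subgroup_SO_D(1)[OF \<Gamma>(1)]])
        (use s that fundamental_domain_packing[OF _ \<Gamma>(1)] fundamental_domain_covering[OF _ \<Gamma>(1)] in \<open>auto simp: sets_\<mu> subset_iff\<close>)
    then show ?thesis using s by (simp add: emeasure_\<mu>)
  qed
  have e: "emeasure haar_ext F = emeasure \<mu> F" using F by (simp add: emeasure_\<mu> fundamental_domain_iff)
  then show "\<exists>F'. fundamental_domain SO_d_1 \<mu> \<Gamma> F' \<and> emeasure haar_ext F = emeasure \<mu> F'" using F by auto
  show "v = emeasure haar_ext F" if "\<exists>F. fundamental_domain SO_d_1 \<mu> \<Gamma> F \<and> v = emeasure \<mu> F" for v
    using that le F unfolding e by (auto intro!: antisym)
qed

text \<open>Countably many relatively open pieces cover the group, each so small that no nontrivial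
  element of \<open>\<Gamma>\<close> carries one of its points to another. From each coset the
  domain takes the point in the first piece that the coset meets.\<close>

lemma fundamental_domain_exists:
  assumes \<Gamma>: "subgroup \<Gamma> SO_d_1" and int: "\<And>\<gamma>. \<gamma> \<in> \<Gamma> \<Longrightarrow> int_matrix \<gamma>"
  obtains F where "fundamental_domain SO_d_1 \<mu> \<Gamma> F"
proof -
  have cnt: "countable \<Gamma>" by (rule countable_subset[OF _ countable_int_matrix]) (use int in auto)
  \<comment> \<open>The radius is one because an integral matrix at distance less than one from the
    identity is the identity.\<close>
  define W where "W = {p. lorentz_inv (fst p) ** snd p \<in> ball (mat 1 :: 'd lmat) 1}"
  have "open W"
    using open_vimage[of "ball (mat 1) 1" "\<lambda>p :: 'd lmat \<times> _. lorentz_inv (fst p) ** snd p"]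
    by (simp add: W_def vimage_def continuous_intros)
  moreover have "(mat 1, mat 1) \<in> W" by (simp add: W_def lorentz_inv_one)
  ultimately obtain A B where AB: "open A" "open B" "(mat 1, mat 1) \<in> A \<times> B" "A \<times> B \<subseteq> W"
    by (metis open_prod_elim)
  define U where "U = A \<inter> B"
  have U: "open U" "mat 1 \<in> U" "\<And>u v. u \<in> U \<Longrightarrow> v \<in> U \<Longrightarrow> norm (lorentz_inv u ** v - mat 1) < 1"
    using AB by (auto simp: U_def W_def dist_norm norm_minus_commute)
  define V where "V g = {x. lorentz_inv g ** x \<in> U}" for g
  have V: "open (V g)" for g
    unfolding V_def using open_vimage[OF U(1), of "(**) (lorentz_inv g)"]
    by (simp add: vimage_def continuous_on_matrix_mult)
  obtain \<F> where \<F>: "\<F> \<subseteq> V ` SO" "countable \<F>" "\<Union>\<F> = (\<Union>g\<in>SO. V g)"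
    using Lindelof[of "V ` SO"] V by auto
  have cov: "SO \<subseteq> \<Union>\<F>"
    unfolding \<F>(3) V_def using U by (auto simp: lorentz_inv_left intro!: bexI)
  have ne: "\<F> \<noteq> {}" using cov SO_one by auto
  define E where "E n = from_nat_into \<F> n \<inter> SO" for n
  have EV: "\<exists>g\<in>SO. E n = V g \<inter> SO" for n
    using from_nat_into[OF ne, of n] \<F>(1) unfolding E_def by blast
  have E: "E n \<in> sets borel" for n
    using EV[of n] V SO_borel by auto
  have EG: "E n \<subseteq> SO" for n by (auto simp: E_def)
  have E_inj: "\<gamma> = mat 1" if x: "x \<in> E n" "x ** \<gamma> \<in> E n" "\<gamma> \<in> \<Gamma>" for x \<gamma> n
  proof -
    obtain g where g: "g \<in> SO" "E n = V g \<inter> SO" using EV by blast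
    have u: "lorentz_inv g ** x \<in> U" "lorentz_inv g ** x ** \<gamma> \<in> U" "lorentz_inv g ** x \<in> SO"
      using x g by (auto simp: V_def matrix_mul_assoc SO_mult SO_inv)
    have "lorentz_inv (lorentz_inv g ** x) ** (lorentz_inv g ** x ** \<gamma>) = \<gamma>"
      by (rule SO_inv_mult_cancel(1)[OF u(3)])
    then have "norm (\<gamma> - mat 1) < 1" using U(3)[OF u(1,2)] by simp
    then show ?thesis
      using int_matrix_norm_less_one[OF int_matrix_diff[OF int[OF x(3)] int_matrix_one]] by simp
  qed
  define P where "P n x \<longleftrightarrow> (\<exists>\<gamma>\<in>\<Gamma>. x ** \<gamma> \<in> E n)" for n x
  have P_inv: "P n (x ** \<delta>) \<longleftrightarrow> P n x" if "\<delta> \<in> \<Gamma>" for n x \<delta>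
  proof -
    have d: "\<delta> \<in> SO" using subgroup_SO_D(1)[OF \<Gamma>] that by auto
    have "x ** \<gamma> = x ** \<delta> ** (lorentz_inv \<delta> ** \<gamma>)" for \<gamma> using SO_inv_mult_cancel[OF d] by (metis matrix_mul_assoc)
    moreover have "x ** \<delta> ** \<gamma> = x ** (\<delta> ** \<gamma>)" for \<gamma> by (simp add: matrix_mul_assoc)
    ultimately show ?thesis unfolding P_def using subgroup_SO_D(3,4)[OF \<Gamma>] that by metis
  qed
  have P_borel: "{x. P n x} \<in> sets borel" for n
  proof -
    have "{x. P n x} = (\<Union>\<gamma>\<in>\<Gamma>. {x. x ** \<gamma> \<in> E n})" by (auto simp: P_def)
    moreover have "{x. x ** \<gamma> \<in> E n} \<in> sets borel" for \<gamma> :: "'d lmat"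
      by (rule right_vimage_borel[OF E])
    ultimately show ?thesis using cnt by auto
  qed
  define F where "F = (\<Union>n. E n - (\<Union>m<n. {x. P m x}))"
  have F_iff: "x \<in> F \<longleftrightarrow> (\<exists>n. x \<in> E n \<and> (\<forall>m<n. \<not> P m x))" for x by (auto simp: F_def)
  have "fundamental_domain SO_d_1 \<mu> \<Gamma> F"
    unfolding fundamental_domain_iff
  proof (intro conjI ballI)
    have "F \<in> sets borel" unfolding F_def using E P_borel by (intro sets.countable_UN sets.Diff) auto
    then show "F \<in> sets \<mu>" using EG by (auto simp: sets_\<mu> F_def)
    fix a :: "'d lmat" assume a: "a \<in> SO"
    have exP: "\<exists>n. P n a"
    proof -
      obtain X where "X \<in> \<F>" "a \<in> X" using cov a by blast
      then obtain n where "from_nat_into \<F> n = X" using from_nat_into_surj[OF \<F>(2)] by blast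
      then have "a ** mat 1 \<in> E n" using \<open>a \<in> X\<close> a by (simp add: E_def)
      then show ?thesis unfolding P_def using subgroup_SO_D(2)[OF \<Gamma>] by blast
    qed
    define n where "n = (LEAST n. P n a)"
    have n: "P n a" "\<And>m. m < n \<Longrightarrow> \<not> P m a"
      unfolding n_def using exP by (auto intro: LeastI_ex dest: not_less_Least)
    obtain \<gamma> where \<gamma>: "\<gamma> \<in> \<Gamma>" "a ** \<gamma> \<in> E n" using n(1) P_def by blast
    have char: "a ** \<delta> \<in> F \<longleftrightarrow> a ** \<delta> \<in> E n" if d: "\<delta> \<in> \<Gamma>" for \<delta>
    proof
      assume "a ** \<delta> \<in> E n" then show "a ** \<delta> \<in> F" using n(2) P_inv[OF d] unfolding F_iff by blast
    next
      assume "a ** \<delta> \<in> F"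
      then obtain k where k: "a ** \<delta> \<in> E k" "\<forall>m<k. \<not> P m a" unfolding F_iff P_inv[OF d] by blast
      have "P k a" using k(1) d P_def by blast
      then have "k = n" using k(2) n by (metis linorder_neqE_nat)
      then show "a ** \<delta> \<in> E n" using k by simp
    qed
    show "\<exists>!x. x \<in> F \<and> (\<exists>\<gamma>\<in>\<Gamma>. x = a ** \<gamma>)"
    proof (rule ex1I[of _ "a ** \<gamma>"])
      show "a ** \<gamma> \<in> F \<and> (\<exists>\<gamma>'\<in>\<Gamma>. a ** \<gamma> = a ** \<gamma>')" using char \<gamma> by blast
      fix x assume "x \<in> F \<and> (\<exists>\<gamma>\<in>\<Gamma>. x = a ** \<gamma>)"
      then obtain \<delta> where d: "\<delta> \<in> \<Gamma>" "x = a ** \<delta>" "a ** \<delta> \<in> E n" using char by blast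
      have gc: "\<gamma> \<in> SO" using subgroup_SO_D(1)[OF \<Gamma>] \<gamma> by auto
      have "a ** \<gamma> ** (lorentz_inv \<gamma> ** \<delta>) = a ** \<delta>" using SO_inv_mult_cancel[OF gc] by (metis matrix_mul_assoc)
      then have "lorentz_inv \<gamma> ** \<delta> = mat 1" using E_inj[OF \<gamma>(2), of "lorentz_inv \<gamma> ** \<delta>"] d \<gamma> subgroup_SO_D(3,4)[OF \<Gamma>] by auto
      then show "x = a ** \<gamma>" using \<open>a ** \<gamma> ** (lorentz_inv \<gamma> ** \<delta>) = a ** \<delta>\<close> d(2) by simp
    qed
  qed
  then show thesis by (rule that)
qed

end

subsection \<open>Cusps\<close>

lemma norm_matrix_le:
  fixes A :: "real ^ 'n ^ 'm"
  assumes "\<And>i j. \<bar>A $ i $ j\<bar> \<le> B"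
  shows "norm A \<le> real CARD('m) * (real CARD('n) * B)"
proof -
  have 1: "norm (A $ i) \<le> real CARD('n) * B" for i
  proof -
    have "norm (A $ i) \<le> (\<Sum>j\<in>UNIV. norm (A $ i $ j))"
      unfolding norm_vec_def by (rule L2_set_le_sum) simp
    also have "\<dots> \<le> (\<Sum>j\<in>(UNIV::'n set). B)" using assms by (intro sum_mono) simp
    finally show ?thesis by simp
  qed
  have "norm A \<le> (\<Sum>i\<in>UNIV. norm (A $ i))"
    unfolding norm_vec_def[of A] by (rule L2_set_le_sum) simp
  also have "\<dots> \<le> (\<Sum>i\<in>(UNIV::'m set). real CARD('n) * B)" using 1 by (intro sum_mono) simp
  finally show ?thesis by simp
qed

lemma borel_matrix_nth [measurable]: "(\<lambda>h :: real ^ 'n ^ 'm. h $ i $ j) \<in> borel_measurable borel"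
  by (intro borel_measurable_continuous_onI continuous_intros)

context lorentz_frame
begin

lemma borel_rho [measurable]: "rho \<in> borel_measurable borel"
  unfolding rho_expand[abs_def] by measurable

lemma rho_Boost: "rho (h ** Boost nu nu' s) = s * rho h"
  by (simp add: rho_def matrix_vector_mul_assoc[symmetric] Boost_works boost_nu matrix_vector_mult_scaleR)

lemma Boost_row: "i \<noteq> i1 \<Longrightarrow> (h ** Boost nu nu' s) $ None $ Some i = h $ None $ Some i"
  by (simp add: matrix_axis_nth[symmetric] matrix_vector_mul_assoc[symmetric] Boost_works boost_nu_axis)

lemma rho_Eichler: "horo w \<Longrightarrow> rho (h ** Eichler nu w) = rho h"
  by (simp add: rho_def matrix_vector_mul_assoc[symmetric] Eichler_works eichler_nu_nu)

lemma Eichler_row: "horo w \<Longrightarrow> i \<noteq> i1 \<Longrightarrow>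
    (h ** Eichler nu w) $ None $ Some i = h $ None $ Some i - w $ Some i * rho h"
  by (simp add: matrix_axis_nth[symmetric] matrix_vector_mul_assoc[symmetric] Eichler_works
      eichler_nu_axis rho_def matrix_vector_mult_diff_distrib matrix_vector_mult_scaleR)

text \<open>
  Modulo the maximal compact subgroup on the left, \<open>rho h\<close> and the quotients of \<open>h $ None $ Some i\<close>
  by \<open>rho h\<close> are coordinates of the upper half-space model, in which right multiplication by boosts
  and Eichler transformations acts by dilations and translations.
\<close>

definition slab :: "real \<Rightarrow> real \<Rightarrow> real \<Rightarrow> 'd lmat set" where
  "slab a b R = {h \<in> SO. a \<le> rho h \<and> rho h \<le> b \<and>
     (\<forall>i\<in>- {i1}. \<bar>h $ None $ Some i\<bar> \<le> R * rho h)}"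

definition cusp :: "real \<Rightarrow> 'd lmat set" where
  "cusp R = {h \<in> SO. 0 < rho h \<and> rho h < 1 \<and>
     (\<forall>i\<in>- {i1}. \<bar>h $ None $ Some i\<bar> \<le> R * rho h)}"

lemma slab_borel: "slab a b R \<in> sets borel"
proof -
  have "{h. a \<le> rho h \<and> rho h \<le> b \<and> (\<forall>i\<in>- {i1}. \<bar>h $ None $ Some i\<bar> \<le> R * rho h)} \<in> sets borel"
    by measurable
  moreover have "slab a b R = SO \<inter> {h. a \<le> rho h \<and> rho h \<le> b \<and> (\<forall>i\<in>- {i1}. \<bar>h $ None $ Some i\<bar> \<le> R * rho h)}"
    by (auto simp: slab_def)
  ultimately show ?thesis by simp
qed

lemma cusp_borel: "cusp R \<in> sets borel"
proof -
  have "{h. 0 < rho h \<and> rho h < 1 \<and> (\<forall>i\<in>- {i1}. \<bar>h $ None $ Some i\<bar> \<le> R * rho h)} \<in> sets borel"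
    by measurable
  moreover have "cusp R = SO \<inter> {h. 0 < rho h \<and> rho h < 1 \<and> (\<forall>i\<in>- {i1}. \<bar>h $ None $ Some i\<bar> \<le> R * rho h)}"
    by (auto simp: cusp_def)
  ultimately show ?thesis by simp
qed

lemma sum_split_i1: "(\<Sum>i\<in>UNIV. f i) = f i1 + (\<Sum>i\<in>- {i1}. f i)" for f :: "'d \<Rightarrow> real"
  by (simp add: sum.remove[of UNIV i1] Compl_eq_Diff_UNIV)

text \<open>The row of \<open>None\<close> is bounded, and it bounds the columns because they have norm \<open>\<plusminus>1\<close>.\<close>

lemma bounded_slab: "bounded (slab (1/2) 1 R)"
proof -
  define K where "K = 1 + real CARD('d) * R\<^sup>2"
  define L where "L = K + 1 + \<bar>R\<bar>"
  have K: "K \<ge> 1" by (simp add: K_def)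
  have "norm h \<le> real CARD('d option) * (real CARD('d option) * (1 + L))" if h: "h \<in> slab (1/2) 1 R" for h
  proof (rule norm_matrix_le)
    have hG: "h \<in> SO" and r: "1/2 \<le> rho h" "rho h \<le> 1"
      and row: "\<And>i. i \<noteq> i1 \<Longrightarrow> \<bar>h $ None $ Some i\<bar> \<le> R * rho h" using h by (auto simp: slab_def)
    have rowR: "\<bar>h $ None $ Some i\<bar> \<le> \<bar>R\<bar>" if "i \<noteq> i1" for i
    proof -
      have "R * rho h \<le> \<bar>R\<bar> * 1" using r by (intro mult_mono) auto
      then show ?thesis using row[OF that] by linarith
    qed
    define a b where "a = h $ None $ None" and "b = h $ None $ Some i1"
    have "(\<Sum>i\<in>- {i1}. (h $ None $ Some i)\<^sup>2) \<le> (\<Sum>i\<in>- {i1}. R\<^sup>2)"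
      using rowR by (intro sum_mono) (metis ComplD insertI1 abs_le_square_iff)
    also have "\<dots> \<le> real CARD('d) * R\<^sup>2" by (auto intro!: mult_right_mono card_mono)
    finally have "a\<^sup>2 - b\<^sup>2 \<le> K"
      using SO_row_zero[OF hG] by (simp add: a_def b_def K_def sum_split_i1)
    moreover have "a\<^sup>2 - b\<^sup>2 \<ge> 0"
      using SO_row_zero[OF hG] sum_nonneg[of "- {i1}" "\<lambda>i. (h $ None $ Some i)\<^sup>2"] by (simp add: a_def b_def sum_split_i1)
    moreover have ab: "b + a = rho h" by (simp add: rho_expand a_def b_def)
    \<comment> \<open>The sum is \<open>rho h\<close>, at least \<open>1/2\<close>, so a bound on
      the product bounds the difference and thereby both entries.\<close>
    moreover have "a\<^sup>2 - b\<^sup>2 = (a - b) * (b + a)" by (simp add: power2_eq_square algebra_simps)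
    ultimately have "(a - b) * rho h \<le> K" "(a - b) * rho h \<ge> 0" by simp_all
    then have "0 \<le> a - b" using r by (simp add: zero_le_mult_iff)
    moreover have "(a - b) * (1/2) \<le> (a - b) * rho h" using calculation r by (intro mult_left_mono) auto
    ultimately have "0 \<le> a - b" "a - b \<le> 2 * K" using \<open>(a - b) * rho h \<le> K\<close> by auto
    then have abL: "\<bar>a\<bar> \<le> L" "\<bar>b\<bar> \<le> L" using ab r K unfolding L_def by linarith+
    have row0: "\<bar>h $ None $ j\<bar> \<le> L" for j
    proof (cases j)
      case (Some i) then show ?thesis using abL rowR[of i] K unfolding L_def b_def by (cases "i = i1") auto
    qed (use abL a_def in auto)
    have L: "L \<ge> 0" using K by (simp add: L_def)
    fix i j
    show "\<bar>h $ i $ j\<bar> \<le> 1 + L"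
    proof (cases i)
      case (Some i')
      have "(h $ Some i' $ j)\<^sup>2 \<le> (\<Sum>i\<in>UNIV. (h $ Some i $ j)\<^sup>2)"
        by (rule member_le_sum) auto
      also have "\<dots> \<le> 1 + (h $ None $ j)\<^sup>2" using SO_column[OF hG, of j] by (auto split: if_splits)
      also have "\<dots> \<le> 1 + L\<^sup>2" using row0[of j] L by (simp add: abs_le_square_iff[symmetric])
      also have "\<dots> \<le> (1 + L)\<^sup>2" using L by (simp add: power2_eq_square algebra_simps)
      finally show ?thesis using Some L by (metis abs_le_square_iff abs_of_nonneg add_nonneg_nonneg zero_le_one)
    qed (use row0[of j] in auto)
  qed
  then show ?thesis by (auto simp: bounded_iff)
qed

end

context so_haar
begin

text \<open>
  After a boost, \<open>2 ^ m\<close> disjoint horospherical translates of the slab at height \<open>2 ^ - m\<close> fit into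
  one slab of finite measure.
\<close>

lemma slab_measure:
  assumes R: "R > 0"
  shows "ennreal (2 ^ m) * emeasure haar_ext (slab ((1/2) ^ Suc m) ((1/2) ^ m) R)
     \<le> emeasure haar_ext (slab (1/2) 1 (4 * R))"
proof -
  \<comment> \<open>The boost multiplies \<open>rho\<close> by \<open>2 ^ m\<close> and keeps the
    other row entries, so the ratio bound drops from \<open>R\<close> to \<open>R / 2 ^ m\<close>.
    The extra factor 2 makes the inequality strict, as the half-open condition in \<open>P\<close>
    requires.\<close>
  define r where "r = 2 * R / 2 ^ m"
  have r: "r > 0" using R by (simp add: r_def)
  define P where "P = {h \<in> slab (1/2) 1 r. - r * rho h \<le> h $ None $ Some i2 \<and> h $ None $ Some i2 < r * rho h}"
  have P: "P \<in> sets borel"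
  proof -
    have "{h. - r * rho h \<le> h $ None $ Some i2 \<and> h $ None $ Some i2 < r * rho h} \<in> sets borel" by measurable
    moreover have "P = slab (1/2) 1 r \<inter> {h. - r * rho h \<le> h $ None $ Some i2 \<and> h $ None $ Some i2 < r * rho h}"
      by (auto simp: P_def)
    ultimately show ?thesis using slab_borel by simp
  qed
  define a where "a = Boost nu nu' ((2::real) ^ m)"
  have a: "a \<in> SO" unfolding a_def by (rule Boost_nu) simp
  have 1: "emeasure haar_ext (slab ((1/2) ^ Suc m) ((1/2) ^ m) R) \<le> emeasure haar_ext P"
  proof -
    have "slab ((1/2) ^ Suc m) ((1/2) ^ m) R \<subseteq> {h. h ** a \<in> P}"
    proof
      fix h assume h: "h \<in> slab ((1/2) ^ Suc m) ((1/2) ^ m) R"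
      then have hG: "h \<in> SO" and lo: "(1/2) ^ Suc m \<le> rho h" and hi: "rho h \<le> (1/2) ^ m"
        and row: "\<And>i. i \<noteq> i1 \<Longrightarrow> \<bar>h $ None $ Some i\<bar> \<le> R * rho h" by (auto simp: slab_def)
      have pos: "rho h > 0" using lo by (smt (verit) zero_less_power half_gt_zero_iff)
      have e: "rho (h ** a) = 2 ^ m * rho h" by (simp add: a_def rho_Boost)
      have "2 ^ m * (1/2) ^ Suc m \<le> 2 ^ m * rho h" "2 ^ m * rho h \<le> 2 ^ m * (1/2) ^ m"
        using lo hi by (intro mult_left_mono; simp)+
      then have b: "1/2 \<le> rho (h ** a)" "rho (h ** a) \<le> 1" unfolding e by (simp_all add: power_divide)
      have rr: "r * rho (h ** a) = 2 * (R * rho h)" by (simp add: e r_def)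
      have pR: "R * rho h > 0" using R pos by simp
      have "\<bar>(h ** a) $ None $ Some i\<bar> \<le> R * rho h" if "i \<noteq> i1" for i
        using row[OF that] by (simp add: a_def Boost_row that)
      then have c: "\<bar>(h ** a) $ None $ Some i\<bar> < r * rho (h ** a)" if "i \<noteq> i1" for i
        using that pR unfolding rr by force
      have "h ** a \<in> SO" using hG a by (rule SO_mult)
      then show "h \<in> {h. h ** a \<in> P}" using b c i12 unfolding P_def slab_def
        by (auto simp: less_imp_le abs_less_iff minus_less_iff)
    qed
    moreover have "{h. h ** a \<in> P} \<in> sets haar_ext"
      using right_vimage_borel[OF P] by (simp add: sets_haar_ext)
    ultimately have "emeasure haar_ext (slab ((1/2) ^ Suc m) ((1/2) ^ m) R) \<le> emeasure haar_ext {h. h ** a \<in> P}"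
      by (rule emeasure_mono)
    then show ?thesis by (simp only: right_invariant[OF a P])
  qed
  \<comment> \<open>The spacing \<open>2 * r\<close> is the width of the interval in
    \<open>P\<close>, so the translates are disjoint, and \<open>2 ^ m\<close> of them stay within
    the ratio \<open>4 * R\<close>. Translating in one direction already yields geometric
    decay.\<close>
  define w where "w j = axis (Some i2) (2 * r * real j)" for j :: nat
  define u where "u j = Eichler nu (w j)" for j
  have w: "horo (w j)" for j using i12 by (auto simp: w_def horo_def axis_def)
  have u: "u j \<in> SO" for j unfolding u_def by (rule Eichler_nu_SO[OF w])
  define Q where "Q j = {h. h ** u j \<in> P}" for j
  have Q: "Q j \<in> sets borel" for j
    unfolding Q_def by (rule right_vimage_borel[OF P])
  have QD: "h \<in> slab (1/2) 1 (4 * R) \<and> (2 * real j - 1) * r * rho h \<le> h $ None $ Some i2 \<and>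
      h $ None $ Some i2 < (2 * real j + 1) * r * rho h"
    if h: "h \<in> Q j" and j: "j < 2 ^ m" for h j
  proof -
    have hu: "h ** u j \<in> SO" "1/2 \<le> rho h" "rho h \<le> 1"
      and row: "\<And>i. i \<noteq> i1 \<Longrightarrow> \<bar>h $ None $ Some i - w j $ Some i * rho h\<bar> \<le> r * rho h"
      and i2: "- r * rho h \<le> h $ None $ Some i2 - 2 * r * real j * rho h"
        "h $ None $ Some i2 - 2 * r * real j * rho h < r * rho h"
      using h i12 by (auto simp: Q_def P_def slab_def u_def rho_Eichler w Eichler_row) (auto simp: w_def axis_def)
    have hG: "h \<in> SO"
      using SO_mult[OF hu(1) SO_inv(2)[OF u[of j]]] SO_inv_mult_cancel(3)[OF u[of j], of h] by simp
    have rr: "r * rho h > 0" using r hu by simp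
    have "\<bar>h $ None $ Some i\<bar> \<le> 4 * R * rho h" if "i \<noteq> i1" for i
    proof -
      have wj: "0 \<le> w j $ Some i \<and> w j $ Some i \<le> 2 * r * real j" using r by (auto simp: w_def axis_def)
      then have "0 \<le> w j $ Some i * rho h" "w j $ Some i * rho h \<le> 2 * r * real j * rho h"
        using hu by (auto intro!: mult_nonneg_nonneg mult_right_mono)
      then have "\<bar>h $ None $ Some i\<bar> \<le> 2 * r * real j * rho h + r * rho h" using row[OF that] by linarith
      also have "\<dots> = (2 * real j + 1) * (r * rho h)" by (simp add: algebra_simps)
      also have "\<dots> \<le> (2 * 2 ^ m) * (r * rho h)"
      proof (rule mult_right_mono)
        have "Suc j \<le> 2 ^ m" using j by simp
        then have "real (Suc j) \<le> real (2 ^ m)" by (simp only: of_nat_le_iff)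
        then show "2 * real j + 1 \<le> 2 * 2 ^ m" by simp
      qed (use rr in simp)
      also have "\<dots> = 4 * R * rho h" by (simp add: r_def)
      finally show ?thesis .
    qed
    then show ?thesis using hG hu i2 by (auto simp: slab_def algebra_simps)
  qed
  have disj: "disjoint_family_on Q {..<2 ^ m}"
    unfolding disjoint_family_on_def
  proof (intro ballI impI)
    fix j k :: nat assume jk: "j \<in> {..<2 ^ m}" "k \<in> {..<2 ^ m}" "j \<noteq> k"
    have False if x: "x \<in> Q j" "x \<in> Q k" and l: "j < k" "j < 2 ^ m" "k < 2 ^ m" for x j k
    proof -
      have "(2 * real k - 1) * (r * rho x) < (2 * real j + 1) * (r * rho x)"
        using QD[OF x(1) l(2)] QD[OF x(2) l(3)] by (simp add: mult.assoc)
      moreover have "r * rho x > 0" using QD[OF x(1) l(2)] r by (auto simp: slab_def)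
      ultimately have "2 * real k - 1 < 2 * real j + 1" by (simp only: mult_less_cancel_right_pos)
      then show False using l by linarith
    qed
    then show "Q j \<inter> Q k = {}" using jk by (metis disjoint_iff lessThan_iff linorder_neqE_nat)
  qed
  have "ennreal (2 ^ m) * emeasure haar_ext P = (\<Sum>j\<in>{..<(2::nat) ^ m}. emeasure haar_ext (Q j))"
    using right_invariant[OF u P] by (simp add: Q_def ennreal_of_nat_eq_real_of_nat flip: numeral_power_eq_of_nat_cancel_iff)
  also have "\<dots> = emeasure haar_ext (\<Union>j<2 ^ m. Q j)"
    by (rule sum_emeasure) (use Q disj in \<open>auto simp: sets_haar_ext\<close>)
  also have "\<dots> \<le> emeasure haar_ext (slab (1/2) 1 (4 * R))"
    by (rule emeasure_mono) (use QD slab_borel in \<open>auto simp: sets_haar_ext\<close>)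
  finally have "ennreal (2 ^ m) * emeasure haar_ext P \<le> emeasure haar_ext (slab (1/2) 1 (4 * R))" .
  then show ?thesis using mult_left_mono[OF 1, of "ennreal (2 ^ m)"] by (meson order_trans zero_le)
qed

text \<open>Dyadic slabs in \<open>rho\<close> exhaust the cusp, and by \<open>slab_measure\<close>
  a geometric series dominates their measures.\<close>

lemma cusp_measure_finite: assumes R: "R > 0" shows "emeasure haar_ext (cusp R) < \<infinity>"
proof -
  let ?E = "\<lambda>m. slab ((1/2) ^ Suc m) ((1/2) ^ m) R"
  have fin: "emeasure haar_ext (slab (1/2) 1 (4 * R)) < \<infinity>"
    by (rule left_haar_bounded[OF left_haar_ext bounded_slab slab_borel])
  define c where "c = measure haar_ext (slab (1/2) 1 (4 * R))"
  have c: "emeasure haar_ext (slab (1/2) 1 (4 * R)) = ennreal c" "c \<ge> 0"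
    using fin by (simp_all add: c_def emeasure_eq_ennreal_measure less_top)
  have "cusp R \<subseteq> (\<Union>m. ?E m)"
  proof
    fix h assume h: "h \<in> cusp R"
    then have r: "0 < rho h" "rho h < 1" by (auto simp: cusp_def)
    define m where "m = (LEAST m. (1/2::real) ^ m < rho h)"
    have ex: "\<exists>m. (1/2::real) ^ m < rho h" using real_arch_pow_inv[OF r(1), of "1/2"] by simp
    have m: "(1/2) ^ m < rho h" unfolding m_def by (rule LeastI_ex[OF ex])
    have "m \<noteq> 0" using m r by (intro notI) simp
    then obtain k where k: "m = Suc k" by (cases m) auto
    have "\<not> (1/2) ^ k < rho h" using not_less_Least[of k "\<lambda>m. (1/2::real) ^ m < rho h"] k m_def by simp
    then have "h \<in> ?E k" using m h k by (auto simp: cusp_def slab_def)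
    then show "h \<in> (\<Union>m. ?E m)" by blast
  qed
  then have "emeasure haar_ext (cusp R) \<le> emeasure haar_ext (\<Union>m. ?E m)"
    using slab_borel by (intro emeasure_mono sets.countable_UN) (auto simp: sets_haar_ext)
  also have "\<dots> \<le> (\<Sum>m. emeasure haar_ext (?E m))"
    using slab_borel by (intro emeasure_subadditive_countably) (auto simp: sets_haar_ext)
  also have "\<dots> \<le> (\<Sum>m. ennreal (c * (1/2) ^ m))"
  proof (intro suminf_le allI)
    fix m :: nat
    have le: "ennreal (2 ^ m) * emeasure haar_ext (?E m) \<le> ennreal c"
      using slab_measure[OF R, of m] c by simp
    then have "emeasure haar_ext (?E m) \<noteq> \<infinity>" by (auto simp: ennreal_mult_top top_unique)
    then obtain e where e: "emeasure haar_ext (?E m) = ennreal e" "e \<ge> 0" by (metis ennreal_cases infinity_ennreal_def)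
    have "ennreal (2 ^ m * e) \<le> ennreal c" using le e by (subst ennreal_mult) auto
    then have "2 ^ m * e \<le> c" using c(2) by (simp only: ennreal_le_iff)
    then have "e \<le> c * (1/2) ^ m" by (simp add: field_simps power_divide)
    then show "emeasure haar_ext (?E m) \<le> ennreal (c * (1/2) ^ m)" using e by (simp add: ennreal_leI)
  qed auto
  also have "\<dots> < \<infinity>"
  proof -
    have "summable (\<lambda>m. c * (1/2) ^ m)" by (intro summable_mult summable_geometric) simp
    then have "(\<Sum>m. ennreal (c * (1/2) ^ m)) \<noteq> \<infinity>"
      unfolding infinity_ennreal_def by (rule ennreal_suminf_neq_top) (simp add: c(2))
    then show ?thesis by (simp only: infinity_ennreal_def less_top)
  qed
  finally show ?thesis .
qed

subsection \<open>Covolumes of integral subgroups\<close>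

lemma covolume_finite:
  assumes \<Gamma>: "subgroup \<Gamma> SO_d_1" "\<And>\<gamma>. \<gamma> \<in> \<Gamma> \<Longrightarrow> int_matrix \<gamma>"
    and S: "S \<in> sets borel" "emeasure haar_ext S < \<infinity>"
    and covering: "\<And>g. g \<in> SO \<Longrightarrow> \<exists>\<gamma>\<in>\<Gamma>. g ** \<gamma> \<in> S"
  shows "covolume SO_d_1 \<mu> \<Gamma> < \<infinity>"
proof -
  obtain F where F: "fundamental_domain SO_d_1 \<mu> \<Gamma> F" using fundamental_domain_exists[OF \<Gamma>] by blast
  have cnt: "countable \<Gamma>" by (rule countable_subset[OF _ countable_int_matrix]) (use \<Gamma> in auto)
  have Fs: "F \<in> sets borel" "F \<subseteq> SO" using F by (auto simp: fundamental_domain_iff sets_\<mu>)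
  have "emeasure haar_ext F \<le> emeasure haar_ext S"
    by (rule packing_le_covering[OF cnt subgroup_SO_D(1)[OF \<Gamma>(1)] Fs(1) S(1)])
      (use covering Fs fundamental_domain_packing[OF F \<Gamma>(1)] in blast)+
  then show ?thesis using S(2) by (simp add: covolume_eq[OF F \<Gamma>(1) cnt])
qed

text \<open>Otherwise countably many null translates of a fundamental domain would cover the
  group.\<close>

lemma covolume_nonzero:
  assumes \<Gamma>: "subgroup \<Gamma> SO_d_1" "\<And>\<gamma>. \<gamma> \<in> \<Gamma> \<Longrightarrow> int_matrix \<gamma>"
  shows "covolume SO_d_1 \<mu> \<Gamma> \<noteq> 0"
proof
  assume 0: "covolume SO_d_1 \<mu> \<Gamma> = 0"
  obtain F where F: "fundamental_domain SO_d_1 \<mu> \<Gamma> F" using fundamental_domain_exists[OF \<Gamma>] by blast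
  have cnt: "countable \<Gamma>" by (rule countable_subset[OF _ countable_int_matrix]) (use \<Gamma> in auto)
  have Fs: "F \<in> sets borel" using F by (auto simp: fundamental_domain_iff sets_\<mu>)
  have G: "\<gamma> \<in> SO" if "\<gamma> \<in> \<Gamma>" for \<gamma> using subgroup_SO_D(1)[OF \<Gamma>(1)] that by auto
  have "emeasure haar_ext F = 0" using 0 by (simp add: covolume_eq[OF F \<Gamma>(1) cnt])
  then have "{x. x ** \<gamma> \<in> F} \<in> null_sets haar_ext" if "\<gamma> \<in> \<Gamma>" for \<gamma>
    using right_invariant[OF G[OF that] Fs] right_vimage_borel[OF Fs]
    by (auto simp: null_sets_def sets_haar_ext)
  then have n: "(\<Union>\<gamma>\<in>\<Gamma>. {x. x ** \<gamma> \<in> F}) \<in> null_sets haar_ext" by (intro null_sets_UN' cnt) auto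
  have "- SO \<in> null_sets haar_ext"
    using left_haar_ext by (auto simp: null_sets_def left_haar_def)
  with n have "(\<Union>\<gamma>\<in>\<Gamma>. {x. x ** \<gamma> \<in> F}) \<union> - SO \<in> null_sets haar_ext" by (rule null_sets.Un)
  moreover have "(\<Union>\<gamma>\<in>\<Gamma>. {x. x ** \<gamma> \<in> F}) \<union> - SO = UNIV"
    using fundamental_domain_covering[OF F \<Gamma>(1)] by auto
  ultimately show False using left_haar_ext by (auto simp: null_sets_def left_haar_def)
qed

text \<open>The right translates of a fundamental domain of \<open>\<Gamma>\<close> by the
  representatives in \<open>R\<close> are disjoint and together form a fundamental domain of
  \<open>\<Delta>\<close>.\<close>

lemma covolume_finite_index:
  assumes \<Gamma>: "subgroup \<Gamma> SO_d_1" "\<And>\<gamma>. \<gamma> \<in> \<Gamma> \<Longrightarrow> int_matrix \<gamma>"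
    and \<Delta>: "subgroup \<Delta> SO_d_1" "\<Delta> \<subseteq> \<Gamma>"
    and R: "finite R" "R \<subseteq> \<Gamma>" "\<And>\<gamma>. \<gamma> \<in> \<Gamma> \<Longrightarrow> \<exists>!r. r \<in> R \<and> \<gamma> ** r \<in> \<Delta>"
  shows "covolume SO_d_1 \<mu> \<Delta> = of_nat (card R) * covolume SO_d_1 \<mu> \<Gamma>"
proof -
  obtain F where F: "fundamental_domain SO_d_1 \<mu> \<Gamma> F" using fundamental_domain_exists[OF \<Gamma>] by blast
  have cnt: "countable \<Gamma>" by (rule countable_subset[OF _ countable_int_matrix]) (use \<Gamma> in auto)
  then have cnt': "countable \<Delta>" using \<Delta>(2) countable_subset by blast
  have Fs: "F \<in> sets borel" "F \<subseteq> SO" using F by (auto simp: fundamental_domain_iff sets_\<mu>)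
  have G: "\<gamma> \<in> SO" if "\<gamma> \<in> \<Gamma>" for \<gamma> using subgroup_SO_D(1)[OF \<Gamma>(1)] that by auto
  have RG: "r \<in> SO" if "r \<in> R" for r using G R that by auto
  define F' where "F' = (\<Union>r\<in>R. (\<lambda>x. x ** r) ` F)"
  have s: "(\<lambda>x. x ** r) ` F \<in> sets borel" if "r \<in> R" for r using right_translate(1)[OF RG[OF that] Fs(1)] .
  have F': "fundamental_domain SO_d_1 \<mu> \<Delta> F'"
    unfolding fundamental_domain_iff
  proof (intro conjI ballI)
    have "F' \<in> sets borel" unfolding F'_def using s R by auto
    moreover have "F' \<subseteq> SO" using Fs RG SO_mult by (auto simp: F'_def)
    ultimately show "F' \<in> sets \<mu>" by (simp add: sets_\<mu>)
    fix a :: "'d lmat" assume a: "a \<in> SO"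
    obtain \<gamma> where \<gamma>: "\<gamma> \<in> \<Gamma>" "a ** \<gamma> \<in> F" using fundamental_domain_covering[OF F \<Gamma>(1) a] by blast
    obtain r where r: "r \<in> R" "\<gamma> ** r \<in> \<Delta>" using R(3)[OF \<gamma>(1)] by blast
    show "\<exists>!x. x \<in> F' \<and> (\<exists>\<gamma>\<in>\<Delta>. x = a ** \<gamma>)"
    proof (rule ex1I[of _ "a ** \<gamma> ** r"])
      show "a ** \<gamma> ** r \<in> F' \<and> (\<exists>\<gamma>'\<in>\<Delta>. a ** \<gamma> ** r = a ** \<gamma>')"
      proof
        show "a ** \<gamma> ** r \<in> F'" using r \<gamma> by (auto simp: F'_def)
        show "\<exists>\<gamma>'\<in>\<Delta>. a ** \<gamma> ** r = a ** \<gamma>'" using r(2) by (metis matrix_mul_assoc)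
      qed
      fix x assume "x \<in> F' \<and> (\<exists>\<gamma>\<in>\<Delta>. x = a ** \<gamma>)"
      then obtain y q \<delta> where x: "y \<in> F" "q \<in> R" "x = y ** q" "\<delta> \<in> \<Delta>" "x = a ** \<delta>" by (auto simp: F'_def)
      have q: "q \<in> \<Gamma>" "q \<in> SO" using x R RG by auto
      have yq: "y ** lorentz_inv (\<delta> ** lorentz_inv q) = a"
      proof -
        have dG: "\<delta> \<in> SO" using x \<Delta> G by auto
        have "a = x ** lorentz_inv \<delta>" using x(5) SO_inv_mult_cancel(3)[OF dG] by simp
        then show ?thesis using x(3) by (simp add: lorentz_inv_mult lorentz_inv_involution matrix_mul_assoc)
      qed
      have mem: "lorentz_inv \<gamma> \<in> \<Gamma>" "lorentz_inv (\<delta> ** lorentz_inv q) \<in> \<Gamma>"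
        using subgroup_SO_D(3,4)[OF \<Gamma>(1)] \<gamma> q x(4) \<Delta>(2) by auto
      have "a ** \<gamma> ** lorentz_inv \<gamma> = y ** lorentz_inv (\<delta> ** lorentz_inv q)"
        using yq SO_inv_mult_cancel(3)[OF G[OF \<gamma>(1)]] by simp
      from fundamental_domain_packing[OF F \<Gamma>(1) \<gamma>(2) x(1) mem this]
      have "lorentz_inv \<gamma> = lorentz_inv (\<delta> ** lorentz_inv q)" and y: "y = a ** \<gamma>" by auto
      then have "\<gamma> = \<delta> ** lorentz_inv q" by (metis lorentz_inv_involution)
      then have "\<gamma> ** q = \<delta>" using SO_inv_mult_cancel(4)[OF q(2)] by simp
      then have "q = r" using R(3)[OF \<gamma>(1)] r x(2,4) by blast
      then show "x = a ** \<gamma> ** r" using x(3) y by simp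
    qed
  qed
  have disj: "disjoint_family_on (\<lambda>r. (\<lambda>x. x ** r) ` F) R"
    unfolding disjoint_family_on_def
    using fundamental_domain_packing[OF F \<Gamma>(1)] R(2) by blast
  have "emeasure haar_ext F' = (\<Sum>r\<in>R. emeasure haar_ext ((\<lambda>x. x ** r) ` F))"
    unfolding F'_def by (rule sum_emeasure[symmetric]) (use s disj R in \<open>auto simp: sets_haar_ext\<close>)
  also have "\<dots> = of_nat (card R) * emeasure haar_ext F"
    using right_translate(2)[OF RG Fs(1)] by simp
  finally show ?thesis by (simp add: covolume_eq[OF F' \<Delta>(1) cnt'] covolume_eq[OF F \<Gamma>(1) cnt])
qed

end

subsection \<open>Short vectors of integral lattices\<close>

definition int_vec :: "real ^ 'n \<Rightarrow> bool" where
  "int_vec x \<longleftrightarrow> (\<forall>i. x $ i \<in> \<int>)"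

lemma int_vec_simps [simp]: "int_vec 0" "int_vec x \<Longrightarrow> int_vec y \<Longrightarrow> int_vec (x + y)"
  "int_vec x \<Longrightarrow> int_vec y \<Longrightarrow> int_vec (x - y)" "int_vec x \<Longrightarrow> int_vec (- x)"
  by (simp_all add: int_vec_def)

lemma int_matrix_vec: "int_matrix A \<Longrightarrow> int_vec x \<Longrightarrow> int_vec (A *v x)"
  by (auto simp: int_matrix_def int_vec_def matrix_vector_mult_def)

lemma countable_int_vec: "countable {x :: real ^ 'n. int_vec x}"
proof -
  have "{x :: real ^ 'n. int_vec x} \<subseteq> range (\<lambda>f :: 'n \<Rightarrow> int. \<chi> i. of_int (f i))"
  proof
    fix x :: "real ^ 'n" assume "x \<in> {x. int_vec x}"
    then have "x = (\<chi> i. of_int \<lfloor>x $ i\<rfloor>)" by (auto simp: vec_eq_iff int_vec_def Ints_def)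
    then show "x \<in> range (\<lambda>f :: 'n \<Rightarrow> int. \<chi> i. of_int (f i))"
      by (rule image_eqI[where x="\<lambda>i. \<lfloor>x $ i\<rfloor>", OF _ UNIV_I])
  qed
  then show ?thesis by (rule countable_subset) simp
qed

text \<open>Reduction modulo integral vectors maps \<open>S\<close> injectively into the half-open
  unit cube. The computation is the unfolding of \<open>packing_le_covering\<close>, with integral
  translations and the cube as covering set.\<close>

lemma Blichfeldt:
  fixes S :: "(real ^ 'n) set"
  assumes S: "S \<in> sets borel" and inj: "\<And>x y. x \<in> S \<Longrightarrow> y \<in> S \<Longrightarrow> int_vec (x - y) \<Longrightarrow> x = y"
  shows "emeasure lborel S \<le> 1"
proof -
  define Z where "Z = {k :: real ^ 'n. int_vec k}"
  define Q where "Q = {x :: real ^ 'n. \<forall>i. 0 \<le> x $ i \<and> x $ i < 1}"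
  have Z: "countable Z" unfolding Z_def by (rule countable_int_vec)
  have [measurable]: "(\<lambda>x :: real ^ 'n. x $ i) \<in> borel_measurable borel" for i
    by (intro borel_measurable_continuous_onI continuous_intros)
  have Q: "Q \<in> sets borel"
  proof -
    have "{x :: real ^ 'n. \<forall>i\<in>UNIV. 0 \<le> x $ i \<and> x $ i < 1} \<in> sets borel" by measurable
    then show ?thesis by (simp add: Q_def)
  qed
  have Q1: "emeasure lborel Q \<le> 1"
  proof -
    have "Q \<subseteq> cbox 0 1" by (auto simp: Q_def mem_box_cart less_imp_le)
    then have "emeasure lborel Q \<le> emeasure lborel (cbox 0 1 :: (real ^ 'n) set)" by (intro emeasure_mono) auto
    also have "\<dots> = 1"
    proof (subst emeasure_lborel_cbox)
      have "1 \<bullet> b = (1::real)" if "b \<in> Basis" for b :: "real ^ 'n"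
        using that by (auto simp: Basis_vec_def inner_axis)
      then show "ennreal (\<Prod>b\<in>Basis. (1 - 0 :: real ^ 'n) \<bullet> b) = 1" "\<And>b. b \<in> Basis \<Longrightarrow> (0 :: real ^ 'n) \<bullet> b \<le> 1 \<bullet> b"
        by simp_all
    qed
    finally show ?thesis .
  qed
  note [measurable] = S Q
  have "emeasure lborel S = (\<integral>\<^sup>+ x. indicator S x \<partial>lborel)" using S by simp
  also have "\<dots> \<le> (\<integral>\<^sup>+ x. (\<integral>\<^sup>+ k. indicator S x * indicator Q (- k + x) \<partial>count_space Z) \<partial>lborel)"
  proof (rule nn_integral_mono)
    fix x :: "real ^ 'n"
    define k where "k = (\<chi> i. real_of_int \<lfloor>x $ i\<rfloor>)"
    have k: "k \<in> Z" by (simp add: Z_def int_vec_def k_def)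
    have "0 \<le> x $ i - of_int \<lfloor>x $ i\<rfloor> \<and> x $ i - of_int \<lfloor>x $ i\<rfloor> < 1" for i by linarith
    then have "- k + x \<in> Q" by (simp add: Q_def k_def)
    then have "indicator S x = (indicator S x * indicator Q (- k + x) :: ennreal)" by simp
    also have "\<dots> \<le> (\<integral>\<^sup>+ k. indicator S x * indicator Q (- k + x) \<partial>count_space Z)"
      using k by (rule nn_integral_ge_point)
    finally show "indicator S x \<le> (\<integral>\<^sup>+ k. indicator S x * indicator Q (- k + x) \<partial>count_space Z)" .
  qed
  also have "\<dots> = (\<integral>\<^sup>+ k. (\<integral>\<^sup>+ x. indicator S x * indicator Q (- k + x) \<partial>lborel) \<partial>count_space Z)"
    by (rule nn_integral_count_space_nn_integral[OF Z]) measurable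
  also have "\<dots> = (\<integral>\<^sup>+ k. (\<integral>\<^sup>+ x. indicator S (k + x) * indicator Q x \<partial>lborel) \<partial>count_space Z)"
  proof (rule nn_integral_cong)
    fix k :: "real ^ 'n"
    have "(\<integral>\<^sup>+ x. indicator S x * indicator Q (- k + x) \<partial>lborel)
      = (\<integral>\<^sup>+ x. indicator S x * indicator Q (- k + x) \<partial>(distr lborel borel ((+) k)))"
      by (simp only: lborel_distr_plus)
    also have "\<dots> = (\<integral>\<^sup>+ x. indicator S (k + x) * indicator Q (- k + (k + x)) \<partial>lborel)"
      by (rule nn_integral_distr) measurable
    finally show "(\<integral>\<^sup>+ x. indicator S x * indicator Q (- k + x) \<partial>lborel)
      = (\<integral>\<^sup>+ x. indicator S (k + x) * indicator Q x \<partial>lborel)" by simp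
  qed
  also have "\<dots> = (\<integral>\<^sup>+ x. (\<integral>\<^sup>+ k. indicator S (k + x) * indicator Q x \<partial>count_space Z) \<partial>lborel)"
    by (rule nn_integral_count_space_nn_integral[OF Z, symmetric]) measurable
  also have "\<dots> \<le> (\<integral>\<^sup>+ x. indicator Q x \<partial>lborel)"
  proof (rule nn_integral_mono)
    fix x :: "real ^ 'n"
    show "(\<integral>\<^sup>+ k. indicator S (k + x) * indicator Q x \<partial>count_space Z) \<le> indicator Q x"
    proof (cases "\<exists>k\<in>Z. k + x \<in> S")
      case True
      then obtain k where k: "k \<in> Z" "k + x \<in> S" by blast
      have "l = k" if "l \<in> Z" "l + x \<in> S" for l
        using inj[OF that(2) k(2)] that(1) k(1) by (simp add: Z_def)
      then have "(\<integral>\<^sup>+ k. indicator S (k + x) * indicator Q x \<partial>count_space Z)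
          \<le> (\<integral>\<^sup>+ l. indicator {k} l * indicator Q x \<partial>count_space Z)"
        by (intro nn_integral_mono) (auto simp: indicator_def)
      also have "\<dots> = indicator Q x" using k(1) by (subst nn_integral_multc) auto
      finally show ?thesis .
    next
      case False
      then have "(\<integral>\<^sup>+ k. indicator S (k + x) * indicator Q x \<partial>count_space Z) = (\<integral>\<^sup>+ k. 0 \<partial>count_space Z)"
        by (intro nn_integral_cong) auto
      then show ?thesis by simp
    qed
  qed
  also have "\<dots> = emeasure lborel Q" using Q by simp
  finally show ?thesis using Q1 by simp
qed

text \<open>The preimage under \<open>g\<close> of a centred box with sides \<open>b i\<close> has
  volume above one, hence contains two points that differ by an integral vector; \<open>y\<close> is
  their difference.\<close>

lemma (in lorentz_frame) Minkowski_box: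
  fixes g :: "'d lmat"
  assumes g: "g \<in> SO" and b: "\<And>i. b i > 0" "(\<Prod>i\<in>UNIV. b i) > 1"
  obtains y where "int_vec y" "y \<noteq> 0" "\<And>i. \<bar>(g *v y) $ i\<bar> \<le> b i"
proof -
  define B where "B = box (\<chi> i. - b i / 2) (\<chi> i. b i / 2)"
  define S where "S = {x. g *v x \<in> B}"
  have "emeasure lborel B = ennreal (\<Prod>i\<in>UNIV. b i)"
  proof -
    have inj: "inj (\<lambda>i :: 'd option. axis i (1::real))" by (auto simp: inj_def axis_eq_axis)
    have Bas: "(Basis :: 'd lvec set) = range (\<lambda>i. axis i 1)"
      by (auto simp: Basis_vec_def)
    have "emeasure lborel B = ennreal (\<Prod>e\<in>Basis. ((\<chi> i. b i / 2) - (\<chi> i. - b i / 2)) \<bullet> e)"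
      unfolding B_def using less_imp_le[OF b(1)] by (intro emeasure_lborel_box) (auto simp: Bas inner_axis intro: order_trans[of _ 0])
    also have "(\<Prod>e\<in>Basis. ((\<chi> i. b i / 2) - (\<chi> i. - b i / 2)) \<bullet> e) = (\<Prod>i\<in>UNIV. b i)"
      unfolding Bas by (subst prod.reindex[OF inj]) (simp add: inner_axis)
    finally show ?thesis .
  qed
  moreover have "emeasure lborel S = emeasure lborel B"
    unfolding S_def by (rule lborel_SO_invariant[OF g]) (simp add: B_def)
  ultimately have "\<not> emeasure lborel S \<le> 1"
    using b(2) by (simp add: ennreal_le_1)
  moreover have "S \<in> sets borel"
  proof -
    have "(*v) g \<in> borel_measurable borel"
      by (intro borel_measurable_continuous_onI linear_continuous_on) (simp add: linear_linear)
    from measurable_sets[OF this, of B] show ?thesis by (simp add: S_def vimage_def B_def)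
  qed
  ultimately obtain x y where xy: "x \<in> S" "y \<in> S" "int_vec (x - y)" "x \<noteq> y" using Blichfeldt by blast
  have "\<bar>(g *v (x - y)) $ i\<bar> \<le> b i" for i
  proof -
    have "\<bar>(g *v x) $ i\<bar> < b i / 2" "\<bar>(g *v y) $ i\<bar> < b i / 2"
      using xy by (auto simp: S_def B_def mem_box_cart abs_less_iff minus_less_iff dest!: spec[of _ i])
    then show ?thesis by (simp add: matrix_vector_mult_diff_distrib)
  qed
  then show thesis using that[of "x - y"] xy by simp
qed

text \<open>Suppose the short vectors are orthogonal to \<open>u\<close>. A box that is long in the
  direction of the largest coordinate of \<open>u\<close> and thin in the others yields a nonzero
  lattice vector orthogonal to \<open>u\<close>. Its long coordinate is then bounded by the sum of
  the thin ones, which makes it shorter than \<open>c\<close>.\<close>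

lemma (in lorentz_frame) short_vectors_span:
  assumes c: "c > 0"
  obtains C where "C > 0" "\<And>g :: 'd lmat. g \<in> SO \<Longrightarrow> (\<And>y. int_vec y \<Longrightarrow> y \<noteq> 0 \<Longrightarrow> c \<le> norm (g *v y)) \<Longrightarrow>
     span {g *v y | y. int_vec y \<and> norm (g *v y) \<le> C} = UNIV"
proof -
  define n where "n = CARD('d option)"
  have n: "n > 0" by (simp add: n_def)
  \<comment> \<open>The thin coordinates add up to at most \<open>c / 4\<close>, and so the long one
    is at most \<open>c / 4\<close>: the norm is at most \<open>c / 2\<close>. The value of
    \<open>T\<close> gives the box volume 2.\<close>
  define c' where "c' = c / (4 * real n)"
  have c': "c' > 0" "real n * c' = c / 4" using c n by (simp_all add: c'_def)
  define T where "T = 2 / c' ^ (n - 1)"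
  have T: "T > 0" using c' by (simp add: T_def)
  show thesis
  proof (rule that)
    show "T + c / 4 > 0" using T c by simp
    fix g :: "'d lmat"
    assume g: "g \<in> SO" and min: "\<And>y. int_vec y \<Longrightarrow> y \<noteq> 0 \<Longrightarrow> c \<le> norm (g *v y)"
    let ?V = "{g *v y | y. int_vec y \<and> norm (g *v y) \<le> T + c / 4}"
    show "span ?V = UNIV"
    proof (rule ccontr)
      assume "span ?V \<noteq> UNIV"
      then obtain u where u: "u \<noteq> 0" "\<And>x. x \<in> span ?V \<Longrightarrow> u \<bullet> x = 0"
        using span_not_UNIV_orthogonal[of ?V] by auto
      have "\<exists>i0. \<forall>i. \<bar>u $ i\<bar> \<le> \<bar>u $ i0\<bar>"
      proof -
        have fin: "finite (range (\<lambda>i. \<bar>u $ i\<bar>))" by simp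
        have "Max (range (\<lambda>i. \<bar>u $ i\<bar>)) \<in> range (\<lambda>i. \<bar>u $ i\<bar>)" by (rule Max_in[OF fin]) simp
        then obtain i0 where "Max (range (\<lambda>i. \<bar>u $ i\<bar>)) = \<bar>u $ i0\<bar>" by (rule rangeE)
        then show ?thesis using Max_ge[OF fin] by (metis rangeI)
      qed
      then obtain i0 where i0: "\<And>i. \<bar>u $ i\<bar> \<le> \<bar>u $ i0\<bar>" by blast
      have ui0: "\<bar>u $ i0\<bar> > 0"
      proof (rule ccontr)
        assume "\<not> ?thesis"
        then have "u $ i = 0" for i using i0[of i] by simp
        then show False using u(1) by (simp add: vec_eq_iff)
      qed
      define b where "b i = (if i = i0 then T else c')" for i
      have b: "b i > 0" for i using T c' by (simp add: b_def)
      have "(\<Prod>i\<in>UNIV. b i) = T * (\<Prod>i\<in>UNIV - {i0}. c')"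
        by (subst prod.remove[of _ i0]) (auto simp: b_def)
      also have "\<dots> = 2" using c' by (simp add: T_def n_def card_Diff_singleton)
      finally have "(\<Prod>i\<in>UNIV. b i) > 1" by simp
      then obtain y where y: "int_vec y" "y \<noteq> 0" "\<And>i. \<bar>(g *v y) $ i\<bar> \<le> b i" using Minkowski_box[OF g, of b] b by blast
      define x where "x = g *v y"
      have small: "(\<Sum>i\<in>UNIV - {i0}. \<bar>x $ i\<bar>) \<le> c / 4"
      proof -
        have "(\<Sum>i\<in>UNIV - {i0}. \<bar>x $ i\<bar>) \<le> (\<Sum>i\<in>UNIV - {i0}. c')"
        proof (rule sum_mono)
          show "\<bar>x $ i\<bar> \<le> c'" if "i \<in> UNIV - {i0}" for i
            using y(3)[of i] that by (simp add: b_def x_def)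
        qed
        also have "\<dots> \<le> real n * c'" using c' by (simp add: n_def card_Diff_singleton)
        finally show ?thesis using c' by simp
      qed
      have "norm x \<le> (\<Sum>i\<in>UNIV. \<bar>x $ i\<bar>)" by (rule norm_le_l1_cart)
      also have "\<dots> = \<bar>x $ i0\<bar> + (\<Sum>i\<in>UNIV - {i0}. \<bar>x $ i\<bar>)" by (subst sum.remove[of _ i0]) auto
      finally have nx: "norm x \<le> \<bar>x $ i0\<bar> + c / 4" using small by simp
      then have "norm x \<le> T + c / 4" using y(3)[of i0] by (simp add: b_def x_def)
      then have "u \<bullet> x = 0" using y(1) by (intro u(2) span_base) (auto simp: x_def)
      then have "u $ i0 * x $ i0 = - (\<Sum>i\<in>UNIV - {i0}. u $ i * x $ i)"
        by (simp add: inner_vec_def sum.remove[of UNIV i0])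
      then have "\<bar>u $ i0\<bar> * \<bar>x $ i0\<bar> \<le> (\<Sum>i\<in>UNIV - {i0}. \<bar>u $ i * x $ i\<bar>)"
        using sum_abs[of "\<lambda>i. u $ i * x $ i" "UNIV - {i0}"] by (simp add: abs_mult flip: abs_mult[of "u $ i0"])
      also have "\<dots> \<le> (\<Sum>i\<in>UNIV - {i0}. \<bar>u $ i0\<bar> * \<bar>x $ i\<bar>)"
        using i0 by (intro sum_mono) (simp add: abs_mult mult_right_mono)
      also have "\<dots> = \<bar>u $ i0\<bar> * (\<Sum>i\<in>UNIV - {i0}. \<bar>x $ i\<bar>)" by (simp add: sum_distrib_left)
      also have "\<dots> \<le> \<bar>u $ i0\<bar> * (c / 4)" using small by (intro mult_left_mono) auto
      finally have "\<bar>x $ i0\<bar> \<le> c / 4" using ui0 by simp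
      then show False using nx min[OF y(1,2)] c by (simp add: x_def)
    qed
  qed
qed

lemma lip_bound: "\<bar>lip x y\<bar> \<le> norm x * norm y"
proof -
  have "(norm (lorentz_form *v y))\<^sup>2 = (norm y)\<^sup>2"
    by (simp only: power2_norm_eq_inner) (simp add: inner_vec_def UNIV_option_sum lorentz_form_mult_nth)
  then have "norm (lorentz_form *v y) = norm y" by (simp add: power2_eq_iff_nonneg)
  then show ?thesis using Cauchy_Schwarz_ineq2[of x "lorentz_form *v y"] by (simp add: lip_def)
qed

subsection \<open>Integral matrices\<close>

lemma int_matrix_det: "int_matrix (A :: real ^ 'n ^ 'n) \<Longrightarrow> det A \<in> \<int>"
  by (auto simp: det_def int_matrix_def intro!: Ints_sum Ints_mult Ints_prod)

lemma finite_int_matrix_bounded: "finite {A :: real ^ 'n ^ 'm. int_matrix A \<and> (\<forall>i j. \<bar>A $ i $ j\<bar> \<le> B)}"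
proof -
  have "finite {f :: 'm \<times> 'n \<Rightarrow> real. \<forall>x. (x \<in> UNIV \<longrightarrow> f x \<in> {k \<in> \<int>. \<bar>k\<bar> \<le> B}) \<and> (x \<notin> UNIV \<longrightarrow> f x = 0)}"
    by (rule finite_set_of_finite_funs) (auto intro: finite_abs_int_segment)
  then have "finite ((\<lambda>f. \<chi> i j. f (i, j)) ` {f :: 'm \<times> 'n \<Rightarrow> real. \<forall>x. f x \<in> \<int> \<and> \<bar>f x\<bar> \<le> B})"
    by simp
  moreover have "{A :: real ^ 'n ^ 'm. int_matrix A \<and> (\<forall>i j. \<bar>A $ i $ j\<bar> \<le> B)}
      \<subseteq> (\<lambda>f. \<chi> i j. f (i, j)) ` {f :: 'm \<times> 'n \<Rightarrow> real. \<forall>x. f x \<in> \<int> \<and> \<bar>f x\<bar> \<le> B}"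
  proof
    fix A :: "real ^ 'n ^ 'm" assume "A \<in> {A. int_matrix A \<and> (\<forall>i j. \<bar>A $ i $ j\<bar> \<le> B)}"
    then show "A \<in> (\<lambda>f. \<chi> i j. f (i, j)) ` {f :: 'm \<times> 'n \<Rightarrow> real. \<forall>x. f x \<in> \<int> \<and> \<bar>f x\<bar> \<le> B}"
      by (intro image_eqI[of _ _ "\<lambda>(i, j). A $ i $ j"]) (auto simp: int_matrix_def vec_eq_iff)
  qed
  ultimately show ?thesis by (rule rev_finite_subset)
qed

lemma matrix_inv_works:
  fixes A :: "real ^ 'n ^ 'n"
  assumes "det A \<noteq> 0" shows "A ** matrix_inv A = mat 1" "matrix_inv A ** A = mat 1"
proof -
  have "\<exists>B. A ** B = mat 1 \<and> B ** A = mat 1"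
    using assms invertible_det_nz[of A] by (auto simp: invertible_def)
  then have "A ** matrix_inv A = mat 1 \<and> matrix_inv A ** A = mat 1"
    unfolding matrix_inv_def by (rule someI_ex)
  then show "A ** matrix_inv A = mat 1" "matrix_inv A ** A = mat 1" by auto
qed

lemma int_matrix_adjugate:
  fixes A :: "real ^ 'n ^ 'n"
  assumes A: "int_matrix A" "det A \<noteq> 0" shows "det A * matrix_inv A $ i $ j \<in> \<int>"
proof -
  have "A *v (matrix_inv A *v axis j 1) = axis j 1"
    by (simp add: matrix_vector_mul_assoc matrix_inv_works[OF A(2)])
  then have "matrix_inv A *v axis j 1 = (\<chi> k. det (\<chi> i j'. if j' = k then axis j 1 $ i else A $ i $ j') / det A)"
    by (simp only: cramer[OF A(2)])
  then have "matrix_inv A $ i $ j = det (\<chi> i' j'. if j' = i then axis j 1 $ i' else A $ i' $ j') / det A"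
    using matrix_axis_nth[of "matrix_inv A" j i] by simp
  then have "det A * matrix_inv A $ i $ j = det (\<chi> i' j'. if j' = i then axis j 1 $ i' else A $ i' $ j')"
    using A(2) by simp
  also have "\<dots> \<in> \<int>" using A(1) by (intro int_matrix_det) (auto simp: int_matrix_def axis_def)
  finally show ?thesis .
qed

text \<open>Write \<open>B\<close> as \<open>A\<close> plus \<open>det A\<close> times an integral
  matrix \<open>E\<close>: the quotient is the identity plus \<open>E\<close> times the adjugate of
  \<open>A\<close>.\<close>

lemma int_matrix_quotient:
  fixes A B :: "real ^ 'n ^ 'n"
  assumes A: "int_matrix A" "det A \<noteq> 0"
    and cong: "\<And>i j. \<exists>k\<in>\<int>. B $ i $ j = A $ i $ j + det A * k"
  shows "int_matrix (B ** matrix_inv A)"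
proof -
  define E where "E = (\<chi> i j. SOME k. k \<in> \<int> \<and> B $ i $ j = A $ i $ j + det A * k)"
  have E: "E $ i $ j \<in> \<int>" "B $ i $ j = A $ i $ j + det A * E $ i $ j" for i j
    using someI_ex[OF cong[of i j, unfolded Bex_def]] by (simp_all add: E_def)
  have "(B ** matrix_inv A) $ i $ j = (A ** matrix_inv A) $ i $ j + (E ** (det A *\<^sub>R matrix_inv A)) $ i $ j" for i j
    by (simp add: matrix_matrix_mult_def E(2) algebra_simps sum.distrib)
  then have "B ** matrix_inv A = mat 1 + E ** (det A *\<^sub>R matrix_inv A)"
    by (simp add: vec_eq_iff matrix_inv_works[OF A(2)])
  moreover have "int_matrix (det A *\<^sub>R matrix_inv A)"
    using int_matrix_adjugate[OF A] by (simp add: int_matrix_def)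
  moreover have "int_matrix E" by (simp add: int_matrix_def E)
  ultimately have "int_matrix (E ** (det A *\<^sub>R matrix_inv A))" by (intro int_matrix_mult)
  then show ?thesis
    using int_matrix_one unfolding \<open>B ** matrix_inv A = _\<close> by (simp add: int_matrix_def)
qed

text \<open>
  An integral basis change \<open>h\<close> taking
  the lattice to bounded vectors has one of finitely many Gram matrices, and two such matrices with
  the same Gram matrix and determinant, congruent modulo the determinant, differ by an integral isometry.
\<close>

theorem (in lorentz_frame) Mahler_criterion:
  assumes c: "c > 0"
  obtains L where "\<And>g :: 'd lmat. g \<in> SO \<Longrightarrow>
      (\<And>y. int_vec y \<Longrightarrow> y \<noteq> 0 \<Longrightarrow> c \<le> norm (g *v y)) \<Longrightarrow>
      \<exists>\<gamma>\<in>SO. int_matrix \<gamma> \<and> norm (g ** \<gamma>) \<le> L"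
proof -
  let ?G = "SO :: 'd lmat set"
  obtain C where C: "C > 0" "\<And>g :: 'd lmat. g \<in> SO \<Longrightarrow>
      (\<And>y. int_vec y \<Longrightarrow> y \<noteq> 0 \<Longrightarrow> c \<le> norm (g *v y)) \<Longrightarrow>
     span {g *v y | y. int_vec y \<and> norm (g *v y) \<le> C} = UNIV" using short_vectors_span[OF c] by blast
  define Bd where "Bd = {X :: 'd lmat. \<forall>j. norm (X *v axis j 1) \<le> C}"
  define P where "P = {h :: 'd lmat. int_matrix h \<and> det h \<noteq> 0 \<and> (\<exists>g\<in>?G. g ** h \<in> Bd)}"
  have red: "\<exists>h\<in>P. g ** h \<in> Bd" if g: "g \<in> ?G" "\<And>y. int_vec y \<Longrightarrow> y \<noteq> 0 \<Longrightarrow> c \<le> norm (g *v y)" for g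
  proof -
    let ?S = "{g *v y | y. int_vec y \<and> norm (g *v y) \<le> C}"
    obtain B where B: "B \<subseteq> ?S" "independent B" "?S \<subseteq> span B" by (rule maximal_independent_subset)
    have "span B = UNIV" using C(2)[OF g] B(3) span_minimal[OF B(3) subspace_span] by auto
    then have cB: "card B = CARD('d option)" "finite B"
      using basis_card_eq_dim[of B UNIV] B(2) by (auto simp: dim_UNIV independent_imp_finite)
    then obtain f where f: "bij_betw f (UNIV :: 'd option set) B"
      using finite_same_card_bij[of "UNIV :: 'd option set" B] by auto
    have "\<exists>y. int_vec y \<and> norm (g *v y) \<le> C \<and> f j = g *v y" for j
      using f B(1) by (auto simp: bij_betw_def)
    then obtain y where y: "\<And>j. int_vec (y j)" "\<And>j. norm (g *v y j) \<le> C" "\<And>j. f j = g *v y j" by metis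
    define h where "h = (\<chi> i j. y j $ i)"
    have hcol: "h *v axis j 1 = y j" for j by (simp add: vec_eq_iff matrix_axis_nth h_def)
    have h: "int_matrix h" using y(1) by (simp add: int_matrix_def int_vec_def h_def)
    have gh: "(g ** h) *v axis j 1 = f j" for j by (simp add: matrix_vector_mul_assoc[symmetric] hcol y(3))
    have "columns (g ** h) = B"
      using f gh by (auto simp: columns_def bij_betw_def matrix_vector_mult_basis[symmetric])
    then have "\<exists>X. (g ** h) ** X = mat 1"
      using \<open>span B = UNIV\<close> matrix_right_invertible_span_columns[of "g ** h"] by (simp add: span_vec_eq)
    then obtain X where "(g ** h) ** X = mat 1" by blast
    then have "det (g ** h) * det X = 1" by (metis det_I det_mul)
    then have "det h \<noteq> 0" by (auto simp: det_mul)
    moreover have "g ** h \<in> Bd" using y(2,3) by (simp add: Bd_def gh)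
    ultimately show ?thesis using h g(1) by (auto simp: P_def)
  qed
  have bdBd: "bounded Bd"
  proof -
    have "norm X \<le> real CARD('d option) * (real CARD('d option) * C)" if "X \<in> Bd" for X
    proof (rule norm_matrix_le)
      fix i j show "\<bar>X $ i $ j\<bar> \<le> C"
        using that component_le_norm_cart[of "X *v axis j 1" i] by (simp add: Bd_def matrix_axis_nth) (meson order_trans)
    qed
    then show ?thesis by (auto simp: bounded_iff)
  qed
  obtain DB where DB: "\<And>X. X \<in> Bd \<Longrightarrow> \<bar>det X\<bar> \<le> DB"
  proof -
    have "continuous_on UNIV (det :: 'd lmat \<Rightarrow> real)"
      unfolding det_def by (intro continuous_intros)
    then have "compact (det ` closure Bd)"
      using bdBd by (intro compact_continuous_image) (auto intro: continuous_on_subset)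
    then have "bounded (det ` Bd)" by (meson bounded_subset closure_subset compact_imp_bounded image_mono)
    then show thesis using that by (auto simp: bounded_iff)
  qed
  \<comment> \<open>Gram matrix, determinant, and entries reduced modulo the determinant. The Gram
    matrix is bounded because \<open>g\<close> preserves it and brings the columns of
    \<open>h\<close> into a bounded set; the residues are bounded by the determinant.\<close>
  define key where "key h = (transpose h ** lorentz_form ** h, det h,
     (\<chi> i j. h $ i $ j - det h * of_int \<lfloor>h $ i $ j / det h\<rfloor>))" for h :: "'d lmat"
  have "finite (key ` P)"
  proof -
    let ?M = "\<lambda>b. {A :: 'd lmat. int_matrix A \<and> (\<forall>i j. \<bar>A $ i $ j\<bar> \<le> b)}"
    have "key ` P \<subseteq> ?M (C * C) \<times> {k \<in> \<int>. \<bar>k\<bar> \<le> DB} \<times> ?M DB"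
    proof
      fix q assume "q \<in> key ` P"
      then obtain h g where h: "q = key h" "int_matrix h" "det h \<noteq> 0" "g \<in> ?G" "g ** h \<in> Bd" by (auto simp: P_def)
      have detg: "det g = 1" using h(4) by (simp add: SO_carrier)
      have d: "\<bar>det h\<bar> \<le> DB" "det h \<in> \<int>" using DB[OF h(5)] detg int_matrix_det[OF h(2)] by (simp_all add: det_mul)
      let ?S = "transpose h ** lorentz_form ** h"
      have S_nth: "?S $ i $ j = lip (h *v axis i 1) (h *v axis j 1)" for i j
        unfolding lip_mult_matrix by (simp add: inner_axis' matrix_axis_nth)
      have "\<bar>?S $ i $ j\<bar> \<le> C * C" for i j
      proof -
        have "?S $ i $ j = lip ((g ** h) *v axis i 1) ((g ** h) *v axis j 1)"
          unfolding S_nth by (simp add: matrix_vector_mul_assoc[symmetric] lip_SO[OF h(4)])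
        also have "\<bar>\<dots>\<bar> \<le> norm ((g ** h) *v axis i 1) * norm ((g ** h) *v axis j 1)" by (rule lip_bound)
        also have "\<dots> \<le> C * C" using h(5) C(1) by (intro mult_mono) (auto simp: Bd_def)
        finally show ?thesis .
      qed
      moreover have "int_matrix ?S"
      proof -
        have "int_vec (h *v axis i 1)" for i
          using h(2) by (simp add: int_vec_def int_matrix_def matrix_axis_nth)
        then show ?thesis unfolding int_matrix_def S_nth lip_expand
          by (auto simp: int_vec_def intro!: Ints_sum Ints_mult Ints_diff)
      qed
      moreover have "int_matrix (\<chi> i j. h $ i $ j - det h * of_int \<lfloor>h $ i $ j / det h\<rfloor>)"
        using h(2) d(2) by (auto simp: int_matrix_def)
      moreover have "\<bar>h $ i $ j - det h * of_int \<lfloor>h $ i $ j / det h\<rfloor>\<bar> \<le> DB" for i j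
      proof -
        have "h $ i $ j - det h * of_int \<lfloor>h $ i $ j / det h\<rfloor> = det h * frac (h $ i $ j / det h)"
          using h(3) by (simp add: frac_def algebra_simps)
        also have "\<bar>\<dots>\<bar> \<le> \<bar>det h\<bar> * 1"
          unfolding abs_mult using frac_lt_1[of "h $ i $ j / det h"] by (intro mult_left_mono) (auto simp: frac_ge_0)
        finally show ?thesis using d(1) by simp
      qed
      ultimately show "q \<in> ?M (C * C) \<times> {k \<in> \<int>. \<bar>k\<bar> \<le> DB} \<times> ?M DB"
        using d by (simp add: h(1) key_def)
    qed
    then show ?thesis
      by (rule finite_subset) (intro finite_cartesian_product finite_int_matrix_bounded finite_abs_int_segment)
  qed
  then obtain R where R: "R \<subseteq> P" "finite R" "key ` P = key ` R" using finite_subset_image[of "key ` P" key P] by blast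
  have "bounded (\<Union>r\<in>R. (\<lambda>X. X ** matrix_inv r) ` Bd)"
  proof (intro bounded_UN ballI R(2))
    fix r assume "r \<in> R"
    have "compact ((\<lambda>X. X ** matrix_inv r) ` closure Bd)"
      using bdBd by (intro compact_continuous_image continuous_intros) simp
    then show "bounded ((\<lambda>X. X ** matrix_inv r) ` Bd)"
      by (meson bounded_subset closure_subset compact_imp_bounded image_mono)
  qed
  then obtain L where L: "\<And>X r. X \<in> Bd \<Longrightarrow> r \<in> R \<Longrightarrow> norm (X ** matrix_inv r) \<le> L"
    by (auto simp: bounded_iff)
  show thesis
  proof (rule that)
    fix g assume g: "g \<in> ?G" "\<And>y. int_vec y \<Longrightarrow> y \<noteq> 0 \<Longrightarrow> c \<le> norm (g *v y)"
    obtain h where h: "h \<in> P" "g ** h \<in> Bd" using red[OF g] by blast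
    obtain r where r: "r \<in> R" "key h = key r" using R(3) h(1) by (metis imageE imageI)
    have S: "transpose h ** lorentz_form ** h = transpose r ** lorentz_form ** r" and d: "det h = det r"
      and q: "\<And>i j. h $ i $ j - det h * of_int \<lfloor>h $ i $ j / det h\<rfloor> = r $ i $ j - det r * of_int \<lfloor>r $ i $ j / det r\<rfloor>"
      using r(2) by (auto simp: key_def vec_eq_iff)
    have rP: "int_matrix r" "det r \<noteq> 0" using r(1) R(1) by (auto simp: P_def)
    note inv = matrix_inv_works[OF rP(2)]
    \<comment> \<open>Then \<open>g ** ?\<gamma>\<close> is the bounded matrix \<open>g ** h\<close>
      times the inverse of one of finitely many \<open>r\<close>.\<close>
    let ?\<gamma> = "h ** matrix_inv r"
    have "int_matrix ?\<gamma>"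
    proof (rule int_matrix_quotient[OF rP])
      fix i j
      show "\<exists>k\<in>\<int>. h $ i $ j = r $ i $ j + det r * k"
        using q[of i j] d by (intro bexI[of _ "of_int \<lfloor>h $ i $ j / det h\<rfloor> - of_int \<lfloor>r $ i $ j / det r\<rfloor>"])
          (auto simp: algebra_simps)
    qed
    moreover have "?\<gamma> \<in> ?G"
    proof -
      have "transpose ?\<gamma> ** lorentz_form ** ?\<gamma> = transpose (matrix_inv r) ** (transpose h ** lorentz_form ** h) ** matrix_inv r"
        by (simp add: matrix_transpose_mul matrix_mul_assoc)
      also have "\<dots> = (transpose (matrix_inv r) ** transpose r) ** lorentz_form ** (r ** matrix_inv r)"
        by (simp only: S matrix_mul_assoc)
      also have "transpose (matrix_inv r) ** transpose r = mat 1"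
        by (simp only: matrix_transpose_mul[symmetric] inv transpose_mat)
      finally have 1: "transpose ?\<gamma> ** lorentz_form ** ?\<gamma> = lorentz_form" by (simp add: inv)
      have "det r * det (matrix_inv r) = 1" using inv(1) by (metis det_I det_mul)
      then show ?thesis using 1 d by (simp add: SO_carrier det_mul)
    qed
    moreover have "norm (g ** ?\<gamma>) \<le> L" using L[OF h(2) r(1)] by (simp add: matrix_mul_assoc)
    ultimately show "\<exists>\<gamma>\<in>?G. int_matrix \<gamma> \<and> norm (g ** \<gamma>) \<le> L" by blast
  qed
qed

subsection \<open>Reduction theory\<close>

text \<open>Subtracting from \<open>y\<close> the multiple of \<open>x\<close> with the same time
  coordinate leaves a null vector without time coordinate, hence zero.\<close>

lemma null_orthogonal_parallel:
  assumes "lip x x = 0" "lip y y = 0" "lip x y = 0" "x $ None \<noteq> 0"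
  shows "y = (y $ None / x $ None) *\<^sub>R x"
proof -
  let ?z = "y - (y $ None / x $ None) *\<^sub>R x"
  have "lip ?z ?z = 0" using assms lip_sym[of y x] by (simp add: lip_simps)
  then have "?z = 0" by (rule null_vector_nz) (use assms in simp)
  then show ?thesis by simp
qed

lemma int_vec_lip: "int_vec x \<Longrightarrow> int_vec y \<Longrightarrow> lip x y \<in> \<int>"
  unfolding lip_expand by (auto simp: int_vec_def intro!: Ints_sum Ints_mult Ints_diff)

text \<open>The time coordinate of a nonzero null vector does not vanish. Among the nonzero
  multiples of \<open>y\<close> that are integral vectors, one with time coordinate of least
  absolute value is primitive.\<close>

lemma primitive_null_vector:
  fixes y :: "('d::finite) lvec"
  assumes y: "int_vec y" "y \<noteq> 0" "lip y y = 0"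
  obtains t where "\<bar>t\<bar> \<le> 1" "t \<noteq> 0" "int_vec (t *\<^sub>R y)"
    "\<And>s. s \<noteq> 0 \<Longrightarrow> int_vec (s *\<^sub>R t *\<^sub>R y) \<Longrightarrow> \<bar>s\<bar> \<ge> 1"
proof -
  have y0: "y $ None \<noteq> 0" using null_vector_nz y by blast
  define A where "A n \<longleftrightarrow> n > 0 \<and> (\<exists>t. int_vec (t *\<^sub>R y) \<and> \<bar>t * y $ None\<bar> = real n)" for n
  have A: "\<exists>n. A n \<and> \<bar>t * y $ None\<bar> = real n" if t: "t \<noteq> 0" "int_vec (t *\<^sub>R y)" for t
  proof -
    have "t * y $ None \<in> \<int>" using t(2) by (simp add: int_vec_def)
    then obtain k where k: "t * y $ None = of_int k" by (auto simp: Ints_def)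
    have k0: "k \<noteq> 0" using k t(1) y0 by auto
    have "\<bar>t * y $ None\<bar> = real (nat \<bar>k\<bar>)" unfolding k by simp
    moreover have "nat \<bar>k\<bar> > 0" using k0 by simp
    ultimately have "A (nat \<bar>k\<bar>)" unfolding A_def using t(2) by blast
    then show ?thesis using \<open>\<bar>t * y $ None\<bar> = real (nat \<bar>k\<bar>)\<close> by blast
  qed
  define n where "n = (LEAST n. A n)"
  have "\<exists>n. A n" using A[of 1] y(1) unfolding scaleR_one by (meson one_neq_zero)
  then have "A n" unfolding n_def by (rule LeastI_ex)
  then obtain t where t: "int_vec (t *\<^sub>R y)" "\<bar>t * y $ None\<bar> = real n" "n > 0" by (auto simp: A_def)
  have t0: "t \<noteq> 0" using t by auto
  have min: "real n \<le> \<bar>s * y $ None\<bar>" if s: "s \<noteq> 0" "int_vec (s *\<^sub>R y)" for s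
  proof -
    obtain m where "A m" "\<bar>s * y $ None\<bar> = real m" using A[OF s] by blast
    then show ?thesis unfolding n_def using Least_le[of A m] by simp
  qed
  show thesis
  proof (rule that[OF _ t0 t(1)])
    have "\<bar>t\<bar> * \<bar>y $ None\<bar> \<le> 1 * \<bar>y $ None\<bar>" using min[of 1] y(1) t(2) by (simp add: abs_mult) 
    then show "\<bar>t\<bar> \<le> 1" using y0 by simp
    fix s assume s: "s \<noteq> 0" "int_vec (s *\<^sub>R t *\<^sub>R y)"
    have "s * t \<noteq> 0" using s(1) t0 by simp
    moreover have "int_vec ((s * t) *\<^sub>R y)" using s(2) by (simp only: scaleR_scaleR)
    ultimately have "real n \<le> \<bar>s * t * y $ None\<bar>" by (rule min)
    also have "\<dots> = \<bar>s\<bar> * real n" unfolding t(2)[symmetric] abs_mult by simp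
    finally show "\<bar>s\<bar> \<ge> 1" using t(3) by simp
  qed
qed

lemma finite_int_vec_bounded: "finite {x :: real ^ 'n. int_vec x \<and> (\<forall>i. \<bar>x $ i\<bar> \<le> B)}"
proof -
  have "(\<lambda>A :: real ^ 'n ^ 1. A $ 1) ` {A. int_matrix A \<and> (\<forall>i j. \<bar>A $ i $ j\<bar> \<le> B)} = {x. int_vec x \<and> (\<forall>i. \<bar>x $ i\<bar> \<le> B)}"
  proof (intro subset_antisym subsetI)
    fix x :: "real ^ 'n" assume "x \<in> {x. int_vec x \<and> (\<forall>i. \<bar>x $ i\<bar> \<le> B)}"
    then show "x \<in> (\<lambda>A :: real ^ 'n ^ 1. A $ 1) ` {A. int_matrix A \<and> (\<forall>i j. \<bar>A $ i $ j\<bar> \<le> B)}"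
      by (intro image_eqI[of _ _ "\<chi> i. x"]) (auto simp: int_matrix_def int_vec_def)
  qed (auto simp: int_matrix_def int_vec_def)
  moreover have "finite ((\<lambda>A :: real ^ 'n ^ 1. A $ 1) ` {A. int_matrix A \<and> (\<forall>i j. \<bar>A $ i $ j\<bar> \<le> B)})"
    by (intro finite_imageI finite_int_matrix_bounded)
  ultimately show ?thesis by simp
qed

context lorentz_frame
begin

text \<open>Boosts and the opposite horospherical group move \<open>nu\<close> to every forward null
  vector outside the ray of \<open>- nu'\<close>, on which \<open>v $ Some i1 + v $ None\<close>
  vanishes. A sign change reaches that ray.\<close>

lemma SO_transitive_forward_null:
  fixes v :: "'d lvec"
  assumes v: "lip v v = 0" "v $ None > 0"
  obtains h where "h \<in> SO" "h *v nu = v"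
proof -
  define m where "m = (\<Sum>i\<in>- {i1}. (v $ Some i)\<^sup>2)"
  have null: "(v $ Some i1)\<^sup>2 + m = (v $ None)\<^sup>2"
    using v(1) by (simp add: lip_expand sum_split_i1 power2_eq_square m_def)
  have m: "m \<ge> 0" unfolding m_def by (rule sum_nonneg) simp
  have "\<bar>v $ Some i1\<bar> \<le> v $ None" using null m v(2) abs_le_square_iff[of "v $ Some i1" "v $ None"] by simp
  then consider "v $ Some i1 + v $ None > 0" | "v $ Some i1 = - v $ None" by linarith
  then show thesis
  proof cases
    case 1
    define s where "s = (v $ Some i1 + v $ None) / 2"
    have s: "s > 0" using 1 by (simp add: s_def)
    define w where "w = (\<chi> i. if i = Some i1 \<or> i = None then 0 else v $ i / (2 * s))"
    have w: "horo w" by (simp add: horo_def w_def)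
    let ?h = "Eichler nu' w ** Boost nu nu' s"
    have "?h \<in> SO"
      by (intro SO_mult Eichler_SO Boost_nu s) (use w in \<open>simp_all add: lip_nu_nu horo_lip\<close>)
    moreover have "?h *v nu = v"
    proof -
      have ww: "lip w w = m / (2 * s)\<^sup>2"
      proof -
        have "lip w w = (\<Sum>i\<in>- {i1}. (v $ Some i)\<^sup>2 / (2 * s)\<^sup>2)"
          unfolding lip_expand sum_split_i1 by (simp add: w_def power2_eq_square)
        then show ?thesis by (simp add: m_def sum_divide_distrib)
      qed
      have h: "?h *v nu = s *\<^sub>R nu + (2 * s) *\<^sub>R w - (s * lip w w) *\<^sub>R nu'"
        by (simp add: matrix_vector_mul_assoc[symmetric] Boost_works boost_nu Eichler_works eichler_def
            lip_simps lip_nu_nu lip_sym[of nu w] horo_lip w mult.commute)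
      have sm: "s * lip w w = - (v $ Some i1 - v $ None) / 2"
      proof -
        have "(v $ Some i1 - v $ None) * (2 * s) = - m" using null by (simp add: s_def power2_eq_square algebra_simps)
        then have "m = - (v $ Some i1 - v $ None) * (2 * s)" by (simp only: mult_minus_left)
        then show ?thesis using s by (simp add: ww power2_eq_square)
      qed
      have w2: "2 * s * w $ i = (if i = Some i1 \<or> i = None then 0 else v $ i)" for i
        using s by (simp add: w_def)
      show ?thesis unfolding h sm vec_eq_iff
        by (simp add: w2 nu_nth) (simp add: s_def field_simps)
    qed
    ultimately show thesis by (rule that)
  next
    case 2
    then have "m = 0" using null by simp
    then have mid: "v $ Some i = 0" if "i \<noteq> i1" for i
      using that sum_nonneg_eq_0_iff[of "- {i1}" "\<lambda>i. (v $ Some i)\<^sup>2"] by (auto simp: m_def)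
    let ?h = "sign_flip {Some i1, Some i2} ** Boost nu nu' (v $ None)"
    have "?h \<in> SO" using i12 by (intro SO_mult sign_flip_SO Boost_nu v) auto
    moreover have "?h *v nu = v"
    proof -
      have "v $ j = (if j = Some i1 then - v $ None else if j = None then v $ None else 0)" for j
        using 2 mid by (cases j) auto
      note vj = this
      show ?thesis unfolding vec_eq_iff
        by (intro allI trans[OF _ vj[symmetric]])
          (use i12 in \<open>auto simp: matrix_vector_mul_assoc[symmetric] Boost_works boost_nu sign_flip_mult_nth nu_nth\<close>)
    qed
    ultimately show thesis by (rule that)
  qed
qed

lemma SO_transitive_null:
  fixes v :: "'d lvec"
  assumes v: "lip v v = 0" "v \<noteq> 0"
  obtains h where "h \<in> SO" "h *v nu = v"
proof -
  have "v $ None \<noteq> 0" using null_vector_nz v by blast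
  then consider "v $ None > 0" | "(- v) $ None > 0" by (auto simp: neq_iff)
  then show thesis
  proof cases
    case 1 show thesis by (rule SO_transitive_forward_null[OF v(1) 1]) (rule that)
  next
    case 2
    then obtain h where h: "h \<in> SO" "h *v nu = - v"
      using SO_transitive_forward_null[of "- v"] v(1) by (auto simp: lip_simps)
    let ?f = "sign_flip {Some i1, None}"
    have f: "?f *v nu = - nu" by (auto simp: vec_eq_iff sign_flip_mult_nth nu_nth)
    show thesis
    proof (rule that)
      show "h ** ?f \<in> SO" by (intro SO_mult h sign_flip_SO) simp
      have "(h ** ?f) *v nu = h *v (- nu)" by (simp add: matrix_vector_mul_assoc[symmetric] f)
      also have "\<dots> = - (h *v nu)" using matrix_vector_mult_diff_distrib[of h 0 nu] by simp
      finally show "(h ** ?f) *v nu = v" by (simp add: h)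
    qed
  qed
qed

lemma Eichler_Boost_swap:
  assumes "s > 0" "horo w"
  shows "Eichler nu w ** Boost nu nu' s = Boost nu nu' s ** Eichler nu (inverse s *\<^sub>R w)"
proof -
  have b: "Boost nu nu' s \<in> SO" by (rule Boost_nu assms)+
  have "Boost nu nu' s *v eichler nu (inverse s *\<^sub>R w) x = eichler nu w (Boost nu nu' s *v x)" for x
  proof -
    have "Boost nu nu' s *v (inverse s *\<^sub>R w) = inverse s *\<^sub>R w" "Boost nu nu' s *v nu = s *\<^sub>R nu"
      by (simp_all add: Boost_works boost_nu) (simp add: boost_def assms horo_lip lip_simps)
    then have "Boost nu nu' s *v eichler nu (inverse s *\<^sub>R w) x = eichler (s *\<^sub>R nu) (inverse s *\<^sub>R w) (Boost nu nu' s *v x)"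
      by (simp only: SO_eichler[OF b])
    also have "\<dots> = eichler nu w (Boost nu nu' s *v x)"
      using assms(1) by (simp only: eichler_scale) simp
    finally show ?thesis .
  qed
  then show ?thesis by (simp add: matrix_eq matrix_vector_mul_assoc[symmetric] Boost_works Eichler_works)
qed

end

context so_haar
begin

text \<open>
  If the lattice of \<open>g\<close> contains a vector of norm below \<open>1/2\<close>, it contains a primitive null vector
  \<open>g x\<close> of that kind. Stretching the direction of \<open>g x\<close> until the norm is \<open>sqrt 2\<close> gives a lattice without
  short vectors, since an integral vector nearly orthogonal to \<open>x\<close> is orthogonal to it.
\<close>

theorem finite_measure_covering:
  obtains S where "S \<in> sets borel" "emeasure haar_ext S < \<infinity>"
    "\<And>g. g \<in> SO \<Longrightarrow> \<exists>\<gamma>\<in>SO. int_matrix \<gamma> \<and> g ** \<gamma> \<in> S"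
proof -
  let ?G = "SO :: 'd lmat set"
  define n where "n = real CARD('d option)"
  obtain L where L: "\<And>g :: 'd lmat. g \<in> ?G \<Longrightarrow>
      (\<And>y. int_vec y \<Longrightarrow> y \<noteq> 0 \<Longrightarrow> 1/2 \<le> norm (g *v y)) \<Longrightarrow>
      \<exists>\<gamma>\<in>?G. int_matrix \<gamma> \<and> norm (g ** \<gamma>) \<le> L" using Mahler_criterion[of "1/2"] by auto
  \<comment> \<open>One cusp for each null vector that can occur below: \<open>z\<close> is the
    inverse of \<open>\<omega>\<close> applied to a vector of norm below 2, and the entries of that
    inverse are, up to sign, those of \<open>\<omega>\<close>, hence at most
    \<open>L\<close>.\<close>
  define F where "F = {z :: 'd lvec. (int_vec z \<and> (\<forall>i. \<bar>z $ i\<bar> \<le> n * (L * 2))) \<and> lip z z = 0 \<and> z \<noteq> 0}"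
  have F: "finite F" unfolding F_def by (rule finite_subset[OF _ finite_int_vec_bounded[of "n * (L * 2)"]]) auto
  define t where "t z = (SOME h. h \<in> ?G \<and> h *v nu = z)" for z
  have t: "t z \<in> ?G" "t z *v nu = z" if "lip z z = 0" "z \<noteq> 0" for z
    using someI_ex[of "\<lambda>h. h \<in> ?G \<and> h *v nu = z"] SO_transitive_null[OF that] unfolding t_def by metis+
  \<comment> \<open>Bounds the entries of a matrix with entries at most \<open>L\<close> times
    \<open>t z\<close>; the added one makes it positive.\<close>
  define Rz where "Rz z = n * (\<bar>L\<bar> * norm (t z)) + 1" for z
  have Rz: "Rz z > 0" for z unfolding Rz_def n_def by (intro add_nonneg_pos mult_nonneg_nonneg) auto
  define T where "T z = {h. h ** t z \<in> cusp (Rz z)}" for z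
  have T: "T z \<in> sets borel" for z
    unfolding T_def by (rule right_vimage_borel[OF cusp_borel])
  define S where "S = cball 0 L \<union> (\<Union>z\<in>F. T z)"
  show thesis
  proof (rule that)
    show "S \<in> sets borel" unfolding S_def using T F by (intro sets.Un sets.finite_UN) auto
    have "emeasure haar_ext S \<le> emeasure haar_ext (cball 0 L) + emeasure haar_ext (\<Union>z\<in>F. T z)"
      unfolding S_def using T F by (intro emeasure_subadditive) (auto simp: sets_haar_ext intro!: sets.finite_UN)
    also have "\<dots> \<le> emeasure haar_ext (cball 0 L) + (\<Sum>z\<in>F. emeasure haar_ext (T z))"
      using T F by (intro add_left_mono emeasure_subadditive_finite) (auto simp: sets_haar_ext)
    also have "\<dots> < \<infinity>"
    proof -
      have "emeasure haar_ext (cball 0 L) < \<infinity>" by (rule left_haar_bounded[OF left_haar_ext]) auto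
      moreover have "emeasure haar_ext (T z) < \<infinity>" if "z \<in> F" for z
        unfolding T_def using that t cusp_measure_finite[OF Rz] by (subst right_invariant[OF _ cusp_borel]) (auto simp: F_def)
      ultimately show ?thesis using F by simp
    qed
    finally show "emeasure haar_ext S < \<infinity>" .
    fix g assume g: "g \<in> ?G"
    show "\<exists>\<gamma>\<in>?G. int_matrix \<gamma> \<and> g ** \<gamma> \<in> S"
    proof (cases "\<forall>y. int_vec y \<and> y \<noteq> 0 \<longrightarrow> 1/2 \<le> norm (g *v y)")
      case True
      then show ?thesis using L[OF g] by (auto simp: S_def)
    next
      case False
      then obtain y where y: "int_vec y" "y \<noteq> 0" "norm (g *v y) < 1/2" by auto
      have "\<bar>lip y y\<bar> < 1"
      proof -
        have "\<bar>lip y y\<bar> \<le> norm (g *v y) * norm (g *v y)" using lip_bound[of "g *v y" "g *v y"] by (simp add: lip_SO[OF g])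
        also have "\<dots> \<le> (1/2) * (1/2)" using y(3) by (intro mult_mono) auto
        finally show ?thesis by simp
      qed
      then have null: "lip y y = 0" using int_vec_lip[OF y(1,1)] Ints_nonzero_abs_less1 by blast
      obtain q where q: "\<bar>q\<bar> \<le> 1" "q \<noteq> 0" "int_vec (q *\<^sub>R y)"
        "\<And>s. s \<noteq> 0 \<Longrightarrow> int_vec (s *\<^sub>R q *\<^sub>R y) \<Longrightarrow> \<bar>s\<bar> \<ge> 1" using primitive_null_vector[OF y(1,2) null] by blast
      define \<sigma> where "\<sigma> = sgn ((g *v (q *\<^sub>R y)) $ None)"
      define x where "x = \<sigma> *\<^sub>R q *\<^sub>R y"
      have gy0: "(g *v (q *\<^sub>R y)) $ None \<noteq> 0"
      proof
        assume "(g *v (q *\<^sub>R y)) $ None = 0"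
        then have "g *v (q *\<^sub>R y) = 0" by (intro null_vector_nz) (simp_all add: lip_SO[OF g] lip_simps null)
        then have "lorentz_inv g *v (g *v (q *\<^sub>R y)) = 0" by simp
        then show False using q(2) y(2) by (simp add: matrix_vector_mul_assoc lorentz_inv_left[OF g])
      qed
      have \<sigma>: "\<sigma> = 1 \<or> \<sigma> = - 1" using gy0 by (auto simp: \<sigma>_def sgn_if)
      have x: "int_vec x" "lip x x = 0" "x \<noteq> 0" using \<sigma> q y null by (auto simp: x_def lip_simps)
      have prim: "\<bar>s\<bar> \<ge> 1" if "s \<noteq> 0" "int_vec (s *\<^sub>R x)" for s
        using q(4)[of "s * \<sigma>"] that \<sigma> by (auto simp: x_def abs_mult)
      define r where "r = (g *v x) $ None"
      have "r = \<sigma> * (g *v (q *\<^sub>R y)) $ None" unfolding r_def x_def by (simp add: matrix_vector_mult_scaleR)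
      also have "\<dots> = \<bar>(g *v (q *\<^sub>R y)) $ None\<bar>" unfolding \<sigma>_def by (simp only: sgn_mult_self_eq abs_sgn mult.commute)
      finally have r: "0 < r" using gy0 by (simp only: zero_less_abs_iff not_False_eq_True)
      have "norm (g *v x) \<le> norm (g *v y)"
        using q(1) \<sigma> by (auto simp: x_def matrix_vector_mult_scaleR intro!: mult_left_le_one_le)
      then have r1: "r < 1" using y(3) component_le_norm_cart[of "g *v x" None] r_def by linarith
      note tx = t[OF x(2,3)]
      define h where "h = g ** t x"
      have h: "h \<in> ?G" unfolding h_def by (intro SO_mult g tx)
      have rh: "rho h = r" by (simp add: rho_def h_def matrix_vector_mul_assoc[symmetric] tx r_def)
      obtain k w where k: "k \<in> ?G" "\<And>x. (k *v x) $ None = sgn r * x $ None" "horo w"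
        "h = k ** Eichler nu w ** Boost nu nu' \<bar>r\<bar>" using KAN_decomposition[OF h] unfolding rh by metis
      define E where "E = Eichler nu (inverse r *\<^sub>R w)"
      have hw: "horo (inverse r *\<^sub>R w)" using k(3) by (simp add: horo_def)
      have E: "E \<in> ?G" "E *v nu = nu" unfolding E_def by (simp_all add: Eichler_nu_SO hw Eichler_works eichler_nu_nu)
      define b where "b = Boost nu nu' r"
      have hk: "h = k ** b ** E"
        using r by (simp add: k(4) Eichler_Boost_swap[OF _ k(3)] matrix_mul_assoc[symmetric] b_def E_def)
      have k0: "(k *v x) $ None = x $ None" for x using k(2) r by simp
      \<comment> \<open>As \<open>g\<close> is \<open>k ** b ** E ** lorentz_inv (t x)\<close>, this
        is \<open>g\<close> without the boost that shortens \<open>x\<close>. It takes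
        \<open>x\<close> to \<open>k *v nu\<close>, of norm \<open>sqrt 2\<close>.\<close>
      define g' where "g' = k ** E ** lorentz_inv (t x)"
      have g': "g' \<in> ?G" unfolding g'_def by (intro SO_mult k E SO_inv tx)
      have tix: "lorentz_inv (t x) *v x = nu"
        using tx by (metis matrix_vector_mul_assoc lorentz_inv_left matrix_vector_mul_lid)
      have g'x: "g' *v x = k *v nu" by (simp add: g'_def matrix_vector_mul_assoc[symmetric] tix E)
      have ng'x: "(norm (g' *v x))\<^sup>2 = 2"
        by (simp only: power2_norm_eq_inner inner_eq_lip g'x k0 lip_SO[OF k(1)] lip_nu_nu) (simp add: nu_nth)
      \<comment> \<open>The products of a short \<open>y\<close> with itself and with
        \<open>x\<close> are integers below one in absolute value, so \<open>y\<close> is null and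
        proportional to \<open>x\<close>; primitivity then makes its image at least as long as that
        of \<open>x\<close>.\<close>
      have no_short: "1/2 \<le> norm (g' *v y)" if y: "int_vec y" "y \<noteq> 0" for y
      proof (rule ccontr)
        assume "\<not> ?thesis"
        then have s: "norm (g' *v y) < 1/2" by simp
        have "\<bar>lip y y\<bar> \<le> norm (g' *v y) * norm (g' *v y)" using lip_bound[of "g' *v y" "g' *v y"] by (simp add: lip_SO[OF g'])
        also have "\<dots> \<le> (1/2) * (1/2)" using s by (intro mult_mono) auto
        finally have "\<bar>lip y y\<bar> < 1" by simp
        then have yy: "lip y y = 0" using int_vec_lip[OF y(1,1)] Ints_nonzero_abs_less1 by blast
        have n2: "norm (g' *v x) < 2" using ng'x by (intro power2_less_imp_less[of _ 2]) auto
        have "\<bar>lip x y\<bar> \<le> norm (g' *v x) * norm (g' *v y)" using lip_bound[of "g' *v x" "g' *v y"] by (simp add: lip_SO[OF g'])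
        also have "\<dots> < 2 * (1/2)" using s n2 by (intro mult_strict_mono) auto
        finally have "\<bar>lip x y\<bar> < 1" by simp
        then have xy: "lip x y = 0" using int_vec_lip[OF x(1) y(1)] Ints_nonzero_abs_less1 by blast
        have x0: "x $ None \<noteq> 0" using null_vector_nz x by blast
        define p where "p = y $ None / x $ None"
        have yp: "y = p *\<^sub>R x" unfolding p_def by (rule null_orthogonal_parallel[OF x(2) yy xy x0])
        then have "\<bar>p\<bar> \<ge> 1" using prim[of p] y by auto
        then have "norm (g' *v x) \<le> norm (g' *v y)" by (simp add: yp matrix_vector_mult_scaleR mult_le_cancel_right1)
        then have "norm (g' *v x) \<le> 1/2" using s by simp
        then have "(norm (g' *v x))\<^sup>2 \<le> (1/2)\<^sup>2" by (intro power_mono) auto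
        then show False using ng'x by (simp add: power2_eq_square)
      qed
      obtain \<gamma> where \<gamma>: "\<gamma> \<in> ?G" "int_matrix \<gamma>" "norm (g' ** \<gamma>) \<le> L" using L[OF g' no_short] by blast
      \<comment> \<open>The null vector \<open>x\<close> seen after reduction by
        \<open>\<gamma>\<close>: it lies in the finite set \<open>F\<close> and names the cusp that
        contains \<open>g ** \<gamma>\<close>.\<close>
      define z where "z = lorentz_inv \<gamma> *v x"
      have \<gamma>z: "\<gamma> *v z = x" by (simp add: z_def matrix_vector_mul_assoc lorentz_inv_right[OF \<gamma>(1)])
      define \<omega> where "\<omega> = g' ** \<gamma>"
      have \<omega>: "\<omega> \<in> ?G" unfolding \<omega>_def by (intro SO_mult g' \<gamma>)
      have \<omega>e: "\<bar>\<omega> $ i $ j\<bar> \<le> L" for i j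
        using \<gamma>(3) component_le_norm_cart[of "\<omega> $ i" j] Finite_Cartesian_Product.norm_nth_le[of \<omega> i] unfolding \<omega>_def by linarith
      have L0: "L \<ge> 0" using \<gamma>(3) norm_ge_zero order_trans by blast
      have zF: "z \<in> F"
      proof -
        have "\<omega> *v z = g' *v x" by (simp add: \<omega>_def matrix_vector_mul_assoc[symmetric] \<gamma>z)
        then have ze: "z = lorentz_inv \<omega> *v (g' *v x)"
          by (metis \<omega> lorentz_inv_left matrix_vector_mul_assoc matrix_vector_mul_lid)
        have "norm (g' *v x) < 2" using ng'x by (intro power2_less_imp_less[of _ 2]) auto
        then have e: "\<bar>(g' *v x) $ j\<bar> \<le> 2" for j using component_le_norm_cart[of "g' *v x" j] by linarith
        have "\<bar>z $ i\<bar> \<le> n * (L * 2)" for i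
        proof -
          have "\<bar>z $ i\<bar> \<le> (\<Sum>j\<in>UNIV. \<bar>lorentz_inv \<omega> $ i $ j * (g' *v x) $ j\<bar>)"
            unfolding ze matrix_vector_mult_def[of "lorentz_inv \<omega>"] by (simp only: vec_lambda_beta sum_abs)
          also have "\<dots> \<le> (\<Sum>j\<in>(UNIV :: 'd option set). L * 2)"
            using \<omega>e e L0 by (intro sum_mono) (auto simp: abs_mult lorentz_inv_nth intro!: mult_mono)
          finally show ?thesis by (simp add: n_def)
        qed
        moreover have "int_vec z" unfolding z_def by (intro int_matrix_vec int_matrix_lorentz_inv \<gamma> x)
        moreover have "lip z z = 0" unfolding z_def by (simp add: lip_SO[OF SO_inv(2)[OF \<gamma>(1)]] x)
        moreover have "z \<noteq> 0" using \<gamma>z x(3) by auto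
        ultimately show ?thesis by (simp add: F_def)
      qed
      then have tz: "t z \<in> ?G" "t z *v nu = z" using t by (auto simp: F_def)
      define p where "p = g ** \<gamma> ** t z"
      have p: "p \<in> ?G" unfolding p_def by (intro SO_mult g \<gamma> tz)
      have rp: "rho p = r" by (simp add: rho_def p_def matrix_vector_mul_assoc[symmetric] tz \<gamma>z r_def)
      \<comment> \<open>The matrix \<open>p\<close> and the bounded matrix
        \<open>\<omega> ** t z\<close> differ only by the boost. Since \<open>b'\<close> fixes
        \<open>nu\<close>, it keeps the relevant unit vectors orthogonal to \<open>nu\<close>, and
        on such vectors the boost multiplies the time coordinate by
        \<open>r = rho p\<close>.\<close>
      define b' where "b' = E ** lorentz_inv (t x) ** \<gamma> ** t z"
      have b': "b' \<in> ?G" unfolding b'_def by (intro SO_mult E SO_inv tx \<gamma> tz)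
      have b'nu: "b' *v nu = nu" by (simp add: b'_def matrix_vector_mul_assoc[symmetric] tz \<gamma>z tix E)
      have pb: "p = k ** b ** b'"
      proof -
        have "g = h ** lorentz_inv (t x)" by (simp add: h_def SO_inv_mult_cancel[OF tx(1)])
        then show ?thesis by (simp add: p_def hk b'_def matrix_mul_assoc)
      qed
      have wb: "\<omega> ** t z = k ** b'" by (simp add: \<omega>_def g'_def b'_def matrix_mul_assoc)
      have row: "\<bar>p $ None $ Some i\<bar> \<le> Rz z * rho p" if i: "i \<noteq> i1" for i
      proof -
        define y where "y = b' *v axis (Some i) 1"
        have "lip y nu = lip (axis (Some i) 1) nu" unfolding y_def by (subst b'nu[symmetric]) (rule lip_SO[OF b'])
        also have "\<dots> = 0" using i by (simp add: lip_nu axis_def)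
        finally have ynu: "lip y nu = 0" .
        have "p $ None $ Some i = boost nu nu' r y $ None"
          by (simp add: matrix_axis_nth[symmetric] pb matrix_vector_mul_assoc[symmetric] k0 b_def Boost_works y_def)
        also have "\<dots> = r * y $ None"
          using ynu by (simp add: boost_def lip_nu nu_nth algebra_simps)
        also have "y $ None = (\<omega> ** t z) $ None $ Some i"
          unfolding wb by (simp add: matrix_axis_nth[symmetric] matrix_vector_mul_assoc[symmetric] k0 y_def)
        finally have e: "p $ None $ Some i = r * (\<omega> ** t z) $ None $ Some i" .
        have "\<bar>(\<omega> ** t z) $ None $ Some i\<bar> \<le> (\<Sum>j\<in>UNIV. \<bar>\<omega> $ None $ j * t z $ j $ Some i\<bar>)"
          unfolding matrix_matrix_mult_def by (simp only: vec_lambda_beta sum_abs)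
        also have "\<dots> \<le> (\<Sum>j\<in>(UNIV :: 'd option set). \<bar>L\<bar> * norm (t z))"
        proof (rule sum_mono)
          fix j
          have "\<bar>t z $ j $ Some i\<bar> \<le> norm (t z)"
            using component_le_norm_cart[of "t z $ j" "Some i"] Finite_Cartesian_Product.norm_nth_le[of "t z" j] by linarith
          then show "\<bar>\<omega> $ None $ j * t z $ j $ Some i\<bar> \<le> \<bar>L\<bar> * norm (t z)"
            using \<omega>e[of None j] L0 unfolding abs_mult by (intro mult_mono) auto
        qed
        also have "\<dots> \<le> Rz z" by (simp add: Rz_def n_def)
        finally have "\<bar>(\<omega> ** t z) $ None $ Some i\<bar> \<le> Rz z" .
        then show ?thesis unfolding e rp abs_mult using r by (simp add: mult.commute mult_right_mono)
      qed
      have "p \<in> cusp (Rz z)" using p row rp r r1 by (simp add: cusp_def)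
      then have "g ** \<gamma> \<in> T z" by (simp add: T_def p_def)
      then have "g ** \<gamma> \<in> S" using zF by (auto simp: S_def)
      then show ?thesis using \<gamma> by blast
    qed
  qed
qed

end

subsection \<open>Congruence modulo three\<close>

definition cong3 :: "real ^ 'n ^ 'n \<Rightarrow> real ^ 'n ^ 'n \<Rightarrow> bool" where
  "cong3 A B \<longleftrightarrow> int_matrix ((1/3) *\<^sub>R (A - B))"

lemma int_matrix_add: "int_matrix A \<Longrightarrow> int_matrix B \<Longrightarrow> int_matrix (A + B)"
  by (simp add: int_matrix_def)

lemma int_matrix_scale: "c \<in> \<int> \<Longrightarrow> int_matrix A \<Longrightarrow> int_matrix (c *\<^sub>R A)"
  by (simp add: int_matrix_def)

lemma matrix_mult_linear:
  fixes A B C :: "real ^ 'n ^ 'n"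
  shows "(A + B) ** C = A ** C + B ** C" "C ** (A + B) = C ** A + C ** B"
    "(A - B) ** C = A ** C - B ** C" "C ** (A - B) = C ** A - C ** B"
    "(c *\<^sub>R A) ** B = c *\<^sub>R (A ** B)" "A ** (c *\<^sub>R B) = c *\<^sub>R (A ** B)"
  by (simp_all add: vec_eq_iff matrix_matrix_mult_def sum.distrib sum_subtractf sum_distrib_left algebra_simps)

lemma cong3_int_matrix: assumes "cong3 A B" "int_matrix B" shows "int_matrix A"
proof -
  have "int_matrix (3 *\<^sub>R ((1/3) *\<^sub>R (A - B)) + B)"
    using assms(1) unfolding cong3_def by (intro int_matrix_add[OF int_matrix_scale assms(2)]) simp
  then show ?thesis by simp
qed

lemma cong3_mult:
  assumes "cong3 A A'" "cong3 B B'" "int_matrix A" "int_matrix B'"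
  shows "cong3 (A ** B) (A' ** B')"
proof -
  have "(1/3) *\<^sub>R (A ** B - A' ** B') = A ** ((1/3) *\<^sub>R (B - B')) + ((1/3) *\<^sub>R (A - A')) ** B'"
    by (simp add: matrix_mult_linear algebra_simps)
  then show ?thesis
    unfolding cong3_def using assms by (simp add: cong3_def int_matrix_add int_matrix_mult)
qed

lemma cong3_refl: "cong3 A A" by (simp add: cong3_def int_matrix_def)

text \<open>The binomial expansion modulo the square of \<open>N\<close>; of the remainder only
  integrality will matter.\<close>

lemma SO_pow_expand:
  fixes X :: "('d::finite) lmat"
  assumes "N \<in> \<int>" "int_matrix X"
  shows "\<exists>Y. int_matrix Y \<and> (mat 1 + N *\<^sub>R X) [^]\<^bsub>SO_d_1\<^esub> (j::nat)
     = mat 1 + (real j * N) *\<^sub>R X + (N * N) *\<^sub>R Y"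
proof (induction j)
  case 0
  show ?case by (intro exI[of _ 0]) (simp add: int_matrix_def)
next
  case (Suc j)
  then obtain Y where Y: "int_matrix Y" "(mat 1 + N *\<^sub>R X) [^]\<^bsub>SO_d_1\<^esub> j
     = mat 1 + (real j * N) *\<^sub>R X + (N * N) *\<^sub>R Y" by blast
  let ?Z = "real j *\<^sub>R (X ** X) + Y + N *\<^sub>R (Y ** X)"
  have "(mat 1 + N *\<^sub>R X) [^]\<^bsub>SO_d_1\<^esub> Suc j
      = (mat 1 + (real j * N) *\<^sub>R X + (N * N) *\<^sub>R Y) ** (mat 1 + N *\<^sub>R X)"
    by (simp add: Y(2))
  also have "\<dots> = mat 1 + (real (Suc j) * N) *\<^sub>R X + (N * N) *\<^sub>R ?Z"
    by (simp only: matrix_mult_linear matrix_mul_lid matrix_mul_rid) (simp add: vec_eq_iff algebra_simps)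
  finally have "(mat 1 + N *\<^sub>R X) [^]\<^bsub>SO_d_1\<^esub> Suc j = mat 1 + (real (Suc j) * N) *\<^sub>R X + (N * N) *\<^sub>R ?Z" .
  moreover have "int_matrix ?Z"
    using assms Y by (intro int_matrix_add int_matrix_scale int_matrix_mult) auto
  ultimately show ?case by blast
qed

text \<open>Infinite descent: if every power of three dividing \<open>A\<close> can be raised, all
  powers divide the entries.\<close>

lemma pow3_divisible_zero:
  fixes A :: "real ^ 'n ^ 'm"
  assumes "int_matrix ((1/3) *\<^sub>R A)"
    and step: "\<And>k X. int_matrix X \<Longrightarrow> A = 3 ^ Suc k *\<^sub>R X \<Longrightarrow> int_matrix ((1/3) *\<^sub>R X)"
  shows "A = 0"
proof -
  have div: "int_matrix ((1 / 3 ^ Suc k) *\<^sub>R A)" for k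
  proof (induction k)
    case (Suc k)
    have "int_matrix ((1/3) *\<^sub>R ((1 / 3 ^ Suc k) *\<^sub>R A))"
      by (rule step[OF Suc, of k]) simp
    then show ?case by simp
  qed (use assms in simp)
  have "A $ i $ j = 0" for i j
  proof -
    obtain k where "\<bar>A $ i $ j\<bar> < 3 ^ k" using real_arch_pow[of 3] by auto
    also have "(3::real) ^ k \<le> 3 ^ Suc k" by simp
    finally have "\<bar>A $ i $ j / 3 ^ Suc k\<bar> < 1" by (simp add: abs_divide)
    moreover have "A $ i $ j / 3 ^ Suc k \<in> \<int>" using div[of k] by (simp add: int_matrix_def)
    ultimately have "A $ i $ j / 3 ^ Suc k = 0" using Ints_nonzero_abs_less1 by blast
    then show ?thesis by simp
  qed
  then show ?thesis by (simp add: vec_eq_iff)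
qed

lemma Ints_div3_coprime:
  assumes "x \<in> \<int>" "real m * x / 3 \<in> \<int>" "\<not> 3 dvd m" shows "x / 3 \<in> \<int>"
proof -
  obtain k where k: "x = of_int k" using assms(1) by (auto simp: Ints_def)
  obtain l where l: "real m * x / 3 = of_int l" using assms(2) by (auto simp: Ints_def)
  have "real_of_int (int m * k) = real_of_int (3 * l)" using l by (simp add: k)
  then have "int m * k = 3 * l" by (simp only: of_int_eq_iff)
  then have "3 dvd int m * k" by simp
  moreover have "prime (3::int)" by simp
  moreover have "\<not> 3 dvd int m" using assms(3) by presburger
  ultimately have "3 dvd k" using prime_dvd_mult_iff by blast
  then obtain q where "k = 3 * q" by (auto simp: dvd_def)
  then show ?thesis by (simp add: k)
qed

lemma torsion_coprime_3:
  fixes g :: "('d::finite) lmat"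
  assumes "cong3 g (mat 1)" "g [^]\<^bsub>SO_d_1\<^esub> (m::nat) = mat 1" "\<not> 3 dvd m"
  shows "g = mat 1"
proof -
  have "g - mat 1 = 0"
  proof (rule pow3_divisible_zero)
    fix k X assume X: "int_matrix X" and e: "g - mat 1 = 3 ^ Suc k *\<^sub>R X"
    define N where "N = (3::real) ^ Suc k"
    have N: "N \<in> \<int>" "N \<noteq> 0" "N / 3 \<in> \<int>" by (simp_all add: N_def)
    have g: "g = mat 1 + N *\<^sub>R X" using e unfolding N_def by (simp only: diff_eq_eq add.commute)
    obtain Y where Y: "int_matrix Y" "g [^]\<^bsub>SO_d_1\<^esub> m = mat 1 + (real m * N) *\<^sub>R X + (N * N) *\<^sub>R Y"
      using SO_pow_expand[OF N(1) X, of m] g by auto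
    have "X $ i $ j / 3 \<in> \<int>" for i j
    proof (rule Ints_div3_coprime[OF _ _ assms(3)])
      show "X $ i $ j \<in> \<int>" using X by (simp add: int_matrix_def)
      have "(real m * N) *\<^sub>R X + (N * N) *\<^sub>R Y = 0" using Y(2) assms(2) by (simp add: add.assoc)
      then have "((real m * N) *\<^sub>R X + (N * N) *\<^sub>R Y) $ i $ j = 0" by simp
      then have "N * (real m * X $ i $ j + N * Y $ i $ j) = 0" by (simp add: algebra_simps)
      then have "real m * X $ i $ j + N * Y $ i $ j = 0" using N(2) by simp
      then have "real m * X $ i $ j / 3 = - (N / 3 * Y $ i $ j)" by simp
      also have "\<dots> \<in> \<int>" using N(3) Y(1) by (intro Ints_minus Ints_mult) (auto simp: int_matrix_def)
      finally show "real m * X $ i $ j / 3 \<in> \<int>" .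
    qed
    then show "int_matrix ((1/3) *\<^sub>R X)" by (simp add: int_matrix_def)
  qed (use assms(1) in \<open>simp add: cong3_def\<close>)
  then show ?thesis by simp
qed

text \<open>For the exponent three, the linear term and the remainder modulo the square of
  \<open>N\<close> may be divisible by the same power of three, so the cube is expanded in full:
  after division by \<open>9 * M\<close> the quadratic and cubic terms keep a factor three. Level
  two would not do, as sign changes are congruent to the identity modulo two.\<close>

lemma torsion_3:
  fixes g :: "('d::finite) lmat"
  assumes "cong3 g (mat 1)" "g [^]\<^bsub>SO_d_1\<^esub> (3::nat) = mat 1"
  shows "g = mat 1"
proof -
  have "g - mat 1 = 0"
  proof (rule pow3_divisible_zero)
    fix k X assume X: "int_matrix X" and e: "g - mat 1 = 3 ^ Suc k *\<^sub>R X"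
    define M where "M = (3::real) ^ k"
    have M: "M \<in> \<int>" "M \<noteq> 0" by (simp_all add: M_def)
    have g: "g = mat 1 + (3 * M) *\<^sub>R X" using e unfolding M_def by (simp only: diff_eq_eq add.commute power_Suc)
    have "mat 1 = g ** g ** g" using assms(2) by (simp add: numeral_3_eq_3)
    also have "\<dots> = mat 1 + (9 * M) *\<^sub>R (X + (3 * M) *\<^sub>R (X ** X) + (3 * M * M) *\<^sub>R (X ** X ** X))"
      unfolding g by (simp only: matrix_mult_linear matrix_mul_lid matrix_mul_rid) (simp add: vec_eq_iff algebra_simps)
    finally have "(9 * M) *\<^sub>R (X + (3 * M) *\<^sub>R (X ** X) + (3 * M * M) *\<^sub>R (X ** X ** X)) = 0" by simp
    then have "X + (3 * M) *\<^sub>R (X ** X) + (3 * M * M) *\<^sub>R (X ** X ** X) = 0" using M(2) by simp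
    then have "X = - ((3 * M) *\<^sub>R (X ** X) + (3 * M * M) *\<^sub>R (X ** X ** X))"
      by (simp only: eq_neg_iff_add_eq_0 add.assoc)
    then have "X = 3 *\<^sub>R ((- M) *\<^sub>R (X ** X + M *\<^sub>R (X ** X ** X)))"
      by (simp only: scaleR_scaleR scaleR_right_distrib) (simp add: mult.assoc)
    moreover have "int_matrix ((- M) *\<^sub>R (X ** X + M *\<^sub>R (X ** X ** X)))"
      using X M by (intro int_matrix_scale int_matrix_add int_matrix_mult Ints_minus) auto
    moreover have "(1/3) *\<^sub>R (3 *\<^sub>R Z) = Z" for Z :: "'d lmat" by simp
    ultimately show "int_matrix ((1/3) *\<^sub>R X)" by metis
  qed (use assms(1) in \<open>simp add: cong3_def\<close>)
  then show ?thesis by simp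
qed

text \<open>Minkowski's lemma. Factors three of the exponent are split off one at a time, powers of
  \<open>g\<close> being congruent to the identity as well.\<close>

lemma congruence_torsion_free:
  fixes g :: "('d::finite) lmat"
  assumes "g \<in> SO" "cong3 g (mat 1)" "g [^]\<^bsub>SO_d_1\<^esub> (m::nat) = mat 1" "m > 0"
  shows "g = mat 1"
  using assms(3,4)
proof (induction m rule: less_induct)
  case (less m)
  interpret group "SO_d_1 :: 'd lmat monoid" by (rule group_SO_d_1)
  show ?case
  proof (cases "3 dvd m")
    case True
    then obtain l where l: "m = l * 3" by (metis dvd_def mult.commute)
    define h where "h = g [^]\<^bsub>SO_d_1\<^esub> l"
    define X where "X = (1/3) *\<^sub>R (g - mat 1)"
    have X: "int_matrix X" "g = mat 1 + 3 *\<^sub>R X" using assms(2) by (simp_all add: cong3_def X_def)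
    obtain Y where Y: "int_matrix Y" "h = mat 1 + (real l * 3) *\<^sub>R X + (3 * 3) *\<^sub>R Y"
      using SO_pow_expand[of 3 X l] X unfolding h_def by auto
    have "(1/3) *\<^sub>R (h - mat 1) = real l *\<^sub>R X + 3 *\<^sub>R Y"
      unfolding Y(2) by (simp add: vec_eq_iff)
    then have "cong3 h (mat 1)"
      unfolding cong3_def using X(1) Y(1) by (simp add: int_matrix_add int_matrix_scale)
    moreover have "h [^]\<^bsub>SO_d_1\<^esub> (3::nat) = mat 1"
      using less.prems(1) nat_pow_pow[OF assms(1), of l 3] by (simp add: h_def l)
    ultimately have "h = mat 1" by (rule torsion_3)
    then show ?thesis using less.IH[of l] less.prems(2) by (simp add: h_def l)
  qed (use torsion_coprime_3[OF assms(2) less.prems(1)] in auto)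
qed

subsection \<open>Time orientation\<close>

definition spat :: "('d::finite) lvec \<Rightarrow> real ^ 'd" where
  "spat x = (\<chi> i. x $ Some i)"

lemma lip_spat: "lip x y = spat x \<bullet> spat y - x $ None * y $ None"
  by (simp add: lip_expand spat_def inner_vec_def)

definition forward :: "('d::finite) lvec \<Rightarrow> bool" where
  "forward x \<longleftrightarrow> norm (spat x) < x $ None"

lemma forward_iff: "forward x \<longleftrightarrow> lip x x < 0 \<and> x $ None > 0"
proof -
  have l: "lip x x = (norm (spat x))\<^sup>2 - (x $ None)\<^sup>2"
    by (simp only: lip_spat power2_norm_eq_inner) (simp add: power2_eq_square)
  show ?thesis
  proof
    assume f: "forward x"
    then have p: "x $ None > 0" using norm_ge_zero[of "spat x"] unfolding forward_def by linarith
    have "(norm (spat x))\<^sup>2 < (x $ None)\<^sup>2" using f by (intro power_strict_mono) (auto simp: forward_def)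
    then show "lip x x < 0 \<and> x $ None > 0" using p l by simp
  next
    assume "lip x x < 0 \<and> x $ None > 0"
    then show "forward x" unfolding forward_def l
      by (intro power2_less_imp_less[of "norm (spat x)" "x $ None"]) auto
  qed
qed

lemma forward_lip: assumes "forward x" "forward y" shows "lip x y < 0"
proof -
  have "spat x \<bullet> spat y \<le> norm (spat x) * norm (spat y)" by (rule norm_cauchy_schwarz)
  also have "\<dots> < x $ None * y $ None"
    using assms norm_ge_zero[of "spat x"] norm_ge_zero[of "spat y"] unfolding forward_def
    by (intro mult_strict_mono') auto
  finally show ?thesis by (simp add: lip_spat)
qed

text \<open>On the group this corner entry never vanishes, and its sign tells whether the two sheets
  of the hyperboloid are exchanged.\<close>

definition tsgn :: "('d::finite) lmat \<Rightarrow> real" where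
  "tsgn g = sgn (g $ None $ None)"

abbreviation e0 :: "('d::finite) lvec" where "e0 \<equiv> axis None 1"

lemma forward_e0: "forward e0"
  by (simp add: forward_iff lip_axis)

lemma SO_time_nz: assumes "g \<in> SO" shows "g $ None $ None \<noteq> 0"
proof
  assume "g $ None $ None = 0"
  then have "1 + (\<Sum>i\<in>UNIV. (g $ None $ Some i)\<^sup>2) = 0" using SO_row_zero[OF assms] by simp
  moreover have "(\<Sum>i\<in>UNIV. (g $ None $ Some i)\<^sup>2) \<ge> 0" by (rule sum_nonneg) simp
  ultimately show False by linarith
qed

lemma tsgn_cases: "g \<in> SO \<Longrightarrow> tsgn g = 1 \<or> tsgn g = - 1"
  using SO_time_nz by (auto simp: tsgn_def sgn_if)

text \<open>The sign returns images of forward vectors to the forward cone, so that the whole group,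
  not only its identity component, acts on hyperbolic space.\<close>

definition act :: "('d::finite) lmat \<Rightarrow> 'd lvec \<Rightarrow> 'd lvec" where
  "act g x = tsgn g *\<^sub>R (g *v x)"

lemma act_lip: "g \<in> SO \<Longrightarrow> lip (act g x) (act g y) = lip x y"
  using tsgn_cases[of g] by (auto simp: act_def lip_simps lip_SO)

lemma forward_act_e0: assumes "g \<in> SO" shows "forward (act g e0)"
proof -
  have "act g e0 $ None = \<bar>g $ None $ None\<bar>"
    by (simp add: act_def matrix_axis_nth tsgn_def sgn_if)
  then show ?thesis unfolding forward_iff act_lip[OF assms]
    using SO_time_nz[OF assms] by (simp add: lip_axis)
qed

lemma tsgn_inv: "tsgn (lorentz_inv g) = tsgn g" by (simp add: tsgn_def lorentz_inv_nth)

lemma tsgn_one: "tsgn (mat 1) = 1" by (simp add: tsgn_def mat_def)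

text \<open>The corner entry of \<open>g ** h\<close> is minus the product of the images of
  \<open>e0\<close> under the inverse of \<open>g\<close> and under \<open>h\<close>. Once made
  forward by their signs, these two vectors have negative product.\<close>

lemma tsgn_mult:
  assumes g: "g \<in> SO" and h: "h \<in> SO" shows "tsgn (g ** h) = tsgn g * tsgn h"
proof -
  let ?g' = "lorentz_inv g"
  have "lip (act ?g' e0) (act h e0) < 0" 
    using g h by (intro forward_lip forward_act_e0 SO_inv)
  moreover have "lip (?g' *v e0) (h *v e0) = lip e0 ((g ** h) *v e0)"
    using lip_SO[OF g, of "?g' *v e0" "h *v e0"] by (simp add: matrix_vector_mul_assoc lorentz_inv_right[OF g])
  moreover have "lip e0 ((g ** h) *v e0) = - (g ** h) $ None $ None"
    by (subst lip_sym) (simp add: lip_axis matrix_axis_nth)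
  ultimately have "tsgn g * (tsgn h * (g ** h) $ None $ None) > 0"
    by (simp add: act_def lip_simps tsgn_inv mult.left_commute)
  then show ?thesis using tsgn_cases[OF g] tsgn_cases[OF h] by (auto simp: tsgn_def[of "g ** h"] sgn_if)
qed

lemma act_mult: "g \<in> SO \<Longrightarrow> h \<in> SO \<Longrightarrow> act (g ** h) x = act g (act h x)"
  by (simp add: act_def tsgn_mult matrix_vector_mult_scaleR matrix_vector_mul_assoc)

lemma act_one: "act (mat 1) x = x" by (simp add: act_def tsgn_one)

context lorentz_frame
begin

section \<open>The lattice and its involution\<close>

definition tau :: "'d lmat" where "tau = sign_flip {Some i1, None}"

definition res :: "'d lmat \<Rightarrow> 'd lmat" where
  "res g = (if tsgn g = 1 then mat 1 else tau)"

definition Gam :: "'d lmat set" where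
  "Gam = {g \<in> SO. cong3 g (res g)}"

lemma tau_SO: "tau \<in> SO"
  unfolding tau_def by (rule sign_flip_SO) simp

lemma tau_square: "tau ** tau = mat 1"
  by (simp add: matrix_eq matrix_vector_mul_assoc[symmetric] tau_def vec_eq_iff sign_flip_mult_nth)

lemma tau_inv: "lorentz_inv tau = tau"
  using SO_inv_mult_cancel(1)[OF tau_SO, of tau] by (simp add: tau_square)

lemma tsgn_tau: "tsgn tau = - 1"
  by (simp add: tsgn_def tau_def sign_flip_def)

lemma tau_neq_one: "tau \<noteq> mat 1"
proof
  assume "tau = mat 1"
  then have "tsgn tau = tsgn (mat 1 :: 'd lmat)" by simp
  then show False by (simp add: tsgn_tau tsgn_one)
qed

lemma res_simps: "res (mat 1) = mat 1" "res tau = tau"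
  by (simp_all add: res_def tsgn_one tsgn_tau)

lemma res_int: "int_matrix (res g)"
  by (simp add: res_def int_matrix_one) (simp add: int_matrix_def tau_def sign_flip_def)

lemma res_mult: "g \<in> SO \<Longrightarrow> h \<in> SO \<Longrightarrow> res (g ** h) = res g ** res h"
  using tsgn_cases[of g] tsgn_cases[of h] by (auto simp: res_def tsgn_mult tau_square)

lemma res_square: "res g ** res g = mat 1" by (simp add: res_def tau_square)

lemma res_inv: "res (lorentz_inv g) = res g" "lorentz_inv (res g) = res g"
  by (simp_all add: res_def tsgn_inv tau_inv lorentz_inv_one)

lemma Gam_SO: "g \<in> Gam \<Longrightarrow> g \<in> SO" by (simp add: Gam_def)

lemma Gam_int: "g \<in> Gam \<Longrightarrow> int_matrix g"
  using cong3_int_matrix res_int by (auto simp: Gam_def)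

lemma cong3_lorentz_inv: "cong3 A B \<Longrightarrow> cong3 (lorentz_inv A) (lorentz_inv B)"
  by (auto simp: cong3_def int_matrix_def lorentz_inv_nth algebra_simps diff_divide_distrib)
    (metis Ints_minus minus_diff_eq)+

lemma Gam_mult: assumes "g \<in> Gam" "h \<in> Gam" shows "g ** h \<in> Gam"
  using assms cong3_mult[of g "res g" h "res h"] Gam_int[OF assms(1)] res_int[of h]
  by (simp add: Gam_def SO_mult res_mult)

lemma Gam_inv: assumes "g \<in> Gam" shows "lorentz_inv g \<in> Gam"
  using assms cong3_lorentz_inv[of g "res g"] by (simp add: Gam_def SO_inv res_inv)

lemma Gam_one: "mat 1 \<in> Gam" by (simp add: Gam_def SO_one res_simps cong3_refl)
lemma Gam_tau: "tau \<in> Gam" by (simp add: Gam_def tau_SO res_simps cong3_refl)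

lemma Gam_subgroup: "subgroup Gam SO_d_1"
  by (rule group.subgroupI[OF group_SO_d_1])
    (use Gam_SO Gam_one Gam_mult Gam_inv in \<open>auto simp: SO_inv(1)[OF Gam_SO]\<close>)

text \<open>Because \<open>tau\<close> lies in \<open>F\<close>, so does \<open>res f ** f\<close>.
  It is congruent to the identity modulo three and of finite order, hence trivial.\<close>

lemma finite_subgroup_containing_tau:
  assumes F: "subgroup F SO_d_1" "finite F" "F \<subseteq> Gam" "tau \<in> F"
  shows "F = {mat 1, tau}"
proof -
  interpret group "SO_d_1 :: 'd lmat monoid" by (rule group_SO_d_1)
  have "f = res f" if f: "f \<in> F" for f
  proof -
    have fG: "f \<in> Gam" using f F by auto
    define h where "h = res f ** f"
    have "res f \<in> F" using F(4) subgroup.one_closed[OF F(1)] by (simp add: res_def)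
    then have hF: "h \<in> F" using subgroup.m_closed[OF F(1) _ f] by (simp add: h_def)
    have "cong3 h (res f ** res f)"
      unfolding h_def using fG by (intro cong3_mult cong3_refl res_int) (simp add: Gam_def)
    then have c: "cong3 h (mat 1)" by (simp add: res_square)
    have hS: "h \<in> SO" using hF F(3) Gam_SO by auto
    let ?H = "SO_d_1\<lparr>carrier := F\<rparr> :: 'd lmat monoid"
    have "group ?H" by (rule subgroup.subgroup_is_group[OF F(1) group_axioms])
    then have "h [^]\<^bsub>?H\<^esub> order ?H = \<one>\<^bsub>?H\<^esub>" by (rule group.pow_order_eq_1) (use hF in simp)
    then have "h [^]\<^bsub>SO_d_1\<^esub> card F = mat 1" by (simp add: order_def nat_pow_consistent[symmetric])
    moreover have "card F > 0" using F(2,4) card_gt_0_iff by blast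
    ultimately have "h = mat 1" by (rule congruence_torsion_free[OF hS c])
    then have "res f ** h = res f" by simp
    then show ?thesis by (simp add: h_def matrix_mul_assoc res_square)
  qed
  moreover have "res f \<in> {mat 1, tau}" for f by (simp add: res_def)
  ultimately have "F \<subseteq> {mat 1, tau}" by (intro subsetI) metis
  then show ?thesis using F(4) subgroup.one_closed[OF F(1)] by auto
qed

subsection \<open>Crossing numbers\<close>

text \<open>Normal vectors instead of hyperplanes: the unit vector and its negative differ modulo
  three, so \<open>v\<close> and \<open>- v\<close> are never both walls and the choice orients the
  hyperplane.\<close>

definition walls :: "'d lvec set" where
  "walls = {v. lip v v = 1 \<and> int_vec ((1/3) *\<^sub>R (v - axis (Some i1) 1))}"

lemma int_vec_axis: "int_vec (axis i 1)" by (simp add: int_vec_def axis_def)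

lemma int_vec_scale: "c \<in> \<int> \<Longrightarrow> int_vec v \<Longrightarrow> int_vec (c *\<^sub>R v)" by (simp add: int_vec_def)

lemma walls_int: assumes "v \<in> walls" shows "int_vec v"
proof -
  have "int_vec (3 *\<^sub>R ((1/3) *\<^sub>R (v - axis (Some i1) 1)) + axis (Some i1) 1)"
    using assms unfolding walls_def by (intro int_vec_simps(2)[OF int_vec_scale int_vec_axis]) simp_all
  then show ?thesis by simp
qed

lemma res_axis: assumes "g \<in> SO"
  shows "tsgn g *\<^sub>R (res g *v axis (Some i1) 1) = axis (Some i1) 1"
proof -
  have "tau *v axis (Some i1) 1 = - axis (Some i1) 1"
    by (auto simp: vec_eq_iff tau_def sign_flip_mult_nth axis_def)
  then show ?thesis using tsgn_cases[OF assms] by (auto simp: res_def)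
qed

text \<open>The residue \<open>tau\<close> negates the unit vector, but elements with this residue
  reverse time, and the sign in \<open>act\<close> cancels the negation.\<close>

lemma act_walls: assumes g: "g \<in> Gam" and v: "v \<in> walls" shows "act g v \<in> walls"
proof -
  have gS: "g \<in> SO" using Gam_SO g by auto
  define e :: "'d lvec" where "e = axis (Some i1) 1"
  define X where "X = (1/3) *\<^sub>R (g - res g)"
  have ts: "tsgn g \<in> \<int>" using tsgn_cases[OF gS] by auto
  have ge: "g *v e = res g *v e + 3 *\<^sub>R (X *v e)"
    by (simp add: vec_eq_iff e_def matrix_axis_nth X_def field_simps)
  have "act g v - e = tsgn g *\<^sub>R (g *v (v - e)) + (tsgn g *\<^sub>R (g *v e) - e)"
    by (simp add: act_def matrix_vector_mult_diff_distrib algebra_simps)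
  also have "tsgn g *\<^sub>R (g *v e) - e = 3 *\<^sub>R tsgn g *\<^sub>R (X *v e)"
    unfolding ge using res_axis[OF gS] by (simp add: e_def algebra_simps)
  finally have "(1/3) *\<^sub>R (act g v - e) = (1/3) *\<^sub>R (tsgn g *\<^sub>R (g *v (v - e)) + 3 *\<^sub>R tsgn g *\<^sub>R (X *v e))"
    by (rule arg_cong)
  then have "(1/3) *\<^sub>R (act g v - e) = tsgn g *\<^sub>R (g *v ((1/3) *\<^sub>R (v - e))) + tsgn g *\<^sub>R (X *v e)"
    by (simp only: matrix_vector_mult_scaleR scaleR_right_distrib) simp
  moreover have "int_vec (tsgn g *\<^sub>R (g *v ((1/3) *\<^sub>R (v - e))))"
    using v by (intro int_vec_scale[OF ts int_matrix_vec[OF Gam_int[OF g]]]) (simp add: walls_def e_def)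
  moreover have "int_vec (tsgn g *\<^sub>R (X *v e))"
    using g unfolding e_def by (intro int_vec_scale ts int_matrix_vec int_vec_axis) (simp add: Gam_def cong3_def X_def)
  ultimately have "int_vec ((1/3) *\<^sub>R (act g v - e))" by simp
  then show ?thesis using v by (simp add: walls_def act_lip[OF gS] e_def)
qed

text \<open>The half-open convention puts every point on exactly one side of each wall, also of a
  wall through it, such as the wall of the unit vector through \<open>e0\<close>. Additivity rests
  on this.\<close>

definition crossing :: "'d lvec \<Rightarrow> 'd lvec \<Rightarrow> 'd lvec set" where
  "crossing x y = {v \<in> walls. lip v x \<le> 0 \<and> 0 < lip v y}"

text \<open>The time coordinate of a separating wall is at most \<open>r\<close> times its spatial
  norm, where \<open>r < 1\<close> is the larger of the speeds of \<open>x\<close> and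
  \<open>y\<close>. Together with norm one this bounds the wall, which is integral.\<close>

lemma finite_crossing: assumes x: "forward x" and y: "forward y" shows "finite (crossing x y)"
proof -
  define r where "r = max (norm (spat x) / x $ None) (norm (spat y) / y $ None)"
  have pos: "x $ None > 0" "y $ None > 0" using x y by (auto simp: forward_iff)
  have "norm (spat x) / x $ None \<le> r" "norm (spat y) / y $ None \<le> r" by (simp_all add: r_def)
  then have rx: "norm (spat x) \<le> r * x $ None" "norm (spat y) \<le> r * y $ None"
    using pos by (simp_all add: divide_le_eq)
  have r1: "r < 1" using x y pos by (simp add: r_def forward_def)
  have "0 \<le> norm (spat x) / x $ None" using pos by simp
  then have r0: "0 \<le> r" unfolding r_def by linarith
  then have r2: "r\<^sup>2 < 1" using r1 by (simp add: abs_square_less_1)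
  have "crossing x y \<subseteq> {v. int_vec v \<and> (\<forall>i. \<bar>v $ i\<bar> \<le> 1 + 1 / (1 - r\<^sup>2))}"
  proof
    fix v assume v: "v \<in> crossing x y"
    define s where "s = norm (spat v)"
    have s: "s \<ge> 0" by (simp add: s_def)
    have vx: "spat v \<bullet> spat x \<le> v $ None * x $ None" and vy: "v $ None * y $ None < spat v \<bullet> spat y"
      using v by (simp_all add: crossing_def lip_spat)
    have v0: "\<bar>v $ None\<bar> \<le> r * s"
    proof (cases "v $ None \<ge> 0")
      case True
      have "v $ None * y $ None \<le> s * norm (spat y)" using vy norm_cauchy_schwarz[of "spat v" "spat y"] by (simp add: s_def)
      also have "\<dots> \<le> s * (r * y $ None)" using rx s by (intro mult_left_mono) auto
      finally have "v $ None * y $ None \<le> (r * s) * y $ None" by (simp add: mult_ac)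
      then have "v $ None \<le> r * s" using pos by (simp only: mult_le_cancel_right_pos)
      then show ?thesis using True by simp
    next
      case False
      have "- (v $ None) * x $ None \<le> - (spat v \<bullet> spat x)" using vx by simp
      also have "\<dots> \<le> s * norm (spat x)" using Cauchy_Schwarz_ineq2[of "spat v" "spat x"] by (simp add: s_def abs_le_iff)
      also have "\<dots> \<le> s * (r * x $ None)" using rx s by (intro mult_left_mono) auto
      finally have "(- (v $ None)) * x $ None \<le> (r * s) * x $ None" by (simp add: mult_ac)
      then have "- (v $ None) \<le> r * s" using pos by (simp only: mult_le_cancel_right_pos)
      then show ?thesis using False by simp
    qed
    have "lip v v = 1" using v by (simp add: crossing_def walls_def)
    then have ss: "s\<^sup>2 - (v $ None)\<^sup>2 = 1"
      by (simp only: lip_spat s_def power2_norm_eq_inner) (simp add: power2_eq_square)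
    have "\<bar>v $ None\<bar>\<^sup>2 \<le> (r * s)\<^sup>2" using v0 by (intro power_mono) auto
    then have "s\<^sup>2 * (1 - r\<^sup>2) \<le> 1" using ss by (simp add: power_mult_distrib algebra_simps)
    then have s2: "s\<^sup>2 \<le> 1 / (1 - r\<^sup>2)" using r2 by (simp add: pos_le_divide_eq)
    have "0 \<le> (s - 1)\<^sup>2 + s\<^sup>2 + 1" by simp
    then have "s \<le> 1 + s\<^sup>2" by (simp add: power2_eq_square algebra_simps)
    then have sB: "s \<le> 1 + 1 / (1 - r\<^sup>2)" using s2 by linarith
    have "\<bar>v $ i\<bar> \<le> s" for i
    proof (cases i)
      case (Some j) then show ?thesis using component_le_norm_cart[of "spat v" j] by (simp add: spat_def s_def)
    next
      case None
      have "r * s \<le> 1 * s" using r1 s by (intro mult_right_mono) auto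
      then show ?thesis using None v0 by simp
    qed
    then have "\<bar>v $ i\<bar> \<le> 1 + 1 / (1 - r\<^sup>2)" for i using sB order_trans by blast
    moreover have "int_vec v" using v walls_int by (simp add: crossing_def)
    ultimately show "v \<in> {v. int_vec v \<and> (\<forall>i. \<bar>v $ i\<bar> \<le> 1 + 1 / (1 - r\<^sup>2))}" by simp
  qed
  then show ?thesis by (rule finite_subset) (rule finite_int_vec_bounded)
qed

definition crossing_number :: "'d lvec \<Rightarrow> 'd lvec \<Rightarrow> int" where
  "crossing_number x y = int (card (crossing x y)) - int (card (crossing y x))"

text \<open>
  Being a sum of differences, the crossing number is additive, whether or not the walls intersect.
\<close>

lemma crossing_number_sum:
  assumes "finite W" "W \<subseteq> walls" "crossing x y \<subseteq> W" "crossing y x \<subseteq> W"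
  shows "crossing_number x y = (\<Sum>v\<in>W. of_bool (0 < lip v y) - of_bool (0 < lip v x))"
proof -
  have 1: "int (card X) = (\<Sum>v\<in>W. if v \<in> X then 1 else 0)" if "X \<subseteq> W" for X
    using that assms(1) by (simp add: sum.If_cases Int_absorb1)
  have "crossing_number x y = (\<Sum>v\<in>W. (if v \<in> crossing x y then 1 else 0) - (if v \<in> crossing y x then 1 else 0))"
    unfolding crossing_number_def 1[OF assms(3)] 1[OF assms(4)] by (rule sum_subtractf[symmetric])
  also have "\<dots> = (\<Sum>v\<in>W. of_bool (0 < lip v y) - of_bool (0 < lip v x))"
    using assms(2) by (intro sum.cong) (auto simp: crossing_def not_le)
  finally show ?thesis .
qed

lemma crossing_number_add:
  assumes "forward x" "forward y" "forward z"
  shows "crossing_number x z = crossing_number x y + crossing_number y z"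
proof -
  define W where "W = crossing x y \<union> crossing y x \<union> crossing y z \<union> crossing z y \<union> crossing x z \<union> crossing z x"
  have W: "finite W" "W \<subseteq> walls" using assms finite_crossing by (auto simp: W_def crossing_def)
  have "crossing_number x z = (\<Sum>v\<in>W. of_bool (0 < lip v z) - of_bool (0 < lip v x))"
    "crossing_number x y = (\<Sum>v\<in>W. of_bool (0 < lip v y) - of_bool (0 < lip v x))"
    "crossing_number y z = (\<Sum>v\<in>W. of_bool (0 < lip v z) - of_bool (0 < lip v y))"
    by (rule crossing_number_sum[OF W]; auto simp: W_def)+
  then show ?thesis by (simp add: sum_subtractf)
qed

lemma crossing_number_act:
  assumes g: "g \<in> Gam" shows "crossing_number (act g x) (act g y) = crossing_number x y"
proof -
  have gS: "g \<in> SO" and gi: "lorentz_inv g \<in> Gam" using Gam_SO Gam_inv g by auto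
  have inv: "act g (act (lorentz_inv g) v) = v" for v
    using act_mult[OF gS SO_inv(2)[OF gS], of v] by (simp add: lorentz_inv_right[OF gS] act_one)
  have inv': "act (lorentz_inv g) (act g v) = v" for v
    using act_mult[OF SO_inv(2)[OF gS] gS, of v] by (simp add: lorentz_inv_left[OF gS] act_one)
  have "crossing (act g x) (act g y) = act g ` crossing x y" for x y
  proof (intro subset_antisym subsetI)
    fix v assume v: "v \<in> crossing (act g x) (act g y)"
    have "lip (act (lorentz_inv g) v) z = lip v (act g z)" for z
      using act_lip[OF gS, of "act (lorentz_inv g) v" z] by (simp add: inv)
    then have "act (lorentz_inv g) v \<in> crossing x y"
      using v act_walls[OF gi] by (simp add: crossing_def)
    then show "v \<in> act g ` crossing x y" by (intro image_eqI[of _ _ "act (lorentz_inv g) v"]) (simp_all add: inv)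
  qed (use act_walls[OF g] in \<open>auto simp: crossing_def act_lip[OF gS]\<close>)
  moreover have "inj_on (act g) S" for S by (rule inj_on_inverseI[of _ "act (lorentz_inv g)"]) (rule inv')
  ultimately show ?thesis by (simp add: crossing_number_def card_image)
qed

definition phi :: "'d lmat \<Rightarrow> int" where
  "phi g = crossing_number e0 (act g e0)"

lemma phi_mult: assumes g: "g \<in> Gam" and h: "h \<in> Gam" shows "phi (g ** h) = phi g + phi h"
proof -
  have S: "g \<in> SO" "h \<in> SO" using Gam_SO g h by auto
  have f: "forward (act g (act h e0))" using forward_act_e0[OF SO_mult[OF S]] act_mult[OF S, of e0] by simp
  have "phi (g ** h) = crossing_number e0 (act g e0) + crossing_number (act g e0) (act g (act h e0))"
    unfolding phi_def act_mult[OF S] by (rule crossing_number_add[OF forward_e0 forward_act_e0[OF S(1)] f])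
  then show ?thesis by (simp add: crossing_number_act[OF g] phi_def)
qed

lemma phi_fix_e0: "act g e0 = e0 \<Longrightarrow> phi g = 0"
  by (simp add: phi_def crossing_number_def)

lemma phi_one: "phi (mat 1) = 0" by (rule phi_fix_e0) (simp add: act_one)

lemma phi_inv: assumes "g \<in> Gam" shows "phi (lorentz_inv g) = - phi g"
  using phi_mult[OF assms Gam_inv[OF assms]] phi_one by (simp add: lorentz_inv_right[OF Gam_SO[OF assms]])

text \<open>The eigenspace of \<open>tau\<close> for -1 is spanned by the unit vectors of
  \<open>Some i1\<close> and \<open>None\<close>, so it contains \<open>g *v e0\<close>. The
  integral coordinates satisfy \<open>b\<^sup>2 - a\<^sup>2 = 1\<close>, and factoring the left side
  forces \<open>a = 0\<close>.\<close>

lemma phi_centralizer: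
  assumes g: "g \<in> Gam" "g ** tau = tau ** g" shows "phi g = 0"
proof (rule phi_fix_e0)
  have gS: "g \<in> SO" using g Gam_SO by auto
  define y where "y = g *v e0"
  have te: "tau *v e0 = - e0" by (auto simp: vec_eq_iff tau_def sign_flip_mult_nth axis_def)
  have "tau *v y = g *v (tau *v e0)" using g(2) by (simp add: y_def matrix_vector_mul_assoc)
  also have "\<dots> = - y" using matrix_vector_mult_diff_distrib[of g 0 e0] by (simp add: te y_def)
  finally have ty: "tau *v y = - y" .
  have mid: "y $ Some i = 0" if "i \<noteq> i1" for i
  proof -
    have "(tau *v y) $ Some i = y $ Some i" using that by (simp add: tau_def sign_flip_mult_nth)
    then show ?thesis using ty by simp
  qed
  have "lip y y = - 1" unfolding y_def by (subst lip_SO[OF gS]) (simp add: lip_axis)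
  moreover have "(\<Sum>i\<in>- {i1}. y $ Some i * y $ Some i) = 0" using mid by (intro sum.neutral) auto
  ultimately have e: "(y $ Some i1)\<^sup>2 - (y $ None)\<^sup>2 = - 1"
    by (simp add: lip_expand sum_split_i1 power2_eq_square)
  have "int_vec y" unfolding y_def by (intro int_matrix_vec Gam_int g int_vec_axis)
  then have yi: "y $ Some i1 \<in> \<int>" "y $ None \<in> \<int>" by (simp_all add: int_vec_def)
  obtain a where a: "y $ Some i1 = of_int a" using yi(1) by (rule Ints_cases)
  obtain b where b: "y $ None = of_int b" using yi(2) by (rule Ints_cases)
  have "real_of_int (b\<^sup>2 - a\<^sup>2) = real_of_int 1" using e by (simp add: a b)
  then have "b\<^sup>2 - a\<^sup>2 = 1" by (simp only: of_int_eq_iff)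
  then have "(\<bar>b\<bar> - \<bar>a\<bar>) * (\<bar>b\<bar> + \<bar>a\<bar>) = 1" by (simp add: algebra_simps power2_eq_square)
  then have "\<bar>b\<bar> + \<bar>a\<bar> = 1 \<and> \<bar>b\<bar> - \<bar>a\<bar> = 1" by (smt (verit) zmult_eq_1_iff)
  then have a0: "a = 0" and b1: "\<bar>b\<bar> = 1" by linarith+
  have b0: "act g e0 $ None > 0" using forward_act_e0[OF gS] by (simp add: forward_iff)
  have ay: "act g e0 $ i = tsgn g * y $ i" for i by (simp add: act_def y_def)
  have "act g e0 $ i = e0 $ i" for i
  proof (cases i)
    case None
    have "\<bar>y $ None\<bar> = 1" using b1 by (simp add: b flip: of_int_abs)
    then have "\<bar>act g e0 $ None\<bar> = 1" using tsgn_cases[OF gS] by (auto simp: ay abs_mult)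
    then show ?thesis using None b0 by (simp add: axis_def)
  next
    case (Some j)
    then have "y $ i = 0" using mid[of j] a0 a by (cases "j = i1") auto
    then show ?thesis using Some by (simp add: ay) (simp add: axis_def)
  qed
  then show "act g e0 = e0" by (simp add: vec_eq_iff)
qed

end

text \<open>
  The Gram determinant of the three vectors \<open>v\<close>, \<open>e\<close> and \<open>gam e\<close>, where \<open>e\<close> is the unit vector of
  \<open>Some i1\<close>, has the wrong sign if \<open>v\<close> has products \<open>- a\<close> and \<open>- b\<close> with the others, whose product
  is \<open>55\<close>.
\<close>

lemma no_separating_wall_arith:
  fixes a b u y :: real
  assumes "a \<ge> 8" "b \<ge> 8" "u > 0" and y: "y\<^sup>2 \<le> u\<^sup>2 + 1 - a\<^sup>2"
    and b: "b = 55 * a - 24 * y - 60 * u" "a \<le> 55 * b"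
  shows False
proof -
  define c where "c = 24 * y + 60 * u"
  have cb: "c = 55 * a - b" by (simp add: c_def b)
  have "8 * 8 \<le> a * a" using assms(1) by (intro mult_mono) auto
  then have "y\<^sup>2 < u\<^sup>2" using y by (simp add: power2_eq_square)
  then have "\<bar>y\<bar> < u" using assms(3) by (intro power2_less_imp_less[of "\<bar>y\<bar>" u]) auto
  \<comment> \<open>This says \<open>b < 55 * a\<close>. With \<open>a \<le> 55 * b\<close> it
    excludes the positions of \<open>v\<close> outside the strip between the two walls, where the
    Gram determinant alone would give no contradiction.\<close>
  then have c0: "c > 0" unfolding c_def by linarith
  \<comment> \<open>Completing the square gives the reversed Cauchy-Schwarz inequality for
    \<open>60 * u + 24 * y\<close>; here
    \<open>3024 = 60\<^sup>2 - 24\<^sup>2 = 55\<^sup>2 - 1\<close>.\<close>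
  have "(3024 * y + 24 * c)\<^sup>2 - 3600 * c\<^sup>2 + 3024 * 3600 * (a\<^sup>2 - 1) = 3024 * 3600 * (y\<^sup>2 - (u\<^sup>2 + 1 - a\<^sup>2))"
    by (simp add: c_def power2_eq_square algebra_simps)
  also have "\<dots> \<le> 0" using y by simp
  finally have "3600 * (3024 * (a\<^sup>2 - 1)) \<le> 3600 * c\<^sup>2" using zero_le_power2[of "3024 * y + 24 * c"] by linarith
  then have c2: "3024 * (a\<^sup>2 - 1) \<le> c\<^sup>2" by simp
  \<comment> \<open>Indeed \<open>55 * c = 3025 * a - 55 * b\<close>, which is at most
    \<open>3024 * a\<close>.\<close>
  have "(55 * c)\<^sup>2 \<le> (3024 * a)\<^sup>2" using cb b(2) c0 by (intro power_mono) auto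
  then have "3025 * c\<^sup>2 \<le> 3024 * (3024 * a\<^sup>2)" by (simp add: power_mult_distrib)
  then have "a\<^sup>2 \<le> 55\<^sup>2" using c2 by simp
  then have a55: "a \<le> 55" by (rule power2_le_imp_le) simp
  have "c\<^sup>2 \<le> (55 * a - 8)\<^sup>2" using cb c0 assms(2) by (intro power_mono) auto
  then have "3024 * (a\<^sup>2 - 1) \<le> (55 * a - 8)\<^sup>2" using c2 by linarith
  then have "0 \<le> a\<^sup>2 - 880 * a + 3088" by (simp add: power2_eq_square algebra_simps)
  \<comment> \<open>The chord bound \<open>a\<^sup>2 \<le> 63 * a - 440\<close> makes the quadratic
    negative on the whole interval from 8 to 55.\<close>
  moreover have "(a - 8) * (a - 55) \<le> 0" using assms(1) a55 by (intro mult_nonneg_nonpos) auto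
  ultimately show False using assms(1) by (simp add: power2_eq_square algebra_simps)
qed

context lorentz_frame
begin

subsection \<open>An element crossing a wall\<close>

text \<open>
  In the coordinates \<open>i1, i2, None\<close> this is the integral matrix with rows \<open>(55, 120, 132)\<close>,
  \<open>(24, 55, 60)\<close>, \<open>(60, 132, 145)\<close>, written in its \<open>N\<^sup>- A N\<close> decomposition, which
  makes the determinant evident.
\<close>

definition gam :: "'d lmat" where
  "gam = Eichler nu' ((3/14) *\<^sub>R axis (Some i2) 1) ** Boost nu nu' 196 ** Eichler nu ((- 9/14) *\<^sub>R axis (Some i2) 1)"

lemma gam_nth:
  "(gam *v x) $ Some i1 = 55 * x $ Some i1 + 120 * x $ Some i2 + 132 * x $ None"
  "(gam *v x) $ Some i2 = 24 * x $ Some i1 + 55 * x $ Some i2 + 60 * x $ None"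
  "(gam *v x) $ None = 60 * x $ Some i1 + 132 * x $ Some i2 + 145 * x $ None"
  "i \<noteq> i1 \<Longrightarrow> i \<noteq> i2 \<Longrightarrow> (gam *v x) $ Some i = x $ Some i"
proof -
  have l: "lip (axis (Some i2) 1) (axis (Some i2) 1) = 1" by (simp add: lip_axis)
  define y where "y = eichler nu ((- 9/14) *\<^sub>R axis (Some i2) 1) x"
  define z where "z = boost nu nu' 196 y"
  have y: "y $ i = x $ i + (x $ Some i1 - x $ None) * (- 9/14 * axis (Some i2) 1 $ i)
      + (9/14 * x $ Some i2 - 81/392 * (x $ Some i1 - x $ None)) * nu $ i" for i
    by (simp add: y_def eichler_def lip_scale lip_minus lip_axis l lip_nu algebra_simps)
  have z: "z $ i = y $ i + 195/2 * (y $ Some i1 + y $ None) * nu $ i - 195/392 * (y $ Some i1 - y $ None) * nu' $ i" for i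
    by (simp add: z_def boost_def lip_nu algebra_simps)
  have gz: "gam *v x = eichler nu' ((3/14) *\<^sub>R axis (Some i2) 1) z"
    by (simp only: gam_def matrix_vector_mul_assoc[symmetric] Eichler_works Boost_works y_def z_def)
  have g: "(gam *v x) $ i = z $ i + (z $ Some i1 + z $ None) * (3/14 * axis (Some i2) 1 $ i)
      - (3/14 * z $ Some i2 + 9/392 * (z $ Some i1 + z $ None)) * nu' $ i" for i
    by (simp add: gz eichler_def lip_scale lip_axis l lip_nu algebra_simps)
  have y': "y $ Some i1 = x $ Some i1 + 9/14 * x $ Some i2 - 81/392 * (x $ Some i1 - x $ None)"
    "y $ Some i2 = x $ Some i2 - 9/14 * (x $ Some i1 - x $ None)"
    "y $ None = x $ None + 9/14 * x $ Some i2 - 81/392 * (x $ Some i1 - x $ None)"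
    using i12 by (simp_all add: y nu_nth axis_def)
  have z': "z $ Some i1 = y $ Some i1 + 195/2 * (y $ Some i1 + y $ None) - 195/392 * (y $ Some i1 - y $ None)"
    "z $ Some i2 = y $ Some i2"
    "z $ None = y $ None + 195/2 * (y $ Some i1 + y $ None) + 195/392 * (y $ Some i1 - y $ None)"
    using i12 by (simp_all add: z nu_nth)
  have g': "(gam *v x) $ Some i1 = z $ Some i1 - (3/14 * z $ Some i2 + 9/392 * (z $ Some i1 + z $ None))"
    "(gam *v x) $ Some i2 = z $ Some i2 + 3/14 * (z $ Some i1 + z $ None)"
    "(gam *v x) $ None = z $ None + (3/14 * z $ Some i2 + 9/392 * (z $ Some i1 + z $ None))"
    using i12 by (simp_all add: g nu_nth axis_def)
  show "(gam *v x) $ Some i1 = 55 * x $ Some i1 + 120 * x $ Some i2 + 132 * x $ None"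
    "(gam *v x) $ Some i2 = 24 * x $ Some i1 + 55 * x $ Some i2 + 60 * x $ None"
    "(gam *v x) $ None = 60 * x $ Some i1 + 132 * x $ Some i2 + 145 * x $ None"
    unfolding g' z' y' by (simp_all add: field_simps)
  show "(gam *v x) $ Some i = x $ Some i" if "i \<noteq> i1" "i \<noteq> i2"
    using that by (simp add: g z y nu_nth axis_def)
qed

lemma gam_SO: "gam \<in> SO"
proof -
  have "horo (c *\<^sub>R axis (Some i2) 1)" for c using i12 by (simp add: horo_def axis_def)
  then show ?thesis unfolding gam_def
    by (intro SO_mult Boost_nu Eichler_SO) (simp_all add: horo_lip lip_nu_nu del: scaleR_minus_left)
qed

lemma gam_time: "gam $ None $ None = 145"
  using gam_nth(3)[of e0] by (simp add: matrix_axis_nth) (simp add: axis_def)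

lemma tsgn_gam: "tsgn gam = 1" by (simp add: tsgn_def gam_time)

lemma gam_Gam: "gam \<in> Gam"
proof -
  have "((1/3) *\<^sub>R (gam - mat 1)) $ i $ j \<in> \<int>" for i j
  proof -
    have e: "gam $ i $ j - (mat 1 :: 'd lmat) $ i $ j = (gam *v axis j 1) $ i - axis j 1 $ i"
      by (simp only: matrix_axis_nth) (simp add: mat_def axis_def)
    consider "i = Some i1" | "i = Some i2" | "i = None" | k where "i = Some k" "k \<noteq> i1" "k \<noteq> i2"
      by (cases i) auto
    then have "\<exists>k::int. (gam *v axis j 1) $ i - axis j 1 $ i = 3 * of_int k"
    proof cases
      case 1 then show ?thesis
        using i12 by (cases "j = Some i1"; cases "j = Some i2"; cases "j = None")
          (auto simp: gam_nth axis_def intro: exI[of _ 18] exI[of _ 40] exI[of _ 44] exI[of _ 0])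
    next
      case 2 then show ?thesis
        using i12 by (cases "j = Some i1"; cases "j = Some i2"; cases "j = None")
          (auto simp: gam_nth axis_def intro: exI[of _ 8] exI[of _ 18] exI[of _ 20] exI[of _ 0])
    next
      case 3 then show ?thesis
        using i12 by (cases "j = Some i1"; cases "j = Some i2"; cases "j = None")
          (auto simp: gam_nth axis_def intro: exI[of _ 20] exI[of _ 44] exI[of _ 48] exI[of _ 0])
    next
      case 4 then show ?thesis by (simp add: gam_nth)
    qed
    then show ?thesis using e by auto
  qed
  then show ?thesis using gam_SO by (simp add: Gam_def res_def tsgn_gam cong3_def int_matrix_def)
qed

text \<open>Write \<open>v\<close> as the unit vector plus \<open>3 *\<^sub>R y\<close>. Norm one
  gives \<open>2 * y $ Some i1 = - 3 * lip y y\<close>, so three divides \<open>y $ Some i1\<close>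
  and the coordinate of \<open>v\<close> is one modulo nine.\<close>

lemma wall_coordinate: assumes "v \<in> walls" shows "v $ Some i1 \<ge> 1 \<or> v $ Some i1 \<le> - 8"
proof -
  define y where "y = (1/3) *\<^sub>R (v - axis (Some i1) 1)"
  have y: "int_vec y" "lip v v = 1" using assms by (simp_all add: walls_def y_def)
  have v: "v = axis (Some i1) 1 + 3 *\<^sub>R y" by (simp add: y_def)
  have l: "lip (axis (Some i1) 1) y = y $ Some i1" "lip y (axis (Some i1) 1) = y $ Some i1"
    by (simp_all add: lip_sym[of "axis (Some i1) 1" y] lip_axis)
  have "lip v v = 1 + 6 * y $ Some i1 + 9 * lip y y"
    unfolding v by (simp add: lip_add lip_scale l) (simp add: lip_axis)
  then have e: "2 * y $ Some i1 = - 3 * lip y y" using y by simp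
  have yi: "y $ Some i1 \<in> \<int>" "lip y y \<in> \<int>" using y(1) int_vec_lip by (auto simp: int_vec_def)
  obtain k where k: "y $ Some i1 = of_int k" using yi(1) by (rule Ints_cases)
  obtain l where l: "lip y y = of_int l" using yi(2) by (rule Ints_cases)
  have "real_of_int (2 * k) = real_of_int (- 3 * l)" using e by (simp add: k l)
  then have "2 * k = - 3 * l" by (simp only: of_int_eq_iff)
  then have "k \<ge> 0 \<or> k \<le> - 3" by presburger
  then have "real_of_int k \<ge> 0 \<or> real_of_int k \<le> - 3" by linarith
  moreover have "v $ Some i1 = 1 + 3 * of_int k" unfolding v by (simp add: k axis_def)
  ultimately show ?thesis by linarith
qed

lemma wall_coordinates_le: assumes "v \<in> walls"
  shows "(v $ Some i2)\<^sup>2 \<le> (v $ None)\<^sup>2 + 1 - (v $ Some i1)\<^sup>2"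
proof -
  have "(v $ Some i2)\<^sup>2 \<le> (\<Sum>i\<in>- {i1}. (v $ Some i)\<^sup>2)"
    using i12 by (intro member_le_sum) auto
  then show ?thesis using assms by (simp add: walls_def lip_expand sum_split_i1 power2_eq_square)
qed

text \<open>The wall of the unit vector is crossed in the positive direction and no wall in the
  negative one, so nothing cancels.\<close>

lemma phi_gam: "phi gam > 0"
proof -
  have act: "act gam x = gam *v x" for x by (simp add: act_def tsgn_gam)
  have "crossing (gam *v e0) e0 = {}"
  proof (rule ccontr)
    assume "crossing (gam *v e0) e0 \<noteq> {}"
    then obtain v where v: "v \<in> walls" and neg: "lip v (gam *v e0) \<le> 0" and "0 < lip v e0"
      by (auto simp: crossing_def)
    then have v0: "v $ None < 0" by (simp add: lip_axis)
    \<comment> \<open>Pulling back by \<open>gam\<close> turns products of \<open>v\<close> with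
      images under \<open>gam\<close> into coordinates of \<open>w\<close>. As \<open>w\<close> is
      again a wall, the gap between -8 and 1 applies to both.\<close>
    define w where "w = act (lorentz_inv gam) v"
    have w: "w \<in> walls" unfolding w_def by (rule act_walls[OF Gam_inv[OF gam_Gam] v])
    have gw: "gam *v w = v"
      by (simp add: w_def act_def tsgn_inv tsgn_gam matrix_vector_mul_assoc lorentz_inv_right[OF gam_SO])
    have wl: "lip w x = lip v (gam *v x)" for x using lip_SO[OF gam_SO, of w x] gw by simp
    have w0: "w $ None \<ge> 0" using neg wl[of e0] by (simp add: lip_axis)
    \<comment> \<open>The time coordinate therefore dominates the linear expressions below, and the
      signs of the time coordinates exclude a value of at least 1 at \<open>Some i1\<close>.\<close>
    have small: "\<bar>x $ Some i2\<bar> \<le> \<bar>x $ None\<bar>" if x: "x \<in> walls" for x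
    proof -
      have "\<bar>x $ Some i1\<bar> \<ge> 1" using wall_coordinate[OF x] by auto
      then have "1\<^sup>2 \<le> \<bar>x $ Some i1\<bar>\<^sup>2" by (intro power_mono) auto
      then have "(x $ Some i2)\<^sup>2 \<le> (x $ None)\<^sup>2" using wall_coordinates_le[OF x] by simp
      then show ?thesis by (simp add: abs_le_square_iff)
    qed
    have v_w: "v $ Some i1 = 55 * w $ Some i1 + 120 * w $ Some i2 + 132 * w $ None"
      "v $ None = 60 * w $ Some i1 + 132 * w $ Some i2 + 145 * w $ None"
      using gam_nth(1,3)[of w] by (simp_all add: gw)
    have w1: "w $ Some i1 = 55 * v $ Some i1 + 24 * v $ Some i2 - 60 * v $ None"
    proof -
      have "gam *v axis (Some i1) 1 = 55 *\<^sub>R axis (Some i1) 1 + 24 *\<^sub>R axis (Some i2) 1 + 60 *\<^sub>R e0"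
        unfolding vec_eq_iff
      proof
        fix i
        show "(gam *v axis (Some i1) 1) $ i = (55 *\<^sub>R axis (Some i1) 1 + 24 *\<^sub>R axis (Some i2) 1 + 60 *\<^sub>R e0) $ i"
        proof (cases i)
          case (Some j) then show ?thesis
            using i12 by (cases "j = i1"; cases "j = i2") (auto simp: gam_nth axis_def)
        qed (use i12 in \<open>simp add: gam_nth axis_def\<close>)
      qed
      then show ?thesis using wl[of "axis (Some i1) 1"] by (simp add: lip_axis lip_add lip_scale)
    qed
    have "132 * v $ Some i1 + 60 * v $ Some i2 - 145 * v $ None \<le> 0"
    proof -
      have "gam *v e0 = 132 *\<^sub>R axis (Some i1) 1 + 60 *\<^sub>R axis (Some i2) 1 + 145 *\<^sub>R e0"
        unfolding vec_eq_iff
      proof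
        fix i
        show "(gam *v e0) $ i = (132 *\<^sub>R axis (Some i1) 1 + 60 *\<^sub>R axis (Some i2) 1 + 145 *\<^sub>R e0) $ i"
        proof (cases i)
          case (Some j) then show ?thesis
            using i12 by (cases "j = i1"; cases "j = i2") (auto simp: gam_nth axis_def)
        qed (use i12 in \<open>simp add: gam_nth axis_def\<close>)
      qed
      then show ?thesis using neg by (simp add: lip_axis lip_add lip_scale)
    qed
    then have "\<not> v $ Some i1 \<ge> 1" using small[OF v] v0 by linarith
    then have a: "- (v $ Some i1) \<ge> 8" using wall_coordinate[OF v] by auto
    have "\<not> w $ Some i1 \<ge> 1" using small[OF w] w0 v0 v_w(2) by linarith
    then have b: "- (w $ Some i1) \<ge> 8" using wall_coordinate[OF w] by auto
    have le: "- (v $ Some i1) \<le> 55 * - (w $ Some i1)" using small[OF w] w0 v_w(1) by linarith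
    show False
      by (rule no_separating_wall_arith[OF a b, of "- (v $ None)" "v $ Some i2"])
        (use v0 w1 le wall_coordinates_le[OF v] in auto)
  qed
  moreover have "axis (Some i1) 1 \<in> crossing e0 (gam *v e0)"
  proof -
    have "axis (Some i1) 1 \<in> walls" by (simp add: walls_def lip_axis)
    moreover have "lip (axis (Some i1) 1) (gam *v e0) = 132"
      unfolding lip_sym[of "axis (Some i1) 1"] lip_axis gam_nth using i12 by (simp add: axis_def)
    ultimately show ?thesis by (simp add: crossing_def lip_axis) (simp add: axis_def)
  qed
  moreover have "finite (crossing e0 (gam *v e0))"
    using finite_crossing[OF forward_e0 forward_act_e0[OF gam_SO]] by (simp add: act)
  ultimately show ?thesis
    by (auto simp: phi_def act crossing_number_def card_gt_0_iff)
qed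

lemma phi_generator:
  obtains t where "t \<in> Gam" "phi t > 0" "\<And>g. g \<in> Gam \<Longrightarrow> phi t dvd phi g"
proof -
  define P where "P k \<longleftrightarrow> k > 0 \<and> (\<exists>g\<in>Gam. phi g = int k)" for k
  have "P (nat (phi gam))" using phi_gam gam_Gam by (auto simp: P_def)
  define m where "m = (LEAST k. P k)"
  have "P m" unfolding m_def by (rule LeastI[of P, OF \<open>P (nat (phi gam))\<close>])
  then obtain t where t: "t \<in> Gam" "phi t = int m" "m > 0" by (auto simp: P_def)
  have mult: "\<exists>h\<in>Gam. phi h = k * int m" for k
  proof (induction k rule: int_induct[where k=0])
    case base then show ?case using Gam_one phi_one by auto
  next
    case (step1 i)
    then obtain h where "h \<in> Gam" "phi h = i * int m" by blast
    then show ?case using t by (intro bexI[of _ "h ** t"]) (simp_all add: phi_mult Gam_mult algebra_simps)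
  next
    case (step2 i)
    then obtain h where "h \<in> Gam" "phi h = i * int m" by blast
    then show ?case using t by (intro bexI[of _ "h ** lorentz_inv t"])
        (simp_all add: phi_mult phi_inv Gam_mult Gam_inv algebra_simps)
  qed
  have "int m dvd phi g" if g: "g \<in> Gam" for g
  proof (rule ccontr)
    assume "\<not> int m dvd phi g"
    then have pos: "phi g mod int m > 0" using t(3) by (simp add: dvd_eq_mod_eq_0 order.not_eq_order_implies_strict)
    obtain h where h: "h \<in> Gam" "phi h = - (phi g div int m) * int m" using mult by blast
    have "phi (g ** h) = phi g mod int m"
      using h by (simp add: phi_mult g minus_mult_div_eq_mod[symmetric] mult.commute)
    then have "P (nat (phi g mod int m))" using pos Gam_mult[OF g h(1)] unfolding P_def by auto
    then have "m \<le> nat (phi g mod int m)" unfolding m_def by (rule Least_le)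
    then show False using pos_mod_bound[of "int m" "phi g"] t(3) by linarith
  qed
  then show thesis using that t by simp
qed

end

text \<open>Two integral elements with the same time sign and the same residues modulo three differ
  by an element of \<open>Gam\<close>, so finitely many translates of the covering set for the
  integral matrices serve for \<open>Gam\<close>.\<close>

lemma (in so_haar) covolume_Gam_finite: "covolume SO_d_1 \<mu> Gam < \<infinity>"
proof -
  let ?Z = "{\<gamma> :: 'd lmat. \<gamma> \<in> SO \<and> int_matrix \<gamma>}"
  define key where "key \<gamma> = (tsgn \<gamma>, (\<chi> i j. \<gamma> $ i $ j - 3 * of_int \<lfloor>\<gamma> $ i $ j / 3\<rfloor>))"
    for \<gamma> :: "'d lmat"
  have "key ` ?Z \<subseteq> {1, - 1} \<times> {A. int_matrix A \<and> (\<forall>i j. \<bar>A $ i $ j\<bar> \<le> 3)}"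
  proof
    fix q assume "q \<in> key ` ?Z"
    then obtain \<gamma> where \<gamma>: "\<gamma> \<in> SO" "int_matrix \<gamma>" "q = key \<gamma>" by auto
    have "\<bar>\<gamma> $ i $ j - 3 * of_int \<lfloor>\<gamma> $ i $ j / 3\<rfloor>\<bar> \<le> 3" for i j by linarith
    then show "q \<in> {1, - 1} \<times> {A. int_matrix A \<and> (\<forall>i j. \<bar>A $ i $ j\<bar> \<le> 3)}"
      using \<gamma> tsgn_cases[OF \<gamma>(1)] by (auto simp: key_def int_matrix_def)
  qed
  then have "finite (key ` ?Z)" by (rule finite_subset) (simp add: finite_int_matrix_bounded)
  then obtain R where R: "R \<subseteq> ?Z" "finite R" "key ` ?Z = key ` R" using finite_subset_image[of "key ` ?Z" key ?Z] by blast
  have rep: "\<exists>r\<in>R. \<gamma> ** lorentz_inv r \<in> Gam" if \<gamma>: "\<gamma> \<in> SO" "int_matrix \<gamma>" for \<gamma>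
  proof -
    obtain r where r: "r \<in> R" "key \<gamma> = key r" using R(3) \<gamma> by (metis (mono_tags, lifting) imageE imageI mem_Collect_eq)
    have rS: "r \<in> SO" "int_matrix r" using r R by auto
    have k: "tsgn \<gamma> = tsgn r" "\<And>i j. \<gamma> $ i $ j - 3 * of_int \<lfloor>\<gamma> $ i $ j / 3\<rfloor> = r $ i $ j - 3 * of_int \<lfloor>r $ i $ j / 3\<rfloor>"
      using r(2) by (auto simp: key_def vec_eq_iff)
    have "((1/3) *\<^sub>R (\<gamma> - r)) $ i $ j = of_int (\<lfloor>\<gamma> $ i $ j / 3\<rfloor> - \<lfloor>r $ i $ j / 3\<rfloor>)" for i j
      using k(2)[of i j] by simp
    then have "cong3 \<gamma> r" unfolding cong3_def int_matrix_def by (metis Ints_of_int)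
    then have "cong3 (\<gamma> ** lorentz_inv r) (r ** lorentz_inv r)"
      using \<gamma> rS by (intro cong3_mult cong3_refl int_matrix_lorentz_inv)
    then have "cong3 (\<gamma> ** lorentz_inv r) (mat 1)" by (simp add: lorentz_inv_right[OF rS(1)])
    moreover have "tsgn (\<gamma> ** lorentz_inv r) = 1"
      using tsgn_cases[OF rS(1)] by (auto simp: tsgn_mult[OF \<gamma>(1) SO_inv(2)[OF rS(1)]] tsgn_inv k(1))
    ultimately have "\<gamma> ** lorentz_inv r \<in> Gam"
      using \<gamma> rS by (simp add: Gam_def res_def SO_mult SO_inv)
    then show ?thesis using r(1) by blast
  qed
  obtain S where S: "S \<in> sets borel" "emeasure haar_ext S < \<infinity>"
    "\<And>g. g \<in> SO \<Longrightarrow> \<exists>\<gamma>\<in>SO. int_matrix \<gamma> \<and> g ** \<gamma> \<in> S" using finite_measure_covering by blast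
  define T where "T r = (\<lambda>x. x ** lorentz_inv r) ` S" for r
  have T: "T r \<in> sets borel" "emeasure haar_ext (T r) = emeasure haar_ext S" if "r \<in> R" for r
    using that R right_translate[OF SO_inv(2) S(1), of r] by (auto simp: T_def)
  show ?thesis
  proof (rule covolume_finite[OF Gam_subgroup Gam_int, of "\<Union>r\<in>R. T r"])
    show "(\<Union>r\<in>R. T r) \<in> sets borel" using T R by auto
    have "emeasure haar_ext (\<Union>r\<in>R. T r) \<le> (\<Sum>r\<in>R. emeasure haar_ext (T r))"
      using T R by (intro emeasure_subadditive_finite) (auto simp: sets_haar_ext)
    also have "\<dots> < \<infinity>"
    proof -
      have "emeasure haar_ext (T r) < \<infinity>" if "r \<in> R" for r using T(2)[OF that] S(2) by simp
      then show ?thesis using R(2) by simp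
    qed
    finally show "emeasure haar_ext (\<Union>r\<in>R. T r) < \<infinity>" .
    fix g :: "'d lmat" assume "g \<in> SO"
    then obtain \<gamma> where \<gamma>: "\<gamma> \<in> SO" "int_matrix \<gamma>" "g ** \<gamma> \<in> S" using S(3) by blast
    obtain r where r: "r \<in> R" "\<gamma> ** lorentz_inv r \<in> Gam" using rep[OF \<gamma>(1,2)] by blast
    have "g ** (\<gamma> ** lorentz_inv r) \<in> T r" using \<gamma>(3) by (auto simp: T_def matrix_mul_assoc)
    then show "\<exists>\<gamma>\<in>Gam. g ** \<gamma> \<in> (\<Union>r\<in>R. T r)" using r by blast
  qed
qed

lemma discrete_int_matrices:
  fixes \<Gamma> :: "(real ^ 'n ^ 'm) set"
  assumes "\<And>\<gamma>. \<gamma> \<in> \<Gamma> \<Longrightarrow> int_matrix \<gamma>" shows "discrete \<Gamma>"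
proof (rule discreteI)
  fix x assume x: "x \<in> \<Gamma>"
  have "ball x 1 \<inter> \<Gamma> = {x}"
  proof (intro subset_antisym subsetI)
    fix y assume y: "y \<in> ball x 1 \<inter> \<Gamma>"
    then have "x - y = 0"
      using int_matrix_norm_less_one[OF int_matrix_diff] x assms by (auto simp: dist_norm)
    then show "y \<in> {x}" by simp
  qed (use x in auto)
  then show "x isolated_in \<Gamma>" using x unfolding isolated_in_def by (intro conjI exI[of _ "ball x 1"]) auto
qed

subsection \<open>Maximal finite subgroups\<close>

lemma subgroup_SO_conjugate:
  fixes F :: "('d::finite) lmat set"
  assumes F: "subgroup F SO_d_1" and h: "h \<in> SO"
  shows "subgroup ((\<lambda>x. lorentz_inv h ** x ** h) ` F) SO_d_1"
proof (rule group.subgroupI[OF group_SO_d_1])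
  have FS: "x \<in> SO" if "x \<in> F" for x using subgroup.subset[OF F] that by auto
  show "(\<lambda>x. lorentz_inv h ** x ** h) ` F \<subseteq> SO"
    using FS h by (auto intro!: SO_mult SO_inv)
  show "(\<lambda>x. lorentz_inv h ** x ** h) ` F \<noteq> {}" using subgroup.one_closed[OF F] by blast
  fix a assume "a \<in> (\<lambda>x. lorentz_inv h ** x ** h) ` F"
  then obtain x where x: "x \<in> F" "a = lorentz_inv h ** x ** h" by auto
  have aS: "a \<in> SO" unfolding x by (intro SO_mult SO_inv h FS x)
  have "lorentz_inv a = lorentz_inv h ** lorentz_inv x ** h"
    by (simp add: x(2) lorentz_inv_mult lorentz_inv_involution matrix_mul_assoc)
  moreover have "lorentz_inv x \<in> F" using subgroup.m_inv_closed[OF F x(1)] SO_inv(1)[OF FS[OF x(1)]] by simp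
  ultimately show "inv\<^bsub>SO_d_1\<^esub> a \<in> (\<lambda>x. lorentz_inv h ** x ** h) ` F" by (simp add: SO_inv(1)[OF aS])
  fix b assume "b \<in> (\<lambda>x. lorentz_inv h ** x ** h) ` F"
  then obtain y where y: "y \<in> F" "b = lorentz_inv h ** y ** h" by auto
  have "a ** b = lorentz_inv h ** x ** (h ** lorentz_inv h) ** y ** h"
    by (simp only: x y matrix_mul_assoc)
  also have "\<dots> = lorentz_inv h ** (x ** y) ** h" by (simp add: lorentz_inv_right[OF h] matrix_mul_assoc)
  finally have "a ** b = lorentz_inv h ** (x ** y) ** h" .
  moreover have "x ** y \<in> F" using subgroup.m_closed[OF F x(1) y(1)] by simp
  ultimately show "a \<otimes>\<^bsub>SO_d_1\<^esub> b \<in> (\<lambda>x. lorentz_inv h ** x ** h) ` F" by simp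
qed

context so_haar
begin

lemma phi_pow: "t \<in> Gam \<Longrightarrow> t [^]\<^bsub>SO_d_1\<^esub> (k::nat) \<in> Gam \<and> phi (t [^]\<^bsub>SO_d_1\<^esub> k) = int k * phi t"
  by (induction k) (simp_all add: Gam_one phi_one Gam_mult phi_mult algebra_simps)

definition phi_kernel :: "int \<Rightarrow> 'd lmat set" where
  "phi_kernel N = {g \<in> Gam. N dvd phi g}"

lemma phi_kernel_subgroup: "subgroup (phi_kernel N) SO_d_1"
  by (rule group.subgroupI[OF group_SO_d_1])
    (use Gam_one phi_one Gam_SO in \<open>auto simp: phi_kernel_def SO_inv(1)[OF Gam_SO] Gam_inv phi_inv phi_mult Gam_mult\<close>)

lemma phi_kernel_subset: "phi_kernel N \<subseteq> Gam" by (auto simp: phi_kernel_def)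

abbreviation tau_conj :: "'d lmat \<Rightarrow> 'd lmat" where
  "tau_conj p \<equiv> p ** tau ** lorentz_inv p"

text \<open>Conjugating back by \<open>p\<close> gives a finite subgroup of \<open>Gam\<close>
  containing \<open>tau\<close>. Maximality holds within \<open>Gam\<close>, so \<open>p\<close> may
  lie outside the smaller group.\<close>

lemma tau_conj_maximal:
  assumes p: "p \<in> Gam" and N: "tau_conj p \<in> phi_kernel N"
  shows "{mat 1, tau_conj p} \<in> maximal_finite_subgroups (SO_d_1\<lparr>carrier := phi_kernel N\<rparr>)"
proof -
  interpret group "SO_d_1 :: 'd lmat monoid" by (rule group_SO_d_1)
  have pS: "p \<in> SO" by (rule Gam_SO[OF p])
  have unconj: "p ** (lorentz_inv p ** x ** p) ** lorentz_inv p = x" for x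
    using SO_inv_mult_cancel[OF pS] by (simp add: matrix_mul_assoc)
  have max: "K = {mat 1, tau_conj p}" if K: "subgroup K SO_d_1" "finite K" "K \<subseteq> Gam" "tau_conj p \<in> K" for K
  proof -
    let ?K = "(\<lambda>x. lorentz_inv p ** x ** p) ` K"
    have "?K = {mat 1, tau}"
    proof (rule finite_subgroup_containing_tau)
      show "subgroup ?K SO_d_1" by (rule subgroup_SO_conjugate[OF K(1) pS])
      show "?K \<subseteq> Gam" using K(3) p by (auto intro!: Gam_mult Gam_inv)
      have "lorentz_inv p ** tau_conj p ** p = tau"
        by (simp only: matrix_mul_assoc[symmetric] SO_inv_mult_cancel(1)[OF pS] lorentz_inv_left[OF pS] matrix_mul_rid)
      then show "tau \<in> ?K" using K(4) by (intro image_eqI[of _ _ "tau_conj p"]) simp_all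
    qed (use K in simp)
    have "K = (\<lambda>x. p ** x ** lorentz_inv p) ` ?K" unfolding image_image unconj by simp
    also have "\<dots> = {mat 1, tau_conj p}" unfolding \<open>?K = _\<close> by (simp add: lorentz_inv_right[OF pS])
    finally show ?thesis .
  qed
  have "subgroup {mat 1, tau_conj p} SO_d_1"
  proof -
    have "subgroup {mat 1, tau} SO_d_1"
      by (rule subgroupI) (auto simp: SO_one tau_SO tau_square SO_inv lorentz_inv_one tau_inv)
    from subgroup_SO_conjugate[OF this SO_inv(2)[OF pS]]
    show ?thesis by (simp add: lorentz_inv_involution lorentz_inv_right[OF pS])
  qed
  moreover have "{mat 1, tau_conj p} \<subseteq> phi_kernel N"
    using N subgroup.one_closed[OF phi_kernel_subgroup[of N]] by simp
  ultimately have "subgroup {mat 1, tau_conj p} (SO_d_1\<lparr>carrier := phi_kernel N\<rparr>)"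
    by (intro subgroup_incl phi_kernel_subgroup)
  moreover have "finite {mat 1, tau_conj p}" by simp
  moreover have "K = {mat 1, tau_conj p}"
    if "subgroup K (SO_d_1\<lparr>carrier := phi_kernel N\<rparr>)" "finite K" "{mat 1, tau_conj p} \<subseteq> K" for K
  proof (rule max)
    show "subgroup K SO_d_1" using that(1) phi_kernel_subgroup incl_subgroup by blast
    show "K \<subseteq> Gam" using subgroup.subset[OF that(1)] phi_kernel_subset by auto
  qed (use that in auto)
  ultimately show ?thesis unfolding maximal_finite_subgroups_def by blast
qed

lemma conjugate_kernel:
  assumes "g \<in> phi_kernel N"
  shows "g <#\<^bsub>SO_d_1\<lparr>carrier := phi_kernel N\<rparr>\<^esub> H #>\<^bsub>SO_d_1\<lparr>carrier := phi_kernel N\<rparr>\<^esub> inv\<^bsub>SO_d_1\<lparr>carrier := phi_kernel N\<rparr>\<^esub> g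
     = (\<lambda>x. g ** x ** lorentz_inv g) ` H"
proof -
  have "inv\<^bsub>SO_d_1\<lparr>carrier := phi_kernel N\<rparr>\<^esub> g = lorentz_inv g"
  proof -
    have "g \<in> SO" using assms phi_kernel_subset Gam_SO by blast
    then show ?thesis by (simp only: group.m_inv_consistent[OF group_SO_d_1 phi_kernel_subgroup assms] SO_inv(1))
  qed
  then show ?thesis by (auto simp: l_coset_def r_coset_def)
qed

text \<open>
  A conjugation in \<open>phi_kernel N\<close> between conjugates of \<open>\<langle>tau\<rangle>\<close> gives an element of the centralizer of
  \<open>tau\<close>, where \<open>phi\<close> vanishes.
\<close>

lemma num_max_finite_classes_kernel:
  assumes t: "t \<in> Gam" "phi t > 0"
  shows "of_nat n \<le> num_max_finite_classes (SO_d_1\<lparr>carrier := phi_kernel (int n * phi t)\<rparr>)"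
proof -
  interpret group "SO_d_1 :: 'd lmat monoid" by (rule group_SO_d_1)
  define N where "N = int n * phi t"
  let ?H = "SO_d_1\<lparr>carrier := phi_kernel N\<rparr> :: 'd lmat monoid"
  let ?conj = "\<lambda>g K. g <#\<^bsub>?H\<^esub> K #>\<^bsub>?H\<^esub> inv\<^bsub>?H\<^esub> g"
  define p where "p k = t [^]\<^bsub>SO_d_1\<^esub> (k::nat)" for k
  have p: "p k \<in> Gam \<and> phi (p k) = int k * phi t" for k
    using phi_pow[OF t(1)] by (simp add: p_def)
  have pS: "p k \<in> SO" for k using p Gam_SO by auto
  have pt: "phi tau = 0" by (rule phi_centralizer[OF Gam_tau]) simp
  have c: "tau_conj (p k) \<in> phi_kernel N" for k
    using p[of k] by (simp add: phi_kernel_def Gam_mult Gam_tau Gam_inv phi_mult phi_inv pt)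
  define T where "T k = {mat 1, tau_conj (p k)}" for k
  define Cl where "Cl k = orbit ?H ?conj (T k)" for k
  have T: "T k \<in> maximal_finite_subgroups ?H" for k
    unfolding T_def by (rule tau_conj_maximal) (use p c in auto)
  have Cl: "Cl k = {(\<lambda>x. g ** x ** lorentz_inv g) ` T k | g. g \<in> phi_kernel N}" for k
    unfolding Cl_def orbit_def
  proof (intro Collect_cong ex_cong1)
    fix u g
    show "(u = ?conj g (T k) \<and> g \<in> carrier ?H) = (u = (\<lambda>x. g ** x ** lorentz_inv g) ` T k \<and> g \<in> phi_kernel N)"
    proof (cases "g \<in> phi_kernel N")
      case True show ?thesis unfolding conjugate_kernel[OF True] by simp
    qed simp
  qed
  have inj: "inj_on Cl {..<n}"
  proof (rule inj_onI)
    fix j k assume jk: "j \<in> {..<n}" "k \<in> {..<n}" "Cl j = Cl k"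
    have "T k \<in> Cl k"
      unfolding Cl using subgroup.one_closed[OF phi_kernel_subgroup[of N]]
      by (auto simp: lorentz_inv_one intro!: exI[of _ "mat 1"])
    then have "T k \<in> Cl j" by (simp only: jk(3))
    then obtain g where g: "g \<in> phi_kernel N" "T k = (\<lambda>x. g ** x ** lorentz_inv g) ` T j"
      unfolding Cl by blast
    have gG: "g \<in> Gam" "g \<in> SO" using g(1) phi_kernel_subset Gam_SO by auto
    have ne: "tau_conj (p k) \<noteq> mat 1"
    proof
      assume "tau_conj (p k) = mat 1"
      then have "lorentz_inv (p k) ** (tau_conj (p k)) ** p k = lorentz_inv (p k) ** mat 1 ** p k" by simp
      then have "tau = mat 1"
        by (simp only: matrix_mul_assoc[symmetric] SO_inv_mult_cancel(1)[OF pS] lorentz_inv_left[OF pS]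
            matrix_mul_rid matrix_mul_lid)
      then show False using tau_neq_one by simp
    qed
    have "tau_conj (p k) \<in> (\<lambda>x. g ** x ** lorentz_inv g) ` T j" using g(2) by (auto simp: T_def)
    then have e: "tau_conj (p k) = g ** tau_conj (p j) ** lorentz_inv g"
      using ne by (auto simp: T_def lorentz_inv_right[OF gG(2)])
    \<comment> \<open>As \<open>phi\<close> adds up over the three factors, \<open>phi h = 0\<close>
      yields \<open>phi g = (int k - int j) * phi t\<close>, which \<open>N\<close> divides only if
      \<open>n\<close> divides \<open>k - j\<close>.\<close>
    define h where "h = lorentz_inv (p k) ** g ** p j"
    have hG: "h \<in> Gam" unfolding h_def using p gG by (intro Gam_mult Gam_inv) auto
    have "h ** tau = lorentz_inv (p k) ** (g ** tau_conj (p j) ** lorentz_inv g) ** g ** p j"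
      unfolding h_def using SO_inv_mult_cancel[OF pS[of j]] SO_inv_mult_cancel[OF gG(2)]
      by (simp add: matrix_mul_assoc)
    also have "\<dots> = lorentz_inv (p k) ** tau_conj (p k) ** g ** p j" by (simp only: e)
    also have "\<dots> = tau ** h"
      unfolding h_def using SO_inv_mult_cancel[OF pS[of k]] by (simp add: matrix_mul_assoc lorentz_inv_left[OF pS])
    finally have "phi h = 0" by (rule phi_centralizer[OF hG])
    moreover have "phi h = - (int k * phi t) + phi g + int j * phi t"
      unfolding h_def using p gG by (simp add: phi_mult phi_inv Gam_mult Gam_inv)
    moreover have "N dvd phi g" using g(1) by (simp add: phi_kernel_def)
    ultimately have "phi g = (int k - int j) * phi t" "int n * phi t dvd phi g"
      by (simp_all add: N_def algebra_simps)
    then have "int n * phi t dvd (int k - int j) * phi t" by simp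
    then have "int n dvd int k - int j" using t(2) by simp
    then have "int k mod int n = int j mod int n" by (simp add: mod_eq_dvd_iff)
    then show "j = k" using jk by simp
  qed
  have "Cl ` {..<n} \<subseteq> max_finite_classes ?H"
    using T by (auto simp: max_finite_classes_def orbits_def Cl_def)
  then have "emeasure (count_space UNIV) (Cl ` {..<n}) \<le> num_max_finite_classes ?H"
    unfolding num_max_finite_classes_def by (intro emeasure_mono) auto
  moreover have "emeasure (count_space UNIV) (Cl ` {..<n}) = of_nat n"
    using card_image[OF inj] by (subst emeasure_count_space_finite) auto
  ultimately show ?thesis by (simp add: N_def)
qed

text \<open>Since \<open>phi t\<close> generates the image of \<open>phi\<close>, the first
  \<open>n\<close> powers of \<open>t\<close>, starting with the identity, represent the
  cosets.\<close>

lemma covolume_kernel: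
  assumes t: "t \<in> Gam" "phi t > 0" "\<And>g. g \<in> Gam \<Longrightarrow> phi t dvd phi g" and n: "n > 0"
  shows "covolume SO_d_1 \<mu> (phi_kernel (int n * phi t)) = of_nat n * covolume SO_d_1 \<mu> Gam"
proof -
  define p where "p k = t [^]\<^bsub>SO_d_1\<^esub> (k::nat)" for k
  have p: "p k \<in> Gam \<and> phi (p k) = int k * phi t" for k
    using phi_pow[OF t(1)] by (simp add: p_def)
  have inj: "inj_on p {..<n}"
    by (rule inj_onI) (metis p t(2) mult_cancel_right of_nat_eq_iff order_less_irrefl)
  have "covolume SO_d_1 \<mu> (phi_kernel (int n * phi t)) = of_nat (card (p ` {..<n})) * covolume SO_d_1 \<mu> Gam"
  proof (rule covolume_finite_index[OF Gam_subgroup Gam_int phi_kernel_subgroup phi_kernel_subset])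
    show "p ` {..<n} \<subseteq> Gam" using p by auto
    fix \<gamma> assume \<gamma>: "\<gamma> \<in> Gam"
    obtain q where q: "phi \<gamma> = phi t * q" using t(3)[OF \<gamma>] by (auto simp: dvd_def)
    have mem: "\<gamma> ** p k \<in> phi_kernel (int n * phi t) \<longleftrightarrow> int n dvd q + int k" for k
    proof -
      have "phi (\<gamma> ** p k) = (q + int k) * phi t" using p[of k] by (simp add: phi_mult[OF \<gamma>] q algebra_simps)
      then show ?thesis using p[of k] t(2) by (simp add: phi_kernel_def Gam_mult \<gamma>)
    qed
    define k where "k = nat ((- q) mod int n)"
    have k: "int k = (- q) mod int n" "k < n" using n by (simp_all add: k_def nat_less_iff)
    have "int n dvd q + int k" unfolding k(1) by (simp add: dvd_eq_mod_eq_0 mod_simps)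
    show "\<exists>!r. r \<in> p ` {..<n} \<and> \<gamma> ** r \<in> phi_kernel (int n * phi t)"
    proof (rule ex1I[of _ "p k"])
      show "p k \<in> p ` {..<n} \<and> \<gamma> ** p k \<in> phi_kernel (int n * phi t)"
        using k(2) mem \<open>int n dvd q + int k\<close> by simp
      fix r assume "r \<in> p ` {..<n} \<and> \<gamma> ** r \<in> phi_kernel (int n * phi t)"
      then obtain l where l: "r = p l" "l < n" "int n dvd q + int l" using mem by auto
      have "int n dvd (q + int l) - (q + int k)" using l(3) \<open>int n dvd q + int k\<close> by (rule dvd_diff)
      then have "int l mod int n = int k mod int n" by (simp add: mod_eq_dvd_iff)
      then have "l = k" using l(2) k(2) by simp
      then show "r = p k" using l(1) by simp
    qed
  qed (assumption | rule finite_imageI[OF finite_lessThan])+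
  then show ?thesis by (simp add: card_image[OF inj])
qed

end

theorem mainTheorem4:
  fixes \<mu> :: "(real ^ ('d::finite option) ^ ('d option)) measure"
  assumes "CARD('d) \<ge> 2"
    and "haar_measure SO_d_1 \<mu>"
  shows "\<exists>\<Gamma> :: nat \<Rightarrow> (real ^ ('d option) ^ ('d option)) set.
           (\<forall>n. lattice_in SO_d_1 \<mu> (\<Gamma> n)) \<and>
           (\<lambda>n. covolume SO_d_1 \<mu> (\<Gamma> n)) \<longlonglongrightarrow> \<infinity> \<and>
           liminf (\<lambda>n. num_max_finite_classes (SO_d_1\<lparr>carrier := \<Gamma> n\<rparr>)
                        / covolume SO_d_1 \<mu> (\<Gamma> n)) > 0"
proof -
  obtain i1 i2 :: 'd where i12: "i1 \<noteq> i2"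
    using assms(1) by (metis (full_types) UNIV_I card_2_iff' card_le_Suc0_iff_eq finite not_less_eq_eq numeral_2_eq_2)
  interpret so_haar i1 i2 \<mu> by standard (fact i12, fact assms(2))
  obtain t where t: "t \<in> Gam" "phi t > 0" "\<And>g. g \<in> Gam \<Longrightarrow> phi t dvd phi g" using phi_generator by blast
  \<comment> \<open>The successor avoids index zero, where the subgroup would be the kernel of
    \<open>phi\<close>, of infinite index in \<open>Gam\<close>.\<close>
  define \<Gamma> where "\<Gamma> n = phi_kernel (int (Suc n) * phi t)" for n
  have "covolume SO_d_1 \<mu> Gam \<noteq> \<infinity>" using covolume_Gam_finite by simp
  then obtain c where c: "covolume SO_d_1 \<mu> Gam = ennreal c" "c \<ge> 0" by (metis ennreal_cases infinity_ennreal_def)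
  have c0: "c > 0" using covolume_nonzero[OF Gam_subgroup Gam_int] c by (cases "c = 0") auto
  have cov: "covolume SO_d_1 \<mu> (\<Gamma> n) = ennreal (real (Suc n) * c)" for n
    using covolume_kernel[OF t, of "Suc n"] c by (simp add: \<Gamma>_def ennreal_mult ennreal_of_nat_eq_real_of_nat)
  have "lattice_in SO_d_1 \<mu> (\<Gamma> n)" for n
    unfolding lattice_in_def cov
    using phi_kernel_subgroup discrete_int_matrices[of "\<Gamma> n"] Gam_int by (auto simp: \<Gamma>_def phi_kernel_def)
  moreover have "(\<lambda>n. covolume SO_d_1 \<mu> (\<Gamma> n)) \<longlonglongrightarrow> \<infinity>"
  proof -
    have "filterlim (\<lambda>n. real (Suc n) * c) at_top sequentially"
      by (rule filterlim_at_top_mult_tendsto_pos[OF tendsto_const c0])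
        (use filterlim_compose[OF filterlim_real_sequentially filterlim_Suc] in simp)
    then show ?thesis unfolding cov infinity_ennreal_def by (simp add: ennreal_tendsto_top_eq_at_top)
  qed
  moreover have "liminf (\<lambda>n. num_max_finite_classes (SO_d_1\<lparr>carrier := \<Gamma> n\<rparr>) / covolume SO_d_1 \<mu> (\<Gamma> n)) > 0"
  proof -
    \<comment> \<open>Class count and covolume are compared through the common factor
      \<open>Suc n\<close>; what remains is the reciprocal of the covolume of
      \<open>Gam\<close>.\<close>
    have "ennreal (1 / c) \<le> num_max_finite_classes (SO_d_1\<lparr>carrier := \<Gamma> n\<rparr>) / covolume SO_d_1 \<mu> (\<Gamma> n)" for n
    proof -
      have "ennreal (1 / c) = ennreal (real (Suc n)) / ennreal (real (Suc n) * c)"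
        using c0 by (subst divide_ennreal) auto
      also have "\<dots> \<le> num_max_finite_classes (SO_d_1\<lparr>carrier := \<Gamma> n\<rparr>) / covolume SO_d_1 \<mu> (\<Gamma> n)"
        unfolding cov using num_max_finite_classes_kernel[OF t(1,2), of "Suc n"]
        by (intro divide_right_mono_ennreal) (simp only: \<Gamma>_def ennreal_of_nat_eq_real_of_nat)
      finally show ?thesis .
    qed
    then have "ennreal (1 / c) \<le> liminf (\<lambda>n. num_max_finite_classes (SO_d_1\<lparr>carrier := \<Gamma> n\<rparr>) / covolume SO_d_1 \<mu> (\<Gamma> n))"
      by (intro Liminf_bounded always_eventually) auto
    moreover have "ennreal (1 / c) > 0" using c0 by simp
    ultimately show ?thesis by (rule order_less_le_trans[rotated])
  qed
  ultimately show ?thesis by blast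
qed

end
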